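(* There is a universal constant $K>0$ such that the following holds. Let $m\ge 1$ and $n>m+1$ be integers, let $\alpha\in(0,\pi/2]$, $\sigma=\sin\alpha$, $0\le\beta<m$, and $H\ge 1$. Let $\bar a_1,\dots,\bar a_n\in S^m$ be arbitrary, and suppose that, independently for $i=1,\dots,n$, the point $a_i$ is chosen at random from an adversarial distribution $\mu_{\bar a_i}$ on $B(\bar a_i,\alpha)$ with center $\bar a_i$, angular radius $\alpha$ and parameters $\beta,H$. Then the random matrix $A=(a_1,\dots,a_n)\in(S^m)^n$ with rows $a_i$ satisfies $$\mathbb{E}\big(\ln \mathscr{C}(A)\big)\ \le\ K\,\Big(1-\frac{\beta}{m}\Big)^{-2}\ln\frac{nH}{\sigma},$$ where $\mathscr{C}$ is the GCC condition number. In the case $\beta=0$ one has more precisely $$\mathbb{E}\big(\ln \mathscr{C}(A)\big)\ \le\ 12\ln n+17\ln m+6\ln\frac1\sigma+8\ln H+29 .$$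
   Context: $S^m=\{x\in\mathbb{R}^{m+1}: \|x\|=1\}$; $d(a,b)\in[0,\pi]$ is the angular distance on $S^m$; $B(\bar a,\alpha)=\{x\in S^m: d(x,\bar a)\le\alpha\}$. GCC condition number: an element $A=(a_1,\dots,a_n)\in(S^m)^n$ is identified with the $n\times(m+1)$ matrix with rows $a_i$. Its solution set is $\{x\in S^m: \langle a_i,x\rangle\le 0 \text{ for all } i\}$. $A$ is feasible if its solution set is nonempty, and strictly feasible if its solution set has nonempty interior in $S^m$. The set of ill-posed instances $\Sigma_{n,m}$ is the set of feasible instances that are not strictly feasible. On $(S^m)^n$ use the metric $d(A,B)=\max_{1\le i\le n} d(a_i,b_i)$, and put $d(A,\Sigma_{n,m})=\inf\{d(A,B): B\in\Sigma_{n,m}\}$. Then $\mathscr{C}(A)=1/\sin d(A,\Sigma_{n,m})$ (with $\mathscr{C}(A)=\infty$ if $A\in\Sigma_{n,m}$). Adversarial distribution: let $\bar a\in S^m$, $\alpha\in(0,\pi/2]$, $\sigma=\sin\alpha$, and let $\nu$ be the uniform probability measure on $B(\bar a,\alpha)$. For real $k>0$ put $I_k(\alpha)=\int_0^\alpha(\sin t)^{k-1}\,dt$. An adversarial distribution $\mu_{\bar a}$ on $B(\bar a,\alpha)$ with center $\bar a$ and parameters $\beta,H$ (where $0\le\beta<m$) is a probability measure of the form $\mu_{\bar a}(G)=\int_G f\,d\nu$ whose density is $f(x)=g(\sin d(x,\bar a))$, where $g\colon[0,\sigma]\to[0,\infty]$ is monotonically decreasing (in the weak sense) and has the form $g(r)=C\,r^{-\beta}h(r)$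 with $C=I_m(\alpha)/I_{m-\beta}(\alpha)$ and $h\colon[0,\sigma]\to[0,\infty)$ continuous with $h(0)\neq0$; and $H=\sup_{0\le r\le\sigma}h(r)$. (Being a probability measure amounts to $I_{m-\beta}(\alpha)=\int_0^\alpha(\sin t)^{m-\beta-1}h(\sin t)\,dt$, and then automatically $H\ge1$.) *)

theory Defs
  imports "HOL-Probability.Probability"
begin

text \<open>
  Since \<open>m\<close> is quantified inside the theorem, \<open>\<real>\<^sup>m\<^sup>+\<^sup>1\<close> is taken as the set of sequences
  \<open>nat \<Rightarrow> real\<close> vanishing beyond index \<open>m\<close> (as in \<^const>\<open>Euclidean_space\<close>), and
  \<open>S\<^sup>m\<close> is the library's \<^const>\<open>nsphere\<close>. A tuple in \<open>(S\<^sup>m)\<^sup>n\<close> is an extensional function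
  on \<open>{..<n}\<close>, so that \<open>A i\<close> is row \<open>i\<close> of the matrix \<open>A\<close>.
\<close>

abbreviation Sph :: "nat \<Rightarrow> (nat \<Rightarrow> real) set" where
  "Sph m \<equiv> topspace (nsphere m)"

definition dotp :: "nat \<Rightarrow> (nat \<Rightarrow> real) \<Rightarrow> (nat \<Rightarrow> real) \<Rightarrow> real" where
  "dotp m x y = (\<Sum>i\<le>m. x i * y i)"

definition ang :: "nat \<Rightarrow> (nat \<Rightarrow> real) \<Rightarrow> (nat \<Rightarrow> real) \<Rightarrow> real" where
  "ang m x y = arccos (dotp m x y)"

definition cap :: "nat \<Rightarrow> (nat \<Rightarrow> real) \<Rightarrow> real \<Rightarrow> (nat \<Rightarrow> real) set" where
  "cap m a \<alpha> = {x \<in> Sph m. ang m x a \<le> \<alpha>}"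

subsection \<open>The GCC condition number\<close>

definition instances :: "nat \<Rightarrow> nat \<Rightarrow> (nat \<Rightarrow> nat \<Rightarrow> real) set" where
  "instances n m = {..<n} \<rightarrow>\<^sub>E Sph m"

definition solution_set :: "nat \<Rightarrow> nat \<Rightarrow> (nat \<Rightarrow> nat \<Rightarrow> real) \<Rightarrow> (nat \<Rightarrow> real) set" where
  "solution_set n m A = {x \<in> Sph m. \<forall>i<n. dotp m (A i) x \<le> 0}"

definition feasible :: "nat \<Rightarrow> nat \<Rightarrow> (nat \<Rightarrow> nat \<Rightarrow> real) \<Rightarrow> bool" where
  "feasible n m A \<longleftrightarrow> solution_set n m A \<noteq> {}"

definition strictly_feasible :: "nat \<Rightarrow> nat \<Rightarrow> (nat \<Rightarrow> nat \<Rightarrow> real) \<Rightarrow> bool" where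
  "strictly_feasible n m A \<longleftrightarrow> nsphere m interior_of solution_set n m A \<noteq> {}"

definition ill_posed :: "nat \<Rightarrow> nat \<Rightarrow> (nat \<Rightarrow> nat \<Rightarrow> real) set" where
  "ill_posed n m = {A \<in> instances n m. feasible n m A \<and> \<not> strictly_feasible n m A}"

definition inst_dist :: "nat \<Rightarrow> nat \<Rightarrow> (nat \<Rightarrow> nat \<Rightarrow> real) \<Rightarrow> (nat \<Rightarrow> nat \<Rightarrow> real) \<Rightarrow> real" where
  "inst_dist n m A B = Max ((\<lambda>i. ang m (A i) (B i)) ` {..<n})"

definition dist_ill_posed :: "nat \<Rightarrow> nat \<Rightarrow> (nat \<Rightarrow> nat \<Rightarrow> real) \<Rightarrow> real" where
  "dist_ill_posed n m A = (INF B\<in>ill_posed n m. inst_dist n m A B)"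

definition gcc :: "nat \<Rightarrow> nat \<Rightarrow> (nat \<Rightarrow> nat \<Rightarrow> real) \<Rightarrow> ennreal" where
  "gcc n m A =
     (if A \<in> ill_posed n m then \<infinity> else 1 / ennreal (sin (dist_ill_posed n m A)))"

text \<open>
  The logarithm on \<open>[1,\<infinity>]\<close>, with \<open>ln \<infinity> = \<infinity>\<close>. Values below \<open>1\<close>, which \<^const>\<open>gcc\<close>
  never attains since \<open>sin \<le> 1\<close>, would be truncated to \<open>0\<close>.
\<close>
definition ln_ennreal :: "ennreal \<Rightarrow> ennreal" where
  "ln_ennreal x = (if x = \<infinity> then \<infinity> else ennreal (ln (enn2real x)))"

subsection \<open>Adversarial distributions\<close>

text \<open>
  The uniform probability measure on \<open>S\<^sup>m\<close>, as a measure with underlying space \<open>S\<^sup>m\<close>: the image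
  of the uniform distribution on the unit ball of \<open>\<real>\<^sup>m\<^sup>+\<^sup>1\<close> under the radial projection
  \<open>x \<mapsto> x / \<parallel>x\<parallel>\<close> (the origin, a null set, is mapped to \<open>0\<close>, outside \<open>S\<^sup>m\<close>).
\<close>
definition sphere_measure :: "nat \<Rightarrow> (nat \<Rightarrow> real) measure" where
  "sphere_measure m =
     (let L = (\<Pi>\<^sub>M i\<in>{..m}. lborel) in
      restrict_space
        (distr (uniform_measure L {x \<in> space L. L2_set x {..m} \<le> 1}) borel
           (\<lambda>x i. if i \<le> m then x i / L2_set x {..m} else 0))
        (Sph m))"

definition cap_measure :: "nat \<Rightarrow> (nat \<Rightarrow> real) \<Rightarrow> real \<Rightarrow> (nat \<Rightarrow> real) measure" where
  "cap_measure m a \<alpha> = uniform_measure (sphere_measure m) (cap m a \<alpha>)"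

definition sin_int :: "real \<Rightarrow> real \<Rightarrow> real" where
  "sin_int k \<alpha> = integral {0..\<alpha>} (\<lambda>t. sin t powr (k - 1))"

text \<open>
  \<open>r\<^sup>-\<^sup>\<beta>\<close> for \<open>r, \<beta> \<ge> 0\<close> with values in \<open>[0,\<infinity>]\<close>. At \<open>r = 0\<close> it is \<open>\<infinity>\<close> for \<open>\<beta> > 0\<close> and \<open>1\<close> for
  \<open>\<beta> = 0\<close>; the case distinction is needed because \<open>0 powr 0 = 0\<close>.
\<close>
definition neg_power :: "real \<Rightarrow> real \<Rightarrow> ennreal" where
  "neg_power r \<beta> = (if \<beta> = 0 then 1 else inverse (ennreal (r powr \<beta>)))"

definition adversarial ::
  "nat \<Rightarrow> real \<Rightarrow> real \<Rightarrow> real \<Rightarrow> (nat \<Rightarrow> real) \<Rightarrow> (nat \<Rightarrow> real) measure \<Rightarrow> bool" where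
  "adversarial m \<alpha> \<beta> H a \<mu> \<longleftrightarrow>
     prob_space \<mu> \<and>
     (\<exists>(g :: real \<Rightarrow> ennreal) (h :: real \<Rightarrow> real).
        \<mu> = density (cap_measure m a \<alpha>) (\<lambda>x. g (sin (ang m x a))) \<and>
        antimono_on {0..sin \<alpha>} g \<and>
        (\<forall>r\<in>{0..sin \<alpha>}.
           g r = ennreal (sin_int m \<alpha> / sin_int (m - \<beta>) \<alpha>) * neg_power r \<beta> * ennreal (h r)) \<and>
        continuous_on {0..sin \<alpha>} h \<and> (\<forall>r\<in>{0..sin \<alpha>}. 0 \<le> h r) \<and> h 0 \<noteq> 0 \<and>
        H = (SUP r\<in>{0..sin \<alpha>}. h r))"

end

theory Submission
  imports Defs
begin

text \<open>
  Let \<open>\<Xi>(A)\<close> be the minimum over unit vectors \<open>x\<close> of \<open>max\<^sub>i \<langle>a\<^sub>i, x\<rangle>\<close>. It vanishes on the ill-posed instances and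
  changes by at most the angular distance, so \<open>\<C>(A)\<close> is at most a constant times \<open>1 / \<bar>\<Xi>(A)\<bar>\<close>, and it suffices to
  bound the probability that \<open>\<bar>\<Xi>(A)\<bar>\<close> is small. In that case some row \<open>a\<^sub>i\<close> lies in a thin slab
  \<open>- \<delta> \<le> min \<langle>a\<^sub>i, w\<rangle> \<le> \<delta>\<close>, the minimum being over the unit vectors \<open>w\<close> of the polar cone of finitely many
  other rows: if \<open>A\<close> is feasible, all other rows are used; if not, one uses the rows preceding the first
  one at which feasibility is lost, unless these already have a small margin themselves.

  The slab is a neighbourhood of the boundary of a convex cone. A point \<open>y\<close> of it leaves the convex set
  \<open>{y. \<forall>w. \<langle>y, w\<rangle> \<ge> - \<delta>}\<close> when it is moved by \<open>O(\<delta> m)\<close> along some coordinate axis, and the successive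
  translates of the set of such points are disjoint. Many of them fit into a slightly enlarged copy of the
  sector of the unit ball over a cap, so the slab has at most \<open>O(m\<^sup>3 \<delta> / \<sigma>)\<close> times the volume of the sector;
  this uses nothing but the behaviour of Lebesgue measure under translations and homotheties. The argument applies
  to densities with convex superlevel sets; a singular density is truncated near its centre, and the
  removed mass is estimated dyadically.
\<close>

subsection \<open>Ill-posedness and margins\<close>

text \<open>The three factors m in the slab bound have separate origins. There are 2(m+1) signed
  axis directions. A unit vector may have no coordinate much larger than its guaranteed 1/(m+1), so
  the steps have length 3\<delta>(m+1). The homothety that dominates the translates enlarges by 1 +
  1/(m+1), which keeps its volume factor below e and limits the total shift to order s/(m+1).

  The infeasible case shapes the union of events: omitting one row may leave an infeasible system,
  whose polar cone has no unit vector and hence no slab. A prefix that is still feasible avoids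
  this, and its polar cone does not involve the row under study.

  Two losses fix the exponents. The infeasible case needs margin \<eta>^2/3 for slabs of width about
  \<eta>, which doubles the logarithm. For a singular density, cutting at relative radius sqrt
  \<delta> leaves the power \<gamma>/2 of \<delta>, where \<gamma> = 1 - \<beta>/m. Integrating that
  tail costs 1/\<gamma>; absorbing ln (1/\<gamma>) costs the second such factor.\<close>

lemma dotp_simps:
  "dotp m (\<lambda>i. x i + y i) z = dotp m x z + dotp m y z"
  "dotp m z (\<lambda>i. x i + y i) = dotp m z x + dotp m z y"
  "dotp m (\<lambda>i. x i - y i) z = dotp m x z - dotp m y z"
  "dotp m z (\<lambda>i. x i - y i) = dotp m z x - dotp m z y"
  "dotp m (\<lambda>i. c * x i) z = c * dotp m x z"
  "dotp m z (\<lambda>i. c * x i) = c * dotp m z x"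
  "dotp m (\<lambda>i. x i / c) z = dotp m x z / c"
  "dotp m z (\<lambda>i. x i / c) = dotp m z x / c"
  "dotp m (\<lambda>i. - x i) z = - dotp m x z"
  "dotp m z (\<lambda>i. - x i) = - dotp m z x"
  by (simp_all add: dotp_def sum.distrib sum_subtractf sum_distrib_left sum_divide_distrib
      sum_negf algebra_simps)

lemma dotp_commute: "dotp m x y = dotp m y x"
  by (simp add: dotp_def mult.commute)

lemma dotp_sum_right: "dotp m z (\<lambda>i. \<Sum>k\<in>I. x k i) = (\<Sum>k\<in>I. dotp m z (x k))"
  unfolding dotp_def by (subst sum.swap) (simp add: sum_distrib_left)

lemma dotp_cong: "(\<And>i. i \<le> m \<Longrightarrow> x i = x' i) \<Longrightarrow> (\<And>i. i \<le> m \<Longrightarrow> y i = y' i) \<Longrightarrow> dotp m x y = dotp m x' y'"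
  by (simp add: dotp_def)

lemma L2_set_dotp: "L2_set x {..m} = sqrt (dotp m x x)"
  by (simp add: L2_set_def dotp_def power2_eq_square)

lemma dotp_self_nonneg [simp]: "0 \<le> dotp m x x"
  by (simp add: dotp_def sum_nonneg)

lemma L2_set_power2: "(L2_set x {..m})\<^sup>2 = dotp m x x"
  by (simp add: L2_set_dotp)

lemma abs_dotp_le: "\<bar>dotp m x y\<bar> \<le> L2_set x {..m} * L2_set y {..m}"
proof -
  have "\<bar>dotp m x y\<bar> \<le> (\<Sum>i\<le>m. \<bar>x i\<bar> * \<bar>y i\<bar>)"
    unfolding dotp_def by (rule order_trans[OF sum_abs]) (simp add: abs_mult)
  also have "\<dots> \<le> L2_set x {..m} * L2_set y {..m}" by (rule L2_set_mult_ineq)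
  finally show ?thesis .
qed

lemma Sph_iff: "x \<in> Sph m \<longleftrightarrow> dotp m x x = 1 \<and> (\<forall>i>m. x i = 0)"
  by (simp add: nsphere dotp_def power2_eq_square)

lemma Sph_L2 [simp]: "x \<in> Sph m \<Longrightarrow> L2_set x {..m} = 1"
  by (simp add: Sph_iff L2_set_dotp)

lemma Sph_dotp_self [simp]: "x \<in> Sph m \<Longrightarrow> dotp m x x = 1"
  by (simp add: Sph_iff)

lemma abs_dotp_Sph_le: "x \<in> Sph m \<Longrightarrow> y \<in> Sph m \<Longrightarrow> \<bar>dotp m x y\<bar> \<le> 1"
  using abs_dotp_le[of m x y] by simp

lemma Sph_nonempty: "\<exists>x. x \<in> Sph m"
  using in_topspace_nsphere by blast

lemma normalize_in_Sph:
  assumes "dotp m x x > 0" "\<And>i. i > m \<Longrightarrow> x i = 0"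
  shows "(\<lambda>i. x i / L2_set x {..m}) \<in> Sph m"
proof -
  have "sqrt (dotp m x x) * sqrt (dotp m x x) = dotp m x x" using assms by simp
  then show ?thesis using assms by (simp add: Sph_iff dotp_simps L2_set_dotp)
qed

lemma ang_nonneg: "x \<in> Sph m \<Longrightarrow> y \<in> Sph m \<Longrightarrow> 0 \<le> ang m x y"
  using abs_dotp_Sph_le[of x m y] by (auto simp: ang_def intro!: arccos_lbound)

lemma cos_ang: "x \<in> Sph m \<Longrightarrow> y \<in> Sph m \<Longrightarrow> cos (ang m x y) = dotp m x y"
  using abs_dotp_Sph_le[of x m y] by (auto simp: ang_def intro!: cos_arccos)

text \<open>The chord is at most the arc: |a - b|^2 = 2 - 2 cos t = 4 sin^2(t/2) \<le> t^2.
  Cauchy-Schwarz does the rest.\<close>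

lemma abs_dotp_diff_le_ang:
  assumes "a \<in> Sph m" "b \<in> Sph m" "z \<in> Sph m"
  shows "\<bar>dotp m a z - dotp m b z\<bar> \<le> ang m a b"
proof -
  let ?t = "ang m a b"
  have c: "1 - cos ?t = 2 * (sin (?t/2))\<^sup>2"
    using cos_double_sin[of "?t/2"] by simp
  have "\<bar>sin (?t/2)\<bar> \<le> \<bar>?t/2\<bar>" by (rule abs_sin_x_le_abs_x)
  then have "(sin (?t/2))\<^sup>2 \<le> (?t/2)\<^sup>2" by (rule abs_le_square_iff[THEN iffD1])
  then have "2 - 2 * cos ?t \<le> ?t\<^sup>2" using c by (simp add: power2_eq_square)
  moreover have "dotp m (\<lambda>i. a i - b i) (\<lambda>i. a i - b i) = 2 - 2 * cos ?t"
    using assms by (simp add: dotp_simps cos_ang dotp_commute[of m b a])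
  ultimately have "L2_set (\<lambda>i. a i - b i) {..m} \<le> ?t"
    unfolding L2_set_dotp using ang_nonneg[OF assms(1,2)] by (intro real_le_lsqrt) auto
  moreover have "\<bar>dotp m a z - dotp m b z\<bar> \<le> L2_set (\<lambda>i. a i - b i) {..m}"
    using abs_dotp_le[of m "\<lambda>i. a i - b i" z] assms by (simp add: dotp_simps)
  ultimately show ?thesis by linarith
qed

lemma continuous_map_dotp: "continuous_map (nsphere m) euclideanreal (\<lambda>x. dotp m b x)"
  unfolding dotp_def
  by (intro continuous_intros continuous_map_nsphere_projection) auto

lemma strictly_feasibleI:
  assumes "z \<in> Sph m" "\<And>i. i < n \<Longrightarrow> dotp m (B i) z < 0"
  shows "strictly_feasible n m B"
proof -
  have op: "openin (nsphere m) {x \<in> Sph m. \<forall>i<n. dotp m (B i) x < 0}" for n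
  proof (induction n)
    case (Suc n)
    have "openin (nsphere m) {x \<in> Sph m. dotp m (B n) x \<in> {..<0}}"
      by (rule openin_continuous_map_preimage[OF continuous_map_dotp]) auto
    from openin_Int[OF Suc this] show ?case
      by (rule back_subst) (auto simp: less_Suc_eq)
  qed auto
  have "z \<in> nsphere m interior_of solution_set n m B"
    unfolding interior_of_def
  proof (intro CollectI exI conjI)
    show "openin (nsphere m) {x \<in> Sph m. \<forall>i<n. dotp m (B i) x < 0}" by (rule op)
  qed (use assms in \<open>auto simp: solution_set_def less_imp_le simp del: topspace_subtopology\<close>)
  then show ?thesis by (auto simp: strictly_feasible_def)
qed

lemma inst_dist_ge: "i < n \<Longrightarrow> ang m (A i) (B i) \<le> inst_dist n m A B"
  unfolding inst_dist_def by (rule Max_ge) auto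

text \<open>Moving every row by less than \<open>e\<close> changes each inner product with a unit
  vector by less than \<open>e\<close>. The first alternative then leaves the instance strictly
  feasible, the second leaves it infeasible, and neither is ill-posed.\<close>

lemma inst_dist_ge_margin:
  assumes A: "A \<in> instances n m" and B: "B \<in> ill_posed n m" and n: "n > 0"
    and e: "(\<exists>z\<in>Sph m. \<forall>i<n. dotp m (A i) z \<le> -e) \<or> (\<forall>x\<in>Sph m. \<exists>i<n. dotp m (A i) x \<ge> e)"
  shows "e \<le> inst_dist n m A B"
proof (rule ccontr)
  assume "\<not> ?thesis"
  then have lt: "ang m (A i) (B i) < e" if "i < n" for i
    using inst_dist_ge[OF that, of m A B] by linarith
  have Bi: "B \<in> instances n m" "feasible n m B" "\<not> strictly_feasible n m B"
    using B by (auto simp: ill_posed_def)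
  have mem: "A i \<in> Sph m" "B i \<in> Sph m" if "i < n" for i
    using A Bi(1) that by (auto simp: instances_def)
  have diff: "\<bar>dotp m (A i) z - dotp m (B i) z\<bar> < e" if "i < n" "z \<in> Sph m" for i z
    using abs_dotp_diff_le_ang[OF mem[OF that(1)] that(2)] lt[OF that(1)] by linarith
  from e show False
  proof
    assume "\<exists>z\<in>Sph m. \<forall>i<n. dotp m (A i) z \<le> -e"
    then obtain z where z: "z \<in> Sph m" "\<And>i. i < n \<Longrightarrow> dotp m (A i) z \<le> -e" by blast
    have "dotp m (B i) z < 0" if "i < n" for i
      using diff[OF that z(1)] z(2)[OF that] by linarith
    then show False using strictly_feasibleI[OF z(1)] Bi(3) by blast
  next
    assume *: "\<forall>x\<in>Sph m. \<exists>i<n. dotp m (A i) x \<ge> e"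
    from Bi(2) obtain x where x: "x \<in> Sph m" "\<And>i. i < n \<Longrightarrow> dotp m (B i) x \<le> 0"
      by (auto simp: feasible_def solution_set_def)
    from * x obtain i where "i < n" "dotp m (A i) x \<ge> e" by blast
    then show False using diff[OF \<open>i < n\<close> x(1)] x(2)[OF \<open>i < n\<close>] by linarith
  qed
qed

text \<open>Turning the first two coordinates by a right angle gives an orthogonal vector; m \<ge> 1
  provides the second coordinate.\<close>

lemma orthogonal_unit_exists:
  assumes "m \<ge> 1"
  shows "\<exists>e\<in>Sph m. dotp m a e = 0"
proof (cases "a 0 = 0 \<and> a 1 = 0")
  case True
  have "dotp m a (\<lambda>n. if n = 0 then 1 else 0) = 0"
    unfolding dotp_def using True by (intro sum.neutral) auto
  then show ?thesis using in_topspace_nsphere[of m] by blast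
next
  case False
  define v where "v = (\<lambda>i::nat. if i = 0 then - a 1 else if i = 1 then a 0 else 0)"
  have s: "(\<Sum>i\<le>m. f i) = f 0 + f 1" if "\<And>i. i \<ge> 2 \<Longrightarrow> f i = 0" for f :: "nat \<Rightarrow> real"
  proof -
    have "(\<Sum>i\<le>m. f i) = (\<Sum>i\<in>{0,1}. f i)"
      using assms by (intro sum.mono_neutral_right) (auto intro!: that)
    then show ?thesis by simp
  qed
  have "dotp m v v = (a 1)\<^sup>2 + (a 0)\<^sup>2"
    unfolding dotp_def by (subst s) (auto simp: v_def power2_eq_square)
  then have pos: "dotp m v v > 0" using False by (auto simp: sum_power2_gt_zero_iff)
  have "dotp m a v = 0" unfolding dotp_def by (subst s) (auto simp: v_def)
  then have "dotp m a (\<lambda>i. v i / L2_set v {..m}) = 0" by (simp add: dotp_simps)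
  moreover have "(\<lambda>i. v i / L2_set v {..m}) \<in> Sph m"
    using pos assms by (intro normalize_in_Sph) (auto simp: v_def)
  ultimately show ?thesis by blast
qed

lemma great_circle:
  assumes x: "x \<in> Sph m" and e: "e \<in> Sph m" and xe: "dotp m e x = 0"
  shows "continuous_map euclideanreal (nsphere m) (\<lambda>t i. cos t * x i + sin t * e i)"
proof -
  have "(\<lambda>i. cos t * x i + sin t * e i) \<in> Sph m" for t
    using x e xe sin_cos_squared_add2[of t]
    by (auto simp: Sph_iff dotp_simps dotp_commute[of m x e] power2_eq_square algebra_simps)
  then show ?thesis
    unfolding nsphere continuous_map_in_subtopology continuous_map_componentwise_UNIV
    by (auto intro!: continuous_intros simp: nsphere)
qed

text \<open>As both signs occur, the solution set is the great subsphere orthogonal to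
  \<open>e\<close>. The point \<open>y\<close> lies in it, and the great circle from any of its
  points towards \<open>e\<close> leaves it at once, so it has no interior.\<close>

lemma plus_minus_ill_posed:
  assumes e: "e \<in> Sph m" and y: "y \<in> Sph m" "dotp m e y = 0"
    and s: "\<And>i. i < n \<Longrightarrow> s i = 1 \<or> s i = (-1::real)"
    and ij: "p < n" "q < n" "s p = 1" "s q = -1"
  shows "(\<lambda>i\<in>{..<n}. \<lambda>k. s i * e k) \<in> ill_posed n m" (is "?B \<in> _")
proof -
  have "?B \<in> instances n m"
    using e s by (auto simp: instances_def Sph_iff dotp_simps) (use s in fastforce)+
  moreover have sol: "x \<in> solution_set n m ?B \<longleftrightarrow> x \<in> Sph m \<and> dotp m e x = 0" for x
  proof
    assume "x \<in> solution_set n m ?B"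
    then have "x \<in> Sph m" and *: "\<And>i. i < n \<Longrightarrow> s i * dotp m e x \<le> 0"
      by (auto simp: solution_set_def dotp_simps)
    with *[OF ij(1)] *[OF ij(2)] ij show "x \<in> Sph m \<and> dotp m e x = 0" by simp
  next
    assume "x \<in> Sph m \<and> dotp m e x = 0"
    then show "x \<in> solution_set n m ?B" by (auto simp: solution_set_def dotp_simps)
  qed
  moreover have "feasible n m ?B" using sol y by (auto simp: feasible_def)
  moreover have "\<not> strictly_feasible n m ?B"
  proof
    assume "strictly_feasible n m ?B"
    then obtain T x where T: "openin (nsphere m) T" "x \<in> T" "T \<subseteq> solution_set n m ?B"
      by (auto simp: strictly_feasible_def interior_of_def)
    let ?g = "\<lambda>t i. cos t * x i + sin t * e i"
    have x: "x \<in> Sph m" "dotp m e x = 0" using T sol by auto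
    have "openin euclideanreal {t \<in> topspace euclideanreal. ?g t \<in> T}"
      by (rule openin_continuous_map_preimage[OF great_circle[OF x(1) e x(2)] T(1)])
    then have "open {t. ?g t \<in> T}" by simp
    moreover have "0 \<in> {t. ?g t \<in> T}" using T(2) by simp
    ultimately obtain d where d: "d > 0" "ball 0 d \<subseteq> {t. ?g t \<in> T}"
      by (meson open_contains_ball_eq)
    define t where "t = min (d/2) 1"
    have t: "0 < t" "t \<le> 1" "t < d" using d by (auto simp: t_def)
    then have "t \<in> {t. ?g t \<in> T}" using d(2) by (intro subsetD[OF d(2)]) auto
    then have "dotp m e (?g t) = 0" using T(3) sol by blast
    then have "sin t = 0" using x e by (simp add: dotp_simps)
    moreover have "sin t > 0" using t pi_gt3 by (intro sin_gt_zero) auto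
    ultimately show False by simp
  qed
  ultimately show ?thesis by (simp add: ill_posed_def)
qed

text \<open>This makes the infimum in \<open>dist_ill_posed\<close> run over a nonempty set and
  keeps it in the range where the sine increases.\<close>

lemma ill_posed_within_right_angle:
  assumes A: "A \<in> instances n m" and m: "m \<ge> 1" and n: "n > 1"
  shows "\<exists>B\<in>ill_posed n m. inst_dist n m A B \<le> pi / 2"
proof -
  have mem: "A i \<in> Sph m" if "i < n" for i using A that by (auto simp: instances_def)
  obtain e where e: "e \<in> Sph m" "dotp m (A 0) e = 0" using orthogonal_unit_exists[OF m] by blast
  \<comment> \<open>Row 0 is orthogonal to \<open>e\<close>, so either sign keeps it at a right
    angle; it takes the sign opposite to row 1, so that both signs occur.\<close>
  define s where "s i = (if i = 0 then (if dotp m (A 1) e \<ge> 0 then -1 else 1)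
      else (if dotp m (A i) e \<ge> 0 then 1 else (-1::real)))" for i
  let ?B = "\<lambda>i\<in>{..<n}. \<lambda>k. s i * e k"
  have s: "s i = 1 \<or> s i = -1" for i by (auto simp: s_def)
  have "\<exists>p q. p < n \<and> q < n \<and> s p = 1 \<and> s q = -1"
  proof (cases "dotp m (A 1) e \<ge> 0")
    case True then show ?thesis using n by (intro exI[of _ 1] exI[of _ 0]) (auto simp: s_def)
  next
    case False then show ?thesis using n by (intro exI[of _ 0] exI[of _ 1]) (auto simp: s_def)
  qed
  then have "?B \<in> ill_posed n m"
    using plus_minus_ill_posed[OF e(1) mem[of 0]] e(2) s n by (auto simp: dotp_commute[of m e])
  moreover have "ang m (A i) (?B i) \<le> pi / 2" if "i < n" for i
  proof -
    have B: "?B i \<in> Sph m"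
      using \<open>?B \<in> ill_posed n m\<close> that by (auto simp: ill_posed_def instances_def)
    have "0 \<le> s i * dotp m (A i) e" using e(2) by (auto simp: s_def)
    then have "0 \<le> dotp m (A i) (?B i)" using that by (simp add: dotp_simps)
    then show ?thesis
      using abs_dotp_Sph_le[OF mem[OF that] B] unfolding ang_def by (intro arccos_le_pi2) auto
  qed
  then have "inst_dist n m A ?B \<le> pi / 2"
    unfolding inst_dist_def using n by (subst Max_le_iff) auto
  ultimately show ?thesis by blast
qed

lemma ln_gcc_le:
  assumes A: "A \<in> instances n m" and m: "m \<ge> 1" and n: "n > 1" and e: "e > 0" and e1: "e \<le> 1"
    and margin: "(\<exists>z\<in>Sph m. \<forall>i<n. dotp m (A i) z \<le> -e) \<or> (\<forall>x\<in>Sph m. \<exists>i<n. dotp m (A i) x \<ge> e)"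
  shows "ln_ennreal (gcc n m A) \<le> ennreal (ln 2 - ln e)"
proof -
  have ge: "e \<le> inst_dist n m A B" if "B \<in> ill_posed n m" for B
    using inst_dist_ge_margin[OF A that _ margin] n by simp
  have notin: "A \<notin> ill_posed n m"
  proof
    assume "A \<in> ill_posed n m"
    from ge[OF this] have "e \<le> inst_dist n m A A" .
    moreover have "inst_dist n m A A = 0"
    proof -
      have "ang m (A i) (A i) = 0" if "i < n" for i
      proof -
        have "A i \<in> Sph m" using A that by (auto simp: instances_def)
        from Sph_dotp_self[OF this] show ?thesis by (simp add: ang_def)
      qed
      then have "(\<lambda>i. ang m (A i) (A i)) ` {..<n} = {0}"
        using n by (auto simp: image_constant_conv lessThan_empty_iff cong: image_cong_simp)
      then show ?thesis by (simp add: inst_dist_def)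
    qed
    ultimately show False using e by simp
  qed
  obtain B where B: "B \<in> ill_posed n m" "inst_dist n m A B \<le> pi / 2"
    using ill_posed_within_right_angle[OF A m n] by blast
  let ?d = "dist_ill_posed n m A"
  have d1: "e \<le> ?d" unfolding dist_ill_posed_def using B ge by (intro cINF_greatest) auto
  have d2: "?d \<le> pi / 2"
    unfolding dist_ill_posed_def using B ge by (intro cINF_lower2[OF _ B(1)] bdd_belowI2) auto
  have le: "e / 2 \<le> sin ?d"
  proof -
    \<comment> \<open>Mean value theorem: e \<le> 1 < pi/3 makes the derivative of the sine at least
      1/2, whence sin e \<ge> e/2.\<close>
    have "\<exists>z. 0 < z \<and> z < e \<and> sin e - sin 0 = (e - 0) * cos z"
      using e by (intro MVT2) (auto intro!: derivative_eq_intros)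
    then obtain z where z: "0 < z" "z < e" "sin e = e * cos z" by auto
    have "cos (pi / 3) \<le> cos z"
      using z e1 pi_gt3 by (intro cos_monotone_0_pi_le) auto
    then have "e * (1 / 2) \<le> sin e" using z(3) e by (simp add: cos_60)
    also have "\<dots> \<le> sin ?d" using d1 d2 e by (intro sin_monotone_2pi_le) auto
    finally show ?thesis by simp
  qed
  have s: "0 < sin ?d" using le e by linarith
  have "gcc n m A = ennreal (1 / sin ?d)"
    using notin s by (simp add: gcc_def divide_ennreal[symmetric])
  then have "ln_ennreal (gcc n m A) = ennreal (ln (1 / sin ?d))"
    using s by (simp add: ln_ennreal_def)
  also have "\<dots> \<le> ennreal (ln (1 / (e / 2)))"
  proof (intro ennreal_leI ln_mono)
    show "1 / sin ?d \<le> 1 / (e / 2)" by (rule divide_left_mono) (use le e s in auto)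
  qed (use s in auto)
  also have "ln (1 / (e / 2)) = ln 2 - ln e"
    using e by (simp add: ln_div ln_mult)
  finally show ?thesis .
qed

subsection \<open>Slabs in sectors of the unit ball\<close>

abbreviation LM :: "nat \<Rightarrow> (nat \<Rightarrow> real) measure" where
  "LM m \<equiv> \<Pi>\<^sub>M i\<in>{..m}. lborel"

text \<open>The dimension is a variable, so volume is a finite product of copies of
  \<open>lborel\<close>; iterated integration reduces the substitution to one coordinate at a
  time.\<close>

lemma nn_integral_PiM_lborel_affine:
  fixes c :: real and d :: "'i \<Rightarrow> real"
  assumes "finite I" "c > 0" "f \<in> borel_measurable (\<Pi>\<^sub>M i\<in>I. lborel)"
  shows "(\<integral>\<^sup>+x. f x \<partial>(\<Pi>\<^sub>M i\<in>I. lborel)) =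
    ennreal (c ^ card I) * (\<integral>\<^sup>+x. f (\<lambda>i\<in>I. d i + c * x i) \<partial>(\<Pi>\<^sub>M i\<in>I. lborel))"
  using assms
proof (induction I arbitrary: f rule: finite_induct)
  case empty
  then show ?case
    by (simp add: PiM_empty nn_integral_count_space_finite restrict_def)
next
  case (insert i I)
  interpret product_sigma_finite "\<lambda>_::'i. lborel :: real measure" by standard
  note [measurable] = insert.prems(2)
  have "(\<integral>\<^sup>+x. f x \<partial>(\<Pi>\<^sub>M i\<in>insert i I. lborel)) =
      (\<integral>\<^sup>+x. (\<integral>\<^sup>+y. f (x(i := y)) \<partial>lborel) \<partial>(\<Pi>\<^sub>M i\<in>I. lborel))"
    by (rule product_nn_integral_insert) (use insert in auto)
  also have "\<dots> = (\<integral>\<^sup>+x. ennreal c * (\<integral>\<^sup>+y. f (x(i := d i + c * y)) \<partial>lborel) \<partial>(\<Pi>\<^sub>M i\<in>I. lborel))"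
  proof (intro nn_integral_cong)
    fix x :: "'i \<Rightarrow> real" assume [measurable]: "x \<in> space (\<Pi>\<^sub>M i\<in>I. lborel)"
    have "(\<lambda>y. f (x(i := y))) \<in> borel_measurable borel" by measurable
    from nn_integral_real_affine[OF this, of c "d i"] insert.prems(1)
    show "(\<integral>\<^sup>+y. f (x(i := y)) \<partial>lborel) = ennreal c * (\<integral>\<^sup>+y. f (x(i := d i + c * y)) \<partial>lborel)"
      by simp
  qed
  also have "\<dots> = ennreal c * (\<integral>\<^sup>+x. (\<integral>\<^sup>+y. f (x(i := d i + c * y)) \<partial>lborel) \<partial>(\<Pi>\<^sub>M i\<in>I. lborel))"
    by (rule nn_integral_cmult) measurable
  also have "(\<integral>\<^sup>+x. (\<integral>\<^sup>+y. f (x(i := d i + c * y)) \<partial>lborel) \<partial>(\<Pi>\<^sub>M i\<in>I. lborel)) =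
      ennreal (c ^ card I) * (\<integral>\<^sup>+x. (\<integral>\<^sup>+y. f ((\<lambda>j\<in>I. d j + c * x j)(i := d i + c * y)) \<partial>lborel) \<partial>(\<Pi>\<^sub>M i\<in>I. lborel))"
    by (rule insert.IH[OF insert.prems(1)]) measurable
  also have "(\<integral>\<^sup>+x. (\<integral>\<^sup>+y. f ((\<lambda>j\<in>I. d j + c * x j)(i := d i + c * y)) \<partial>lborel) \<partial>(\<Pi>\<^sub>M i\<in>I. lborel)) =
      (\<integral>\<^sup>+x. (\<integral>\<^sup>+y. f (\<lambda>j\<in>insert i I. d j + c * (x(i := y)) j) \<partial>lborel) \<partial>(\<Pi>\<^sub>M i\<in>I. lborel))"
    using insert.hyps
    by (intro nn_integral_cong arg_cong[of _ _ f]) (auto simp: fun_eq_iff)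
  also have "\<dots> = (\<integral>\<^sup>+x. f (\<lambda>j\<in>insert i I. d j + c * x j) \<partial>(\<Pi>\<^sub>M i\<in>insert i I. lborel))"
    by (rule product_nn_integral_insert[symmetric]) (use insert in auto)
  finally have eq: "(\<integral>\<^sup>+x. f x \<partial>(\<Pi>\<^sub>M i\<in>insert i I. lborel)) = ennreal c * (ennreal (c ^ card I) *
      (\<integral>\<^sup>+x. f (\<lambda>j\<in>insert i I. d j + c * x j) \<partial>(\<Pi>\<^sub>M i\<in>insert i I. lborel)))" .
  have "ennreal (c ^ card (insert i I)) = ennreal c * ennreal (c ^ card I)"
    using insert.hyps insert.prems(1) by (simp add: ennreal_mult)
  then show ?case unfolding eq by (simp only: mult.assoc)
qed

lemma measurable_dotp [measurable]:
  "(\<lambda>y. dotp m y w) \<in> borel_measurable (LM m)"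
  unfolding dotp_def by measurable

lemma measurable_L2_set [measurable]:
  "(\<lambda>y. L2_set y {..m}) \<in> borel_measurable (LM m)"
  unfolding L2_set_def by measurable

text \<open>
  The translates of \<open>{y. K y \<and> \<not> K (y + v)}\<close> by multiples of \<open>v\<close> are disjoint because \<open>K\<close> is convex.
\<close>
lemma nn_integral_exit_set_le:
  fixes D :: "(nat \<Rightarrow> real) set" and v d :: "nat \<Rightarrow> real" and e :: real
  assumes D: "countable D" and c: "c > 0"
    and F[measurable]: "F \<in> borel_measurable (LM m)"
    and shift: "\<And>z j. z \<in> space (LM m) \<Longrightarrow> j < N \<Longrightarrow>
      F (\<lambda>i\<in>{..m}. real j * v i + z i) \<le> F (\<lambda>i\<in>{..m}. d i + c * z i)"
  defines "K \<equiv> \<lambda>y. \<forall>w\<in>D. - e \<le> dotp m y w"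
  defines "T \<equiv> {y \<in> space (LM m). K y \<and> \<not> K (\<lambda>i. y i + v i)}"
  shows "T \<in> sets (LM m)"
    and "of_nat N * (\<integral>\<^sup>+y. F y * indicator T y \<partial>LM m) \<le> ennreal ((1 / c) ^ Suc m) * (\<integral>\<^sup>+y. F y \<partial>LM m)"
proof -
  show T[measurable]: "T \<in> sets (LM m)"
    unfolding T_def K_def dotp_simps using D by measurable
  let ?s = "\<lambda>j z. \<lambda>i\<in>{..m}. real j * v i + z i"
  let ?\<phi> = "\<lambda>z. \<lambda>i\<in>{..m}. d i + c * z i"
  have s[measurable]: "?s j \<in> measurable (LM m) (LM m)" for j by measurable
  have \<phi>[measurable]: "?\<phi> \<in> measurable (LM m) (LM m)" by measurable
  have dot: "dotp m (?s j z) w = real j * dotp m v w + dotp m z w" for j z w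
    by (subst dotp_cong[where x' = "\<lambda>i. real j * v i + z i" and y' = w]) (auto simp: dotp_simps)
  have inT: "?s j z \<in> T \<longleftrightarrow> (\<forall>w\<in>D. - e \<le> real j * dotp m v w + dotp m z w) \<and>
      \<not> (\<forall>w\<in>D. - e \<le> real (Suc j) * dotp m v w + dotp m z w)" if "z \<in> space (LM m)" for j z
    using measurable_space[OF s that, of j]
    by (simp only: T_def K_def dotp_simps dot mem_Collect_eq of_nat_Suc distrib_right mult_1 add.assoc add.left_commute simp_thms)
       (simp only: ac_simps)
  \<comment> \<open>The constraint \<open>w\<close> violated right after step \<open>j\<close> held
    at step \<open>j\<close>, so it decreases along \<open>v\<close>; being affine in the step
    number, it is violated at every later step too.\<close>
  have uniq: False if as: "z \<in> space (LM m)" "?s j z \<in> T" "?s k z \<in> T" "j < k" for j k z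
  proof -
    obtain w where w: "w \<in> D" "real (Suc j) * dotp m v w + dotp m z w < - e"
      using as(2) inT[OF as(1)] by force
    have "- e \<le> real j * dotp m v w + dotp m z w" "- e \<le> real k * dotp m v w + dotp m z w"
      using as(2,3) inT[OF as(1)] w(1) by blast+
    with w have "dotp m v w < 0" "(real k - real (Suc j)) * dotp m v w > 0"
      by (auto simp: algebra_simps)
    moreover have "real k - real (Suc j) \<ge> 0" using as(4) by simp
    ultimately show False by (smt (verit) mult_nonneg_nonpos)
  qed
  \<comment> \<open>At most one translate contributes, and \<open>shift\<close> dominates that
    single term; thus all \<open>N\<close> translates together cost one homothetic copy of
    \<open>F\<close>.\<close>
  have sum_le: "(\<Sum>j<N. F (?s j z) * indicator T (?s j z)) \<le> F (?\<phi> z)" if z: "z \<in> space (LM m)" for z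
  proof (cases "\<exists>j<N. ?s j z \<in> T")
    case True
    then obtain j where j: "j < N" "?s j z \<in> T" by blast
    have other: "?s k z \<notin> T" if "k \<noteq> j" for k
      using uniq[OF z j(2) _, of k] uniq[OF z _ j(2), of k] that by (meson linorder_neqE_nat)
    have "(\<Sum>k<N. F (?s k z) * indicator T (?s k z)) = (\<Sum>k\<in>{j}. F (?s k z) * indicator T (?s k z))"
      using j other by (intro sum.mono_neutral_right) auto
    also have "\<dots> \<le> F (?\<phi> z)" using shift[OF z j(1)] j by simp
    finally show ?thesis .
  qed (simp add: indicator_def)
  have "of_nat N * (\<integral>\<^sup>+y. F y * indicator T y \<partial>LM m) = (\<Sum>j<N. \<integral>\<^sup>+y. F y * indicator T y \<partial>LM m)"
    by simp
  also have "\<dots> = (\<Sum>j<N. \<integral>\<^sup>+z. F (?s j z) * indicator T (?s j z) \<partial>LM m)"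
    by (intro sum.cong refl, subst nn_integral_PiM_lborel_affine[where c = 1 and d = "\<lambda>i. real _ * v i"]) auto
  also have "\<dots> = (\<integral>\<^sup>+z. (\<Sum>j<N. F (?s j z) * indicator T (?s j z)) \<partial>LM m)"
    by (rule nn_integral_sum[symmetric]) measurable
  also have "\<dots> \<le> (\<integral>\<^sup>+z. F (?\<phi> z) \<partial>LM m)" by (intro nn_integral_mono sum_le)
  also have "\<dots> = ennreal ((1 / c) ^ Suc m) * (ennreal (c ^ Suc m) * (\<integral>\<^sup>+z. F (?\<phi> z) \<partial>LM m))"
    using c by (simp add: mult.assoc[symmetric] ennreal_mult[symmetric] power_mult_distrib[symmetric] del: power_Suc)
  also have "ennreal (c ^ Suc m) * (\<integral>\<^sup>+z. F (?\<phi> z) \<partial>LM m) = (\<integral>\<^sup>+y. F y \<partial>LM m)"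
    using c by (subst nn_integral_PiM_lborel_affine[where f = F and c = c and d = d]) auto
  finally show "of_nat N * (\<integral>\<^sup>+y. F y * indicator T y \<partial>LM m) \<le> ennreal ((1 / c) ^ Suc m) * (\<integral>\<^sup>+y. F y \<partial>LM m)" .
qed

text \<open>The parameter \<open>s\<close> is the sine of the half-angle, which is at most a right angle.\<close>
definition sector :: "nat \<Rightarrow> (nat \<Rightarrow> real) \<Rightarrow> real \<Rightarrow> (nat \<Rightarrow> real) set" where
  "sector m a s = {y \<in> space (LM m). 0 < L2_set y {..m} \<and> L2_set y {..m} \<le> 1 \<and>
     sqrt (1 - s\<^sup>2) * L2_set y {..m} \<le> dotp m y a}"

text \<open>The radial extension of sin d(x,a) from the sphere, so that a density on a cap becomes a
  density on the solid sector.\<close>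

definition axis_sin :: "nat \<Rightarrow> (nat \<Rightarrow> real) \<Rightarrow> (nat \<Rightarrow> real) \<Rightarrow> real" where
  "axis_sin m a y = sqrt (1 - (dotp m y a / L2_set y {..m})\<^sup>2)"

lemma measurable_axis_sin [measurable]: "axis_sin m a \<in> borel_measurable (LM m)"
  unfolding axis_sin_def by measurable

lemma sets_sector [measurable]: "sector m a s \<in> sets (LM m)"
  unfolding sector_def
  by (intro sets.sets_Collect_conj borel_measurable_le borel_measurable_less borel_measurable_times
      measurable_L2_set measurable_dotp borel_measurable_const)

lemma restrict_in_space_LM: "(\<lambda>i\<in>{..m}. x i) \<in> space (LM m)"
  by (auto simp: space_PiM)

lemma L2_set_restrict: "L2_set (\<lambda>i\<in>{..m}. x i) {..m} = L2_set x {..m}"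
  by (rule L2_set_cong) auto

lemma dotp_restrict: "dotp m (\<lambda>i\<in>{..m}. x i) y = dotp m x y"
  by (rule dotp_cong) auto

lemma L2_set_scale:
  fixes m :: nat
  shows "L2_set (\<lambda>i. c * x i) {..m} = \<bar>c\<bar> * L2_set x {..m}"
  by (simp add: L2_set_dotp dotp_simps mult.assoc[symmetric] real_sqrt_mult[of "c * c"])

lemma L2_set_add_le: "L2_set (\<lambda>i. x i + y i) {..m} \<le> L2_set x {..m} + L2_set y {..m}"
  by (rule L2_set_triangle_ineq)

lemma abs_dotp_axis_le: "a \<in> Sph m \<Longrightarrow> \<bar>dotp m y a\<bar> \<le> L2_set y {..m}"
  using abs_dotp_le[of m y a] by simp

lemma axis_sin_nonneg:
  assumes "a \<in> Sph m"
  shows "0 \<le> axis_sin m a y"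
proof -
  have "\<bar>dotp m y a / L2_set y {..m}\<bar> \<le> 1"
    using abs_dotp_axis_le[OF assms(1), of y] L2_set_nonneg[of y "{..m}"]
    by (cases "L2_set y {..m} = 0") (auto simp: abs_divide divide_le_eq_1 simp del: L2_set_nonneg)
  then have "(dotp m y a / L2_set y {..m})\<^sup>2 \<le> 1" by (simp only: abs_square_le_1)
  then show ?thesis by (simp add: axis_sin_def)
qed

lemma sector_mono: "0 \<le> s \<Longrightarrow> s \<le> t \<Longrightarrow> t \<le> 1 \<Longrightarrow> sector m a s \<subseteq> sector m a t"
proof -
  assume "0 \<le> s" "s \<le> t" "t \<le> 1"
  then have "s\<^sup>2 \<le> t\<^sup>2" by (simp add: power_mono)
  then have "sqrt (1 - t\<^sup>2) * L2_set y {..m} \<le> sqrt (1 - s\<^sup>2) * L2_set y {..m}" for y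
    by (intro mult_right_mono) auto
  then show ?thesis unfolding sector_def by (auto intro: order_trans)
qed

text \<open>The sine does not separate an angle from its supplement; \<open>sector m a 1\<close>,
  the half ball without the origin, excludes the wrong one.\<close>

lemma axis_sin_le_iff:
  assumes a: "a \<in> Sph m" and s: "0 \<le> s" "s \<le> 1" and y: "y \<in> sector m a 1"
  shows "axis_sin m a y \<le> s \<longleftrightarrow> y \<in> sector m a s"
proof -
  let ?N = "L2_set y {..m}"
  have N: "0 < ?N" "?N \<le> 1" "0 \<le> dotp m y a" "y \<in> space (LM m)"
    using y by (auto simp: sector_def)
  let ?c = "dotp m y a / ?N"
  have c: "0 \<le> ?c" using N by simp
  have "axis_sin m a y \<le> s \<longleftrightarrow> sqrt (1 - ?c\<^sup>2) \<le> sqrt (s\<^sup>2)"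
    unfolding axis_sin_def using s(1) by simp
  also have "\<dots> \<longleftrightarrow> sqrt (1 - s\<^sup>2) \<le> sqrt (?c\<^sup>2)"
    unfolding real_sqrt_le_iff by auto
  also have "\<dots> \<longleftrightarrow> sqrt (1 - s\<^sup>2) \<le> ?c"
    using c by (simp only: real_sqrt_abs abs_of_nonneg)
  also have "\<dots> \<longleftrightarrow> y \<in> sector m a s"
    using N by (auto simp: sector_def field_simps)
  finally show ?thesis .
qed

text \<open>A sector is the intersection of the unit ball with a convex cone, minus the origin.
  Positivity of \<open>dotp m q a\<close> keeps the combination off the origin, which two opposite
  points orthogonal to the axis could otherwise reach when \<open>s\<close> is 1.\<close>

lemma sector_convex:
  assumes a: "a \<in> Sph m" and s: "0 \<le> s" "s \<le> 1" and u: "u \<in> sector m a s" and q: "q \<in> sector m a s"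
    and qa: "0 < dotp m q a" and l: "0 < l"
  shows "(\<lambda>i\<in>{..m}. (u i + l * q i) / (1 + l)) \<in> sector m a s"
proof -
  let ?z = "\<lambda>i. (u i + l * q i) / (1 + l)" and ?k = "sqrt (1 - s\<^sup>2)"
  have k: "0 \<le> ?k" using s by (simp add: abs_square_le_1)
  have u': "L2_set u {..m} \<le> 1" "?k * L2_set u {..m} \<le> dotp m u a" using u by (auto simp: sector_def)
  have q': "L2_set q {..m} \<le> 1" "?k * L2_set q {..m} \<le> dotp m q a" using q by (auto simp: sector_def)
  have ua: "0 \<le> dotp m u a"
    using u'(2) k by (meson L2_set_nonneg mult_nonneg_nonneg order_trans)
  have "?z = (\<lambda>i. inverse (1 + l) * (u i + l * q i))" by (simp add: divide_inverse mult.commute)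
  then have "L2_set ?z {..m} = inverse (1 + l) * L2_set (\<lambda>i. u i + l * q i) {..m}"
    using l by (simp add: L2_set_scale)
  also have "\<dots> \<le> inverse (1 + l) * (L2_set u {..m} + l * L2_set q {..m})"
    using L2_set_add_le[of u "\<lambda>i. l * q i" m] l by (intro mult_left_mono) (auto simp: L2_set_scale)
  finally have N: "L2_set ?z {..m} \<le> inverse (1 + l) * (L2_set u {..m} + l * L2_set q {..m})" .
  also have "\<dots> \<le> inverse (1 + l) * (1 + l * 1)"
    using u' q' l by (intro mult_left_mono add_mono) auto
  also have "\<dots> = 1" using l by simp
  finally have N1: "L2_set ?z {..m} \<le> 1" .
  have z: "dotp m ?z a = inverse (1 + l) * (dotp m u a + l * dotp m q a)"
    by (simp add: dotp_simps divide_inverse mult.commute)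
  have "?k * L2_set ?z {..m} \<le> ?k * (inverse (1 + l) * (L2_set u {..m} + l * L2_set q {..m}))"
    using N k by (rule mult_left_mono)
  also have "\<dots> = inverse (1 + l) * (?k * L2_set u {..m} + l * (?k * L2_set q {..m}))"
    by (simp add: algebra_simps)
  also have "\<dots> \<le> inverse (1 + l) * (dotp m u a + l * dotp m q a)"
    using u' q' l by (intro mult_left_mono add_mono) auto
  finally have C: "?k * L2_set ?z {..m} \<le> dotp m ?z a" using z by simp
  have "0 < dotp m ?z a" unfolding z using ua qa l by (intro mult_pos_pos add_nonneg_pos) auto
  also have "\<dots> \<le> L2_set ?z {..m}" using abs_dotp_axis_le[OF a, of ?z] by linarith
  finally show ?thesis
    using N1 C restrict_in_space_LM
    unfolding sector_def mem_Collect_eq L2_set_restrict dotp_restrict by blast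
qed

text \<open>With x the axis component of \<open>v\<close> and |v|^2 \<le> s^2/4, the cone condition
  follows from the identity (1 - s^2)(1/4 + x + s^2/4) = (1/2 + x)^2 - (x + s^2/2)^2. The radius s/3
  also keeps the norm at most 1 and the axis component positive.\<close>

lemma ball_in_sector:
  assumes a: "a \<in> Sph m" and s: "0 < s" "s \<le> 1" and v: "L2_set v {..m} \<le> s / 3"
  shows "(\<lambda>i\<in>{..m}. a i / 2 + v i) \<in> sector m a s" "0 < dotp m (\<lambda>i\<in>{..m}. a i / 2 + v i) a"
proof -
  let ?q = "\<lambda>i. a i / 2 + v i" and ?x = "dotp m v a" and ?V = "dotp m v v"
  have x: "\<bar>?x\<bar> \<le> s / 3" using abs_dotp_axis_le[OF a, of v] v by linarith
  have "?V = (L2_set v {..m})\<^sup>2" by (simp add: L2_set_power2)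
  also have "\<dots> \<le> (s / 3)\<^sup>2" using v by (intro power_mono) auto
  also have "\<dots> \<le> s\<^sup>2 / 4" by (simp add: power_divide)
  finally have V: "?V \<le> s\<^sup>2 / 4" .
  have qa: "dotp m ?q a = 1 / 2 + ?x" using a by (simp add: dotp_simps)
  then have pos: "0 < dotp m ?q a" using x s by linarith
  then show "0 < dotp m (\<lambda>i\<in>{..m}. a i / 2 + v i) a" by (simp add: dotp_restrict)
  have qq: "dotp m ?q ?q = 1 / 4 + ?x + ?V"
    using a by (simp add: dotp_simps dotp_commute[of m a v])
  have "L2_set ?q {..m} \<le> L2_set (\<lambda>i. (1/2) * a i) {..m} + L2_set v {..m}"
    using L2_set_add_le[of "\<lambda>i. (1/2) * a i" v m] by simp
  also have "\<dots> \<le> 1" using a v s unfolding L2_set_scale by simp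
  finally have q1: "L2_set ?q {..m} \<le> 1" .
  have q0: "0 < L2_set ?q {..m}" using abs_dotp_axis_le[OF a, of ?q] pos by linarith
  have "(1 - s\<^sup>2) * dotp m ?q ?q \<le> (dotp m ?q a)\<^sup>2"
  proof -
    have "(1 - s\<^sup>2) * (1 / 4 + ?x + ?V) \<le> (1 - s\<^sup>2) * (1 / 4 + ?x + s\<^sup>2 / 4)"
      using V s by (intro mult_left_mono) (auto simp: abs_square_le_1)
    also have "\<dots> = (1 / 2 + ?x)\<^sup>2 - (?x + s\<^sup>2 / 2)\<^sup>2" by (simp add: power2_eq_square field_simps)
    also have "\<dots> \<le> (1 / 2 + ?x)\<^sup>2" by simp
    finally show ?thesis unfolding qq qa .
  qed
  then have "sqrt ((1 - s\<^sup>2) * dotp m ?q ?q) \<le> dotp m ?q a"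
    using pos by (intro real_le_lsqrt) auto
  then have "sqrt (1 - s\<^sup>2) * L2_set ?q {..m} \<le> dotp m ?q a"
    by (simp add: real_sqrt_mult L2_set_dotp)
  then show "(\<lambda>i\<in>{..m}. a i / 2 + v i) \<in> sector m a s"
    using q0 q1 restrict_in_space_LM
    unfolding sector_def mem_Collect_eq L2_set_restrict dotp_restrict by blast
qed

text \<open>
  \<open>G (max (axis_sin m a y) s)\<close> has convex superlevel sets, each containing the ball of radius \<open>s / 3\<close>
  around \<open>a / 2\<close>, so a short translation is dominated by a homothety with centre \<open>a / 2\<close>.
\<close>
lemma sector_density_translate_le:
  fixes G :: "real \<Rightarrow> ennreal"
  assumes a: "a \<in> Sph m" and s: "0 < s" "s \<le> t" "t \<le> 1"
    and G: "antimono_on {0..t} G" and l: "0 < l" and w: "L2_set w {..m} \<le> l * s / 3"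
  defines "F \<equiv> \<lambda>y. G (max (axis_sin m a y) s) * indicator (sector m a t) y"
  shows "F (\<lambda>i\<in>{..m}. w i + z i) \<le> F (\<lambda>i\<in>{..m}. l / (2 * (1 + l)) * a i + 1 / (1 + l) * z i)"
proof (cases "(\<lambda>i\<in>{..m}. w i + z i) \<in> sector m a t")
  case True
  \<comment> \<open>\<open>?q\<close> is chosen so that \<open>w\<close> cancels in
    \<open>?u + l * ?q\<close>: the point \<open>?p\<close> is at once the homothetic image of
    \<open>z\<close> and a convex combination of \<open>?u\<close> with a point of the ball about
    a/2.\<close>
  let ?u = "\<lambda>i\<in>{..m}. w i + z i" and ?q = "\<lambda>i\<in>{..m}. a i / 2 + (- 1 / l) * w i"
  let ?p = "\<lambda>i\<in>{..m}. l / (2 * (1 + l)) * a i + 1 / (1 + l) * z i"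
  \<comment> \<open>The sector of sine \<open>r\<close> is the superlevel set through
    \<open>?u\<close>; since r \<ge> s it contains the ball as well.\<close>
  define r where "r = max (axis_sin m a ?u) s"
  have t1: "?u \<in> sector m a 1" using sector_mono[of t 1 m a] True s by auto
  have ut: "axis_sin m a ?u \<le> t" using axis_sin_le_iff[OF a _ _ t1, of t] True s by auto
  have r: "0 < r" "r \<le> t" "s \<le> r" "r \<le> 1" using ut s by (auto simp: r_def)
  have ur: "?u \<in> sector m a r" using axis_sin_le_iff[OF a _ _ t1, of r] r by (auto simp: r_def)
  have "L2_set (\<lambda>i. (- 1 / l) * w i) {..m} \<le> s / 3"
    unfolding L2_set_scale using l w by (simp add: field_simps)
  note q = ball_in_sector[OF a s(1) _ this]
  have qr: "?q \<in> sector m a r" using q(1) sector_mono[of s r m a] r s by auto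
  have qa: "0 < dotp m ?q a" using q(2) s by simp
  have eq: "(\<lambda>i\<in>{..m}. (?u i + l * ?q i) / (1 + l)) = ?p"
  proof (intro restrict_ext)
    fix i assume i: "i \<in> {..m}"
    have "l * (a i / 2 + (- 1 / l) * w i) = l * a i / 2 - w i" using l by (simp add: field_simps)
    then have "(?u i + l * ?q i) / (1 + l) = (l * a i / 2 + z i) / (1 + l)" using i by simp
    also have "\<dots> = l / (2 * (1 + l)) * a i + 1 / (1 + l) * z i"
      by (simp add: add_divide_distrib mult.commute)
    finally show "(?u i + l * ?q i) / (1 + l) = l / (2 * (1 + l)) * a i + 1 / (1 + l) * z i" .
  qed
  have pr: "?p \<in> sector m a r"
    using sector_convex[OF a _ r(4) ur qr qa l] r(1) unfolding eq by simp
  have p1: "?p \<in> sector m a 1" and pt: "?p \<in> sector m a t"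
    using sector_mono[of r 1 m a] sector_mono[of r t m a] pr r s by auto
  have "axis_sin m a ?p \<le> r" using axis_sin_le_iff[OF a _ _ p1, of r] pr r by auto
  then have "G r \<le> G (max (axis_sin m a ?p) s)"
    using r s by (intro monotone_onD[OF G]) auto
  then show ?thesis using True pt by (simp add: F_def r_def)
qed (simp add: F_def)

text \<open>Otherwise the squares of the coordinates would sum to less than 1/(m+1).\<close>

lemma large_coordinate:
  assumes "x \<in> Sph m"
  shows "\<exists>i\<le>m. 1 / real (Suc m) \<le> \<bar>x i\<bar>"
proof (rule ccontr)
  assume "\<not> ?thesis"
  then have lt: "\<bar>x i\<bar> < 1 / real (Suc m)" if "i \<le> m" for i
    using that by (meson not_le)
  have "x i * x i \<le> 1 / real (Suc m) * (1 / real (Suc m))" if "i \<le> m" for i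
  proof -
    have "x i * x i = \<bar>x i\<bar> * \<bar>x i\<bar>" by simp
    also have "\<dots> \<le> 1 / real (Suc m) * (1 / real (Suc m))"
      using lt[OF that] by (intro mult_mono) auto
    finally show ?thesis .
  qed
  moreover have "x 0 * x 0 < 1 / real (Suc m) * (1 / real (Suc m))"
  proof -
    have "x 0 * x 0 = \<bar>x 0\<bar> * \<bar>x 0\<bar>" by simp
    also have "\<dots> < 1 / real (Suc m) * (1 / real (Suc m))"
      using lt[of 0] by (intro mult_strict_mono) auto
    finally show ?thesis .
  qed
  ultimately have "(\<Sum>i\<le>m. x i * x i) < (\<Sum>i\<le>m. 1 / real (Suc m) * (1 / real (Suc m)))"
    by (intro sum_strict_mono_ex1) auto
  also have "\<dots> = 1 / real (Suc m)" by (simp del: of_nat_Suc)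
  also have "\<dots> \<le> 1" by simp
  finally show False using assms by (simp add: Sph_iff dotp_def)
qed

lemma one_plus_inverse_power_le: "(1 + 1 / real (Suc m)) ^ Suc m \<le> 3"
proof -
  have "(1 + 1 / real (Suc m)) ^ Suc m \<le> exp (1 / real (Suc m)) ^ Suc m"
    by (intro power_mono exp_ge_add_one_self) auto
  also have "\<dots> = exp 1" by (simp only: exp_of_nat_mult[symmetric]) simp
  also have "\<dots> \<le> 3" by (rule exp_le)
  finally show ?thesis .
qed

text \<open>Write M = m+1 and l = 1/M. Translates by j steps of length 3\<delta>M are dominated
  while the total length is at most l s/3 = s/(3M). About s/(9 \<delta> M^2) of them fit, at a
  volume cost of at most 3, which yields 27 M^2 \<delta>/s.\<close>

lemma nn_integral_sector_exit_le:
  fixes G :: "real \<Rightarrow> ennreal" and e :: real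
  assumes a: "a \<in> Sph m" and s: "0 < s" "s \<le> t" "t \<le> 1"
    and G: "antimono_on {0..t} G" and \<delta>: "0 < \<delta>" and D: "countable D" and k: "k \<le> m"
    and b: "\<bar>b\<bar> = 3 * \<delta> * real (Suc m)"
  defines "F \<equiv> \<lambda>y. G (max (axis_sin m a y) s) * indicator (sector m a t) y"
  defines "T \<equiv> {y \<in> space (LM m). (\<forall>w\<in>D. - e \<le> dotp m y w) \<and>
     \<not> (\<forall>w\<in>D. - e \<le> dotp m (\<lambda>i. y i + (if i = k then b else 0)) w)}"
  assumes F: "F \<in> borel_measurable (LM m)"
  shows "T \<in> sets (LM m)"
    "(\<integral>\<^sup>+y. F y * indicator T y \<partial>LM m) \<le> ennreal (27 * real (Suc m) ^ 2 * \<delta> / s) * (\<integral>\<^sup>+y. F y \<partial>LM m)"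
proof -
  define M where "M = real (Suc m)"
  define l where "l = 1 / M"
  \<comment> \<open>The steps are numbered from 0, so \<open>N\<close> is at least the bound while
    the largest index \<open>N - 1\<close> does not exceed it.\<close>
  define N where "N = Suc (nat \<lfloor>s / (9 * \<delta> * M\<^sup>2)\<rfloor>)"
  define v where "v = (\<lambda>i. if i = k then b else 0)"
  have M: "M > 0" and l: "l > 0" by (auto simp: M_def l_def)
  have x0: "0 \<le> s / (9 * \<delta> * M\<^sup>2)" using s \<delta> by simp
  have fl: "real_of_int \<lfloor>s / (9 * \<delta> * M\<^sup>2)\<rfloor> = real (nat \<lfloor>s / (9 * \<delta> * M\<^sup>2)\<rfloor>)"
    using x0 by simp
  have N1: "s / (9 * \<delta> * M\<^sup>2) \<le> real N" "0 < real N"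
    using fl real_of_int_floor_add_one_ge[of "s / (9 * \<delta> * M\<^sup>2)"] by (simp_all add: N_def)
  have step: "L2_set (\<lambda>i. real j * v i) {..m} \<le> l * s / 3" if "j < N" for j
  proof -
    have "real j \<le> s / (9 * \<delta> * M\<^sup>2)" 
      using that fl of_int_floor_le[of "s / (9 * \<delta> * M\<^sup>2)"] by (simp add: N_def)
    then have "real j * (3 * \<delta> * M) \<le> s / (9 * \<delta> * M\<^sup>2) * (3 * \<delta> * M)"
      using \<delta> M by (intro mult_right_mono) auto
    also have "\<dots> = l * s / 3" using \<delta> M by (simp add: l_def field_simps power2_eq_square)
    finally have jb: "real j * \<bar>b\<bar> \<le> l * s / 3" unfolding b M_def by simp
    have "L2_set v {..m} \<le> (\<Sum>i\<le>m. \<bar>v i\<bar>)" by (rule L2_set_le_sum_abs)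
    also have "\<dots> = \<bar>b\<bar>" using k by (simp add: v_def if_distrib[of abs] cong: if_cong)
    finally have "real j * L2_set v {..m} \<le> real j * \<bar>b\<bar>" by (rule mult_left_mono) simp
    then show ?thesis using jb by (simp add: L2_set_scale)
  qed
  have c: "0 < 1 / (1 + l)" using l by simp
  have shift: "F (\<lambda>i\<in>{..m}. real j * v i + z i) \<le> F (\<lambda>i\<in>{..m}. l / (2 * (1 + l)) * a i + 1 / (1 + l) * z i)"
    if "j < N" for j z
    unfolding F_def by (rule sector_density_translate_le[OF a s G l step[OF that]])
  note exit = nn_integral_exit_set_le[OF D c F shift, of N e]
  have T: "T = {y \<in> space (LM m). (\<forall>w\<in>D. - e \<le> dotp m y w) \<and> \<not> (\<forall>w\<in>D. - e \<le> dotp m (\<lambda>i. y i + v i) w)}"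
    by (simp add: T_def v_def)
  show "T \<in> sets (LM m)" unfolding T by (rule exit(1))
  have "(1 / (1 / (1 + l))) ^ Suc m \<le> 3"
    using one_plus_inverse_power_le[of m] by (simp add: l_def M_def)
  then have "ennreal ((1 / (1 / (1 + l))) ^ Suc m) * (\<integral>\<^sup>+y. F y \<partial>LM m) \<le> ennreal 3 * (\<integral>\<^sup>+y. F y \<partial>LM m)"
    by (intro mult_right_mono ennreal_leI) simp_all
  with exit(2) have "of_nat N * (\<integral>\<^sup>+y. F y * indicator T y \<partial>LM m) \<le> ennreal 3 * (\<integral>\<^sup>+y. F y \<partial>LM m)"
    unfolding T by (rule order_trans)
  then have "ennreal (1 / real N) * (of_nat N * (\<integral>\<^sup>+y. F y * indicator T y \<partial>LM m))
      \<le> ennreal (1 / real N) * (ennreal 3 * (\<integral>\<^sup>+y. F y \<partial>LM m))"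
    by (rule mult_left_mono) simp
  moreover have "ennreal (1 / real N) * of_nat N = 1"
    using N1(2) by (simp add: ennreal_of_nat_eq_real_of_nat ennreal_mult[symmetric])
  moreover have "ennreal (1 / real N) * ennreal 3 = ennreal (3 / real N)"
    by (subst ennreal_mult[symmetric]) auto
  ultimately have "(\<integral>\<^sup>+y. F y * indicator T y \<partial>LM m) \<le> ennreal (3 / real N) * (\<integral>\<^sup>+y. F y \<partial>LM m)"
    by (simp add: mult.assoc[symmetric])
  also have "\<dots> \<le> ennreal (27 * M ^ 2 * \<delta> / s) * (\<integral>\<^sup>+y. F y \<partial>LM m)"
  proof (intro mult_right_mono ennreal_leI)
    have "3 / real N \<le> 3 / (s / (9 * \<delta> * M\<^sup>2))"
      using N1 s \<delta> M by (intro divide_left_mono) auto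
    then show "3 / real N \<le> 27 * M ^ 2 * \<delta> / s" by (simp add: algebra_simps)
  qed auto
  finally show "(\<integral>\<^sup>+y. F y * indicator T y \<partial>LM m) \<le> ennreal (27 * real (Suc m) ^ 2 * \<delta> / s) * (\<integral>\<^sup>+y. F y \<partial>LM m)"
    by (simp add: M_def)
qed

text \<open>
  A point of the slab leaves the convex set \<open>{y. \<forall>w\<in>D. - \<delta> \<le> dotp m y w}\<close> when it moves by
  \<open>3 * \<delta> * (m + 1)\<close> along a suitable coordinate axis.
\<close>
lemma nn_integral_sector_slab_le:
  fixes G :: "real \<Rightarrow> ennreal"
  assumes a: "a \<in> Sph m" and s: "0 < s" "s \<le> t" "t \<le> 1"
    and G: "antimono_on {0..t} G" and \<delta>: "0 < \<delta>" and D: "countable D" "D \<subseteq> Sph m"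
  defines "F \<equiv> \<lambda>y. G (max (axis_sin m a y) s) * indicator (sector m a t) y"
  defines "E \<equiv> {y \<in> space (LM m). (\<exists>x\<in>D. dotp m y x < 2 * \<delta>) \<and> (\<forall>w\<in>D. - \<delta> \<le> dotp m y w)}"
  assumes F[measurable]: "F \<in> borel_measurable (LM m)"
  shows "(\<integral>\<^sup>+y. F y * indicator E y \<partial>LM m) \<le> ennreal (54 * real (Suc m) ^ 3 * \<delta> / s) * (\<integral>\<^sup>+y. F y \<partial>LM m)"
proof -
  define c where "c = 3 * \<delta> * real (Suc m)"
  have c: "c > 0" using \<delta> by (simp add: c_def)
  define T where "T = (\<lambda>(k, b). {y \<in> space (LM m). (\<forall>w\<in>D. - \<delta> \<le> dotp m y w) \<and>
     \<not> (\<forall>w\<in>D. - \<delta> \<le> dotp m (\<lambda>i. y i + (if i = k then b else 0)) w)})"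
  define I where "I = {..m} \<times> {c, - c}"
  have T: "T p \<in> sets (LM m)" "(\<integral>\<^sup>+y. F y * indicator (T p) y \<partial>LM m) \<le>
      ennreal (27 * real (Suc m) ^ 2 * \<delta> / s) * (\<integral>\<^sup>+y. F y \<partial>LM m)" if pI: "p \<in> I" for p
  proof -
    obtain k b where p: "p = (k, b)" "k \<le> m" "\<bar>b\<bar> = 3 * \<delta> * real (Suc m)"
    proof -
      obtain k b where kb: "p = (k, b)" by (cases p)
      with pI have "k \<le> m" "b = c \<or> b = - c" by (auto simp: I_def)
      then have "\<bar>b\<bar> = c" using c by auto
      with kb \<open>k \<le> m\<close> show thesis by (intro that) (auto simp: c_def)
    qed
    show "T p \<in> sets (LM m)" "(\<integral>\<^sup>+y. F y * indicator (T p) y \<partial>LM m) \<le>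
      ennreal (27 * real (Suc m) ^ 2 * \<delta> / s) * (\<integral>\<^sup>+y. F y \<partial>LM m)"
      using nn_integral_sector_exit_le[OF a s G \<delta> D(1) p(2,3), of \<delta>] F
      unfolding T_def p(1) F_def by auto
  qed
  have sub: "\<exists>p\<in>I. y \<in> T p" if yE: "y \<in> E" for y
  proof -
    obtain x where x: "x \<in> D" "dotp m y x < 2 * \<delta>" using yE by (auto simp: E_def)
    then obtain i where i: "i \<le> m" "1 / real (Suc m) \<le> \<bar>x i\<bar>"
      using large_coordinate[of x m] D(2) by auto
    \<comment> \<open>The sign makes \<open>dotp m y x\<close> drop by at least 3\<delta>, from
      below 2\<delta> to below -\<delta>.\<close>
    define b where "b = (if x i \<ge> 0 then - c else c)"
    have "b * x i = - (c * \<bar>x i\<bar>)" by (auto simp: b_def)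
    also have "\<dots> \<le> - (c * (1 / real (Suc m)))"
      using c i(2) by (intro le_imp_neg_le mult_left_mono) auto
    also have "\<dots> = - 3 * \<delta>" by (simp add: c_def)
    finally have "b * x i \<le> - 3 * \<delta>" .
    moreover have "dotp m (\<lambda>j. if j = i then b else 0) x = b * x i"
      unfolding dotp_def using i(1) by (simp add: if_distrib[of "\<lambda>z. z * _"] cong: if_cong)
    ultimately have "dotp m (\<lambda>j. y j + (if j = i then b else 0)) x < - \<delta>"
      unfolding dotp_simps using x(2) by linarith
    then have "y \<in> T (i, b)" using yE x(1) by (auto simp: T_def E_def not_le)
    moreover have "(i, b) \<in> I" using i by (auto simp: I_def b_def)
    ultimately show ?thesis by blast
  qed
  have finI: "finite I" by (simp add: I_def)
  have "F y * indicator E y \<le> (\<Sum>p\<in>I. F y * indicator (T p) y)" for y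
  proof (cases "y \<in> E")
    case True
    then obtain p where p: "p \<in> I" "y \<in> T p" using sub by blast
    have "F y * indicator (T p) y \<le> (\<Sum>p\<in>I. F y * indicator (T p) y)"
      by (rule member_le_sum[OF p(1)]) (use finI in auto)
    then show ?thesis using True p by simp
  qed simp
  then have "(\<integral>\<^sup>+y. F y * indicator E y \<partial>LM m) \<le> (\<integral>\<^sup>+y. (\<Sum>p\<in>I. F y * indicator (T p) y) \<partial>LM m)"
    by (intro nn_integral_mono)
  also have "\<dots> = (\<Sum>p\<in>I. \<integral>\<^sup>+y. F y * indicator (T p) y \<partial>LM m)"
    by (rule nn_integral_sum) (use T(1) F in auto)
  also have "\<dots> \<le> (\<Sum>p\<in>I. ennreal (27 * real (Suc m) ^ 2 * \<delta> / s) * (\<integral>\<^sup>+y. F y \<partial>LM m))"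
    by (intro sum_mono T(2))
  also have "\<dots> = of_nat (card I) * ennreal (27 * real (Suc m) ^ 2 * \<delta> / s) * (\<integral>\<^sup>+y. F y \<partial>LM m)"
    by (simp add: mult.assoc)
  \<comment> \<open>Two signs for each of the m+1 axes turn 27 (m+1)^2 into 54 (m+1)^3.\<close>
  also have "card I = 2 * Suc m"
    using c by (simp add: I_def card_cartesian_product)
  also have "of_nat (2 * Suc m) * ennreal (27 * real (Suc m) ^ 2 * \<delta> / s) =
      ennreal (54 * real (Suc m) ^ 3 * \<delta> / s)"
    unfolding ennreal_of_nat_eq_real_of_nat
    by (subst ennreal_mult[symmetric]) (use \<delta> s in \<open>auto simp: power2_eq_square power3_eq_cube\<close>)
  finally show ?thesis .
qed

section \<open>Volumes of balls and sectors\<close>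

lemma emeasure_L2_ball:
  assumes "0 < r"
  shows "emeasure (LM m) {y \<in> space (LM m). L2_set (\<lambda>i. y i - p i) {..m} \<le> r} =
    ennreal (r ^ Suc m) * emeasure (LM m) {y \<in> space (LM m). L2_set y {..m} \<le> 1}"
proof -
  let ?B = "{y \<in> space (LM m). L2_set (\<lambda>i. y i - p i) {..m} \<le> r}"
  have [measurable]: "?B \<in> sets (LM m)" unfolding L2_set_def by measurable
  have "emeasure (LM m) ?B = (\<integral>\<^sup>+y. indicator ?B y \<partial>LM m)" by simp
  also have "\<dots> = ennreal (r ^ card {..m}) * (\<integral>\<^sup>+y. indicator ?B (\<lambda>i\<in>{..m}. p i + r * y i) \<partial>LM m)"
    by (rule nn_integral_PiM_lborel_affine) (use assms in auto)
  also have "(\<integral>\<^sup>+y. indicator ?B (\<lambda>i\<in>{..m}. p i + r * y i) \<partial>LM m) =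
      (\<integral>\<^sup>+y. indicator {y \<in> space (LM m). L2_set y {..m} \<le> 1} y \<partial>LM m)"
  proof (intro nn_integral_cong)
    fix y assume y: "y \<in> space (LM m)"
    have "L2_set (\<lambda>i. (\<lambda>i\<in>{..m}. p i + r * y i) i - p i) {..m} = L2_set (\<lambda>i. r * y i) {..m}"
      by (rule L2_set_cong) auto
    also have "\<dots> = r * L2_set y {..m}" using assms by (simp add: L2_set_scale)
    finally show "(indicator ?B (\<lambda>i\<in>{..m}. p i + r * y i) :: ennreal) =
      indicator {y \<in> space (LM m). L2_set y {..m} \<le> 1} y"
      using y assms restrict_in_space_LM[of "\<lambda>i. p i + r * y i" m]
      by (simp add: indicator_def mult_le_cancel_left1)
  qed
  also have "\<dots> = emeasure (LM m) {y \<in> space (LM m). L2_set y {..m} \<le> 1}"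
    by simp
  finally show ?thesis by simp
qed

text \<open>Positivity and finiteness suffice, because this volume cancels in the quotients formed
  below.\<close>

lemma emeasure_unit_ball:
  obtains w where "0 < w" "emeasure (LM m) {y \<in> space (LM m). L2_set y {..m} \<le> 1} = ennreal w"
proof
  show "0 < unit_ball_vol (real (card {..m}))" by simp
  show "emeasure (LM m) {y \<in> space (LM m). L2_set y {..m} \<le> 1} = ennreal (unit_ball_vol (real (card {..m})))"
    using emeasure_cball_aux[of "{..m}" 1] by (simp add: L2_set_def Int_def conj_commute)
qed

text \<open>A narrow sector stays within distance \<open>s\<close> of the segment from the origin to
  \<open>a\<close>. Balls of radius 2s centred on that segment at spacing \<open>s\<close> cover it,
  and at most 2/s of them are needed.\<close>

lemma emeasure_sector_le:
  assumes a: "a \<in> Sph m" and s: "0 < s" "s \<le> 1"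
  shows "emeasure (LM m) (sector m a s) \<le>
    ennreal (2 / s * (2 * s) ^ Suc m) * emeasure (LM m) {y \<in> space (LM m). L2_set y {..m} \<le> 1}"
proof -
  let ?w = "emeasure (LM m) {y \<in> space (LM m). L2_set y {..m} \<le> 1}"
  let ?B = "\<lambda>k. {y \<in> space (LM m). L2_set (\<lambda>i. y i - real k * s * a i) {..m} \<le> 2 * s}"
  define N where "N = nat \<lfloor>1 / s\<rfloor>"
  have meas: "?B k \<in> sets (LM m)" for k unfolding L2_set_def by measurable
  have "sector m a s \<subseteq> (\<Union>k\<in>{..N}. ?B k)"
  proof
    fix y assume y: "y \<in> sector m a s"
    let ?L = "L2_set y {..m}" and ?t = "dotp m y a"
    have y': "y \<in> space (LM m)" "?L \<le> 1" "sqrt (1 - s\<^sup>2) * ?L \<le> ?t" using y by (auto simp: sector_def)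
    have k0: "0 \<le> sqrt (1 - s\<^sup>2)" using s by (simp add: abs_square_le_1)
    have t: "0 \<le> ?t" "?t \<le> 1"
      using y' mult_nonneg_nonneg[OF k0 L2_set_nonneg[of y "{..m}"]] abs_dotp_axis_le[OF a, of y]
      by linarith+
    have "(sqrt (1 - s\<^sup>2) * ?L)\<^sup>2 \<le> ?t\<^sup>2"
      using y'(3) k0 by (intro power_mono) auto
    then have 1: "(1 - s\<^sup>2) * ?L\<^sup>2 \<le> ?t\<^sup>2" using s by (simp add: power_mult_distrib abs_square_le_1)
    define k where "k = nat \<lfloor>?t / s\<rfloor>"
    have fl: "0 \<le> ?t / s" using t s by simp
    have "?t / s \<le> 1 / s" using t s by (intro divide_right_mono) auto
    then have kN: "k \<le> N" unfolding k_def N_def by (intro nat_mono floor_mono)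
    have kk: "real k \<le> ?t / s" "?t / s < real k + 1" using fl unfolding k_def by linarith+
    have "real k * s \<le> ?t" "?t \<le> real k * s + s" using kk s by (auto simp: field_simps)
    then have 2: "(?t - real k * s)\<^sup>2 \<le> s\<^sup>2" by (intro power_mono) auto
    have "s\<^sup>2 * ?L\<^sup>2 \<le> s\<^sup>2 * 1" using y'(2) by (intro mult_left_mono) (auto simp: abs_square_le_1)
    then have 3: "?L\<^sup>2 - ?t\<^sup>2 \<le> s\<^sup>2" using 1 by (simp add: algebra_simps)
    have "dotp m (\<lambda>i. y i - real k * s * a i) (\<lambda>i. y i - real k * s * a i) = (?L\<^sup>2 - ?t\<^sup>2) + (?t - real k * s)\<^sup>2"
      using a unfolding L2_set_power2 dotp_simps
      by (simp add: dotp_commute[of m a y] power2_eq_square algebra_simps)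
    also have "\<dots> \<le> (2 * s)\<^sup>2" using 2 3 by (simp add: power_mult_distrib) (smt (verit) zero_le_power2)
    finally have "L2_set (\<lambda>i. y i - real k * s * a i) {..m} \<le> 2 * s"
      unfolding L2_set_dotp using s by (intro real_le_lsqrt) auto
    then show "y \<in> (\<Union>k\<in>{..N}. ?B k)" using y' kN by auto
  qed
  then have "emeasure (LM m) (sector m a s) \<le> emeasure (LM m) (\<Union>k\<in>{..N}. ?B k)"
    by (rule emeasure_mono) (use meas in auto)
  also have "\<dots> \<le> (\<Sum>k\<in>{..N}. emeasure (LM m) (?B k))"
    by (rule emeasure_subadditive_finite) (use meas in auto)
  also have "\<dots> = (\<Sum>k\<in>{..N}. ennreal ((2 * s) ^ Suc m) * ?w)"
    using emeasure_L2_ball[of "2 * s" m] s by simp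
  also have "\<dots> = of_nat (Suc N) * ennreal ((2 * s) ^ Suc m) * ?w"
    by (simp add: mult.assoc)
  also have "of_nat (Suc N) * ennreal ((2 * s) ^ Suc m) = ennreal (real (Suc N) * (2 * s) ^ Suc m)"
    unfolding ennreal_of_nat_eq_real_of_nat by (subst ennreal_mult) (use s in auto)
  also have "\<dots> * ?w \<le> ennreal (2 / s * (2 * s) ^ Suc m) * ?w"
  proof (intro mult_right_mono ennreal_leI)
    have "1 \<le> 1 / s" using s by simp
    then have "real (Suc N) \<le> 1 / s + 1 / s" unfolding N_def by linarith
    then show "real (Suc N) \<le> 2 / s" by simp
  qed (use s in auto)
  finally show ?thesis .
qed

lemma emeasure_sector_ge:
  assumes a: "a \<in> Sph m" and t: "0 < t" "t \<le> 1"
  shows "ennreal ((t / 3) ^ Suc m) * emeasure (LM m) {y \<in> space (LM m). L2_set y {..m} \<le> 1}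
    \<le> emeasure (LM m) (sector m a t)"
proof -
  have "{y \<in> space (LM m). L2_set (\<lambda>i. y i - a i / 2) {..m} \<le> t / 3} \<subseteq> sector m a t"
  proof safe
    fix y assume y: "y \<in> space (LM m)" "L2_set (\<lambda>i. y i - a i / 2) {..m} \<le> t / 3"
    have "(\<lambda>i\<in>{..m}. a i / 2 + (y i - a i / 2)) = y"
      using y(1) by (auto simp: space_PiM PiE_def extensional_def)
    then show "y \<in> sector m a t" using ball_in_sector(1)[OF a t y(2)] by simp
  qed
  then have "emeasure (LM m) {y \<in> space (LM m). L2_set (\<lambda>i. y i - a i / 2) {..m} \<le> t / 3} \<le> emeasure (LM m) (sector m a t)"
    by (rule emeasure_mono) simp
  then show ?thesis using emeasure_L2_ball[of "t/3" m "\<lambda>i. a i / 2"] t by simp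
qed

lemma emeasure_sector_pos_finite:
  assumes a: "a \<in> Sph m" and t: "0 < t" "t \<le> 1"
  shows "0 < emeasure (LM m) (sector m a t)" "emeasure (LM m) (sector m a t) < \<infinity>"
proof -
  obtain w where w: "0 < w" "emeasure (LM m) {y \<in> space (LM m). L2_set y {..m} \<le> 1} = ennreal w"
    by (rule emeasure_unit_ball)
  have "0 < ennreal ((t / 3) ^ Suc m) * ennreal w"
    using w t by (simp add: ennreal_mult[symmetric] del: power_Suc)
  also have "\<dots> \<le> emeasure (LM m) (sector m a t)" using emeasure_sector_ge[OF a t] w by simp
  finally show "0 < emeasure (LM m) (sector m a t)" .
  have "emeasure (LM m) (sector m a t) \<le> emeasure (LM m) {y \<in> space (LM m). L2_set y {..m} \<le> 1}"
    by (rule emeasure_mono) (auto simp: sector_def)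
  then show "emeasure (LM m) (sector m a t) < \<infinity>" unfolding w(2) by (simp add: le_less_trans)
qed

text \<open>The covering bound for the small sector is divided by the inscribed ball of the large
  one: 2/(tr) (2tr)^(m+1) / (t/3)^(m+1) = 12/t (6r)^m. The exponent m, the dimension of the cap, is
  what beats a singularity of order \<beta> < m.\<close>

lemma emeasure_sector_ratio:
  assumes a: "a \<in> Sph m" and t: "0 < t" "t \<le> 1" and r: "0 < r" "r \<le> 1"
  shows "emeasure (LM m) (sector m a (t * r)) \<le> ennreal (12 / t * (6 * r) ^ m) * emeasure (LM m) (sector m a t)"
proof -
  let ?w = "emeasure (LM m) {y \<in> space (LM m). L2_set y {..m} \<le> 1}"
  have tr: "0 < t * r" "t * r \<le> 1" using t r by (auto intro: mult_le_one)
  have "12 / t * (6 * r) ^ m * (t / 3) ^ Suc m = 2 / (t * r) * (2 * (t * r)) ^ Suc m"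
  proof -
    have "(6 * r) ^ Suc m * (t / 3) ^ Suc m = (2 * (t * r)) ^ Suc m"
      unfolding power_mult_distrib[symmetric] by (simp add: mult.assoc mult.commute)
    moreover have "12 / t * (6 * r) ^ m = 2 / (t * r) * (6 * r) ^ Suc m" using r t by simp
    ultimately show ?thesis by (simp only: mult.assoc)
  qed
  then have eq: "ennreal (2 / (t * r) * (2 * (t * r)) ^ Suc m) = ennreal (12 / t * (6 * r) ^ m) * ennreal ((t / 3) ^ Suc m)"
    using t r by (subst ennreal_mult[symmetric]) auto
  have "emeasure (LM m) (sector m a (t * r)) \<le> ennreal (2 / (t * r) * (2 * (t * r)) ^ Suc m) * ?w"
    by (rule emeasure_sector_le[OF a tr])
  also have "\<dots> = ennreal (12 / t * (6 * r) ^ m) * (ennreal ((t / 3) ^ Suc m) * ?w)"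
    by (simp only: eq mult.assoc)
  also have "\<dots> \<le> ennreal (12 / t * (6 * r) ^ m) * emeasure (LM m) (sector m a t)"
    by (intro mult_left_mono emeasure_sector_ge[OF a t]) auto
  finally show ?thesis .
qed

subsection \<open>Adversarial distributions\<close>

definition proj :: "nat \<Rightarrow> (nat \<Rightarrow> real) \<Rightarrow> nat \<Rightarrow> real" where
  "proj m y = (\<lambda>i. if i \<le> m then y i / L2_set y {..m} else 0)"

lemma measurable_proj [measurable]: "proj m \<in> measurable (LM m) borel"
proof (rule measurable_coordinatewise_then_product)
  fix i
  show "(\<lambda>y. proj m y i) \<in> borel_measurable (LM m)"
  proof (cases "i \<le> m")
    case True
    then have [measurable]: "(\<lambda>y. y i) \<in> borel_measurable (LM m)" by simp
    from True show ?thesis unfolding proj_def by simp measurable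
  qed (simp add: proj_def)
qed

lemma closed_Sph: "closed (Sph m)"
proof -
  have "Sph m = {x. (\<Sum>i\<le>m. x i ^ 2) = 1} \<inter> (\<Inter>i\<in>{m<..}. {x. x i = 0})"
    by (auto simp: nsphere)
  also have "closed \<dots>"
    by (intro closed_Int closed_INT ballI closed_Collect_eq continuous_intros) auto
  finally show ?thesis .
qed

lemma sets_borel_Sph [measurable]: "Sph m \<in> sets borel"
  using closed_Sph by (rule borel_closed)

lemma continuous_on_dotp: "continuous_on UNIV (\<lambda>x. dotp m x w)"
  unfolding dotp_def by (intro continuous_intros) auto

lemma borel_measurable_dotp [measurable]: "(\<lambda>x. dotp m x w) \<in> borel_measurable borel"
  using continuous_on_dotp by (rule borel_measurable_continuous_onI)

lemma dotp_proj: "dotp m (proj m y) w = dotp m y w / L2_set y {..m}"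
proof -
  have "dotp m (proj m y) w = dotp m (\<lambda>i. y i / L2_set y {..m}) w"
    by (rule dotp_cong) (auto simp: proj_def)
  then show ?thesis by (simp add: dotp_simps)
qed

lemma proj_in_Sph_iff: "proj m y \<in> Sph m \<longleftrightarrow> 0 < L2_set y {..m}"
proof
  assume "proj m y \<in> Sph m"
  then have "dotp m (proj m y) (proj m y) = 1" by simp
  then have "L2_set y {..m} \<noteq> 0" unfolding dotp_proj by auto
  then show "0 < L2_set y {..m}" by (simp add: less_le)
next
  assume pos: "0 < L2_set y {..m}"
  have "dotp m (proj m y) (proj m y) = dotp m y y / (L2_set y {..m})\<^sup>2"
    unfolding dotp_proj dotp_commute[of m y "proj m y"] by (simp add: power2_eq_square)
  also have "\<dots> = 1" unfolding L2_set_power2[symmetric] using pos by simp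
  finally show "proj m y \<in> Sph m" by (simp add: Sph_iff proj_def)
qed

text \<open>For \<alpha> \<le> pi/2 the cosine of the half-angle is the nonnegative root of 1 -
  sin^2 \<alpha>, so the cap condition becomes the cone condition of the sector.\<close>

lemma proj_in_cap_iff:
  assumes a: "a \<in> Sph m" and al: "0 < \<alpha>" "\<alpha> \<le> pi / 2" and y: "y \<in> space (LM m)"
  shows "L2_set y {..m} \<le> 1 \<and> proj m y \<in> cap m a \<alpha> \<longleftrightarrow> y \<in> sector m a (sin \<alpha>)"
proof (cases "0 < L2_set y {..m}")
  case True
  let ?p = "proj m y"
  have p: "?p \<in> Sph m" using True by (simp add: proj_in_Sph_iff)
  have ca: "sqrt (1 - (sin \<alpha>)\<^sup>2) = cos \<alpha>"
    using al pi_gt3 cos_squared_eq[of \<alpha>] cos_ge_zero[of \<alpha>] by (simp add: cos_squared_eq[symmetric])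
  have "ang m ?p a \<le> pi"
    using abs_dotp_Sph_le[OF p a] unfolding ang_def by (intro arccos_ubound) auto
  then have "ang m ?p a \<le> \<alpha> \<longleftrightarrow> cos \<alpha> \<le> cos (ang m ?p a)"
    using ang_nonneg[OF p a] al by (intro cos_mono_le_eq[symmetric]) auto
  also have "\<dots> \<longleftrightarrow> sqrt (1 - (sin \<alpha>)\<^sup>2) * L2_set y {..m} \<le> dotp m y a"
    unfolding cos_ang[OF p a] dotp_proj ca using True by (simp add: pos_le_divide_eq)
  finally show ?thesis using p True y by (auto simp: cap_def sector_def)
next
  case False
  then show ?thesis using proj_in_Sph_iff[of m y] by (auto simp: cap_def sector_def)
qed

lemma sphere_measure_proj:
  "sphere_measure m = restrict_space
     (distr (uniform_measure (LM m) {x \<in> space (LM m). L2_set x {..m} \<le> 1}) borel (proj m)) (Sph m)"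
  by (simp add: sphere_measure_def Let_def proj_def[abs_def])

lemma sets_sphere_measure [measurable_cong]:
  "sets (sphere_measure m) = sets (restrict_space borel (Sph m))"
  unfolding sphere_measure_proj by (rule sets_restrict_space_cong) simp

lemma sets_cap: "cap m a \<alpha> \<in> sets (sphere_measure m)" "cap m a \<alpha> \<in> sets borel" if "a \<in> Sph m" "\<alpha> \<le> pi"
proof -
  have "cap m a \<alpha> = {x \<in> Sph m. max (-1) (cos (max 0 \<alpha>)) \<le> dotp m x a \<and> 0 \<le> \<alpha>}"
  proof -
    have "ang m x a \<le> \<alpha> \<longleftrightarrow> max (-1) (cos (max 0 \<alpha>)) \<le> dotp m x a \<and> 0 \<le> \<alpha>" if x: "x \<in> Sph m" for x
    proof (cases "0 \<le> \<alpha>")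
      case True
      have "ang m x a \<le> pi"
        using abs_dotp_Sph_le[OF x \<open>a \<in> Sph m\<close>] unfolding ang_def by (intro arccos_ubound) auto
      then have "ang m x a \<le> \<alpha> \<longleftrightarrow> cos \<alpha> \<le> cos (ang m x a)"
        using ang_nonneg[OF x \<open>a \<in> Sph m\<close>] \<open>\<alpha> \<le> pi\<close> True by (intro cos_mono_le_eq[symmetric]) auto
      then show ?thesis using True cos_ang[OF x \<open>a \<in> Sph m\<close>] by simp
    qed (use ang_nonneg[OF x \<open>a \<in> Sph m\<close>] in auto)
    then show ?thesis by (auto simp: cap_def)
  qed
  moreover have "{x \<in> space borel. max (-1) (cos (max 0 \<alpha>)) \<le> dotp m x a \<and> 0 \<le> \<alpha>} \<in> sets borel"
    by measurable
  ultimately have "cap m a \<alpha> = Sph m \<inter> {x \<in> space borel. max (-1) (cos (max 0 \<alpha>)) \<le> dotp m x a \<and> 0 \<le> \<alpha>}"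
     "Sph m \<inter> {x \<in> space borel. max (-1) (cos (max 0 \<alpha>)) \<le> dotp m x a \<and> 0 \<le> \<alpha>} \<in> sets borel"
    by auto
  then show "cap m a \<alpha> \<in> sets borel" by simp
  then show "cap m a \<alpha> \<in> sets (sphere_measure m)"
    unfolding sets_sphere_measure by (subst sets_restrict_space_iff) (auto simp: cap_def)
qed

lemma nn_integral_sphere_measure:
  assumes f: "f \<in> borel_measurable (restrict_space borel (Sph m))"
  shows "(\<integral>\<^sup>+x. f x \<partial>sphere_measure m) =
    (\<integral>\<^sup>+y. f (proj m y) * indicator (Sph m) (proj m y) * indicator {x \<in> space (LM m). L2_set x {..m} \<le> 1} y \<partial>LM m)
      / emeasure (LM m) {x \<in> space (LM m). L2_set x {..m} \<le> 1}"
proof -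
  have [measurable]: "(\<lambda>x. f x * indicator (Sph m) x) \<in> borel_measurable borel"
    using f by (subst (asm) borel_measurable_restrict_space_iff_ennreal) auto
  have m: "proj m \<in> measurable (uniform_measure (LM m) {x \<in> space (LM m). L2_set x {..m} \<le> 1}) borel"
    by (subst measurable_cong_sets[OF sets_uniform_measure refl]) measurable
  show ?thesis
    unfolding sphere_measure_proj
    by (subst nn_integral_restrict_space; (subst nn_integral_distr[OF m])?;
        (subst nn_integral_uniform_measure)?) auto
qed

text \<open>This trades the measure on the sphere for Lebesgue measure on a solid sector; the
  normalisation by the unit ball cancels.\<close>

lemma nn_integral_cap_measure:
  assumes f: "f \<in> borel_measurable (restrict_space borel (Sph m))"
    and a: "a \<in> Sph m" and al: "0 < \<alpha>" "\<alpha> \<le> pi / 2"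
  shows "(\<integral>\<^sup>+x. f x \<partial>cap_measure m a \<alpha>) =
    (\<integral>\<^sup>+y. f (proj m y) * indicator (sector m a (sin \<alpha>)) y \<partial>LM m) / emeasure (LM m) (sector m a (sin \<alpha>))"
proof -
  let ?B = "{x \<in> space (LM m). L2_set x {..m} \<le> 1}"
  have cap: "cap m a \<alpha> \<in> sets (sphere_measure m)" "cap m a \<alpha> \<in> sets borel"
    using sets_cap[OF a, of \<alpha>] al pi_gt_zero by auto
  obtain w where w: "0 < w" "emeasure (LM m) ?B = ennreal w" by (rule emeasure_unit_ball)
  have ind: "f (proj m y) * indicator (cap m a \<alpha>) (proj m y) * indicator (Sph m) (proj m y) * indicator ?B y
     = f (proj m y) * indicator (sector m a (sin \<alpha>)) y" if y: "y \<in> space (LM m)" for f :: "_ \<Rightarrow> ennreal" and y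
    using proj_in_cap_iff[OF a al y] y by (auto simp: indicator_def cap_def)
  have int: "(\<integral>\<^sup>+x. f x * indicator (cap m a \<alpha>) x \<partial>sphere_measure m) =
     (\<integral>\<^sup>+y. f (proj m y) * indicator (sector m a (sin \<alpha>)) y \<partial>LM m) / ennreal w"
    if [measurable]: "f \<in> borel_measurable (restrict_space borel (Sph m))" for f
  proof -
    have [measurable]: "cap m a \<alpha> \<in> sets (restrict_space borel (Sph m))"
      using cap(1) by (simp add: sets_sphere_measure)
    have "(\<lambda>x. f x * indicator (cap m a \<alpha>) x) \<in> borel_measurable (restrict_space borel (Sph m))"
      by measurable
    from nn_integral_sphere_measure[OF this] show ?thesis
      unfolding w(2) by (simp add: ind cong: nn_integral_cong)
  qed
  have "emeasure (sphere_measure m) (cap m a \<alpha>) = (\<integral>\<^sup>+x. 1 * indicator (cap m a \<alpha>) x \<partial>sphere_measure m)"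
    using cap by simp
  also have "\<dots> = emeasure (LM m) (sector m a (sin \<alpha>)) / ennreal w"
    by (subst int) auto
  finally have e: "emeasure (sphere_measure m) (cap m a \<alpha>) = emeasure (LM m) (sector m a (sin \<alpha>)) / ennreal w" .
  have "(\<integral>\<^sup>+x. f x \<partial>cap_measure m a \<alpha>) =
      (\<integral>\<^sup>+x. f x * indicator (cap m a \<alpha>) x \<partial>sphere_measure m) / emeasure (sphere_measure m) (cap m a \<alpha>)"
    unfolding cap_measure_def
    by (rule nn_integral_uniform_measure) (use f cap in \<open>auto simp: measurable_cong_sets[OF sets_sphere_measure refl]\<close>)
  also have "\<dots> = (\<integral>\<^sup>+y. f (proj m y) * indicator (sector m a (sin \<alpha>)) y \<partial>LM m) * inverse (ennreal w) /
      (emeasure (LM m) (sector m a (sin \<alpha>)) * inverse (ennreal w))"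
    unfolding int[OF f] e by (simp add: divide_ennreal_def)
  also have "\<dots> = (\<integral>\<^sup>+y. f (proj m y) * indicator (sector m a (sin \<alpha>)) y \<partial>LM m) / emeasure (LM m) (sector m a (sin \<alpha>))"
    by (rule divide_mult_eq) (use w in \<open>auto simp: inverse_ennreal\<close>)
  finally show ?thesis .
qed

text \<open>On the interval, sin^(m-1) t = sin^\<beta> t sin^(m-\<beta>-1) t, and the first factor
  is at most its value at \<alpha>. If an integral fails to exist, its default value 0 (and division
  by 0) makes the bound trivial. The bound lets the normalising constant turn r^(-\<beta>) into
  (r/sin \<alpha>)^(-\<beta>).\<close>

lemma sin_int_le:
  assumes "0 \<le> \<beta>" "0 < \<alpha>" "\<alpha> \<le> pi / 2"
  shows "sin_int m \<alpha> / sin_int (m - \<beta>) \<alpha> \<le> sin \<alpha> powr \<beta>" "0 \<le> sin_int m \<alpha> / sin_int (m - \<beta>) \<alpha>"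
proof -
  let ?f = "\<lambda>t. sin t powr (m - 1)" and ?g = "\<lambda>t. sin t powr (m - \<beta> - 1)"
  have nn: "0 \<le> sin_int k \<alpha>" for k
    unfolding sin_int_def
    by (cases "(\<lambda>t. sin t powr (k - 1)) integrable_on {0..\<alpha>}")
       (auto intro: integral_nonneg simp: not_integrable_integral)
  then show "0 \<le> sin_int m \<alpha> / sin_int (m - \<beta>) \<alpha>" by simp
  have "sin_int m \<alpha> \<le> sin \<alpha> powr \<beta> * sin_int (m - \<beta>) \<alpha>" if g: "?g integrable_on {0..\<alpha>}"
  proof (cases "?f integrable_on {0..\<alpha>}")
    case True
    have le: "?f t \<le> sin \<alpha> powr \<beta> * ?g t" if t: "t \<in> {0..\<alpha>}" for t
    proof -
      have "0 \<le> sin t" "sin t \<le> sin \<alpha>"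
        using t assms by (auto intro!: sin_ge_zero sin_monotone_2pi_le)
      then have "sin t powr \<beta> * ?g t \<le> sin \<alpha> powr \<beta> * ?g t"
        using assms by (intro mult_right_mono powr_mono2) auto
      moreover have "?f t = sin t powr \<beta> * ?g t" by (simp add: powr_add[symmetric])
      ultimately show ?thesis by simp
    qed
    have "sin_int m \<alpha> \<le> integral {0..\<alpha>} (\<lambda>t. sin \<alpha> powr \<beta> * ?g t)"
      unfolding sin_int_def using True g le by (intro integral_le integrable_on_mult_right) auto
    then show ?thesis by (simp add: sin_int_def)
  next
    case False
    then have "sin_int m \<alpha> = 0" by (simp add: sin_int_def not_integrable_integral)
    then show ?thesis using nn by simp
  qed
  moreover have "sin_int (m - \<beta>) \<alpha> = 0" if "\<not> ?g integrable_on {0..\<alpha>}"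
    using that by (simp add: sin_int_def not_integrable_integral)
  ultimately show "sin_int m \<alpha> / sin_int (m - \<beta>) \<alpha> \<le> sin \<alpha> powr \<beta>"
    using nn[of "m - \<beta>"] by (cases "sin_int (m - \<beta>) \<alpha> = 0") (auto simp: pos_divide_le_eq less_le mult.commute)
qed

lemma sets_adversarial:
  assumes "adversarial m \<alpha> \<beta> H a \<mu>"
  shows "sets \<mu> = sets (restrict_space borel (Sph m))"
  using assms by (auto simp: adversarial_def cap_measure_def sets_sphere_measure)

text \<open>
  Outside \<open>{0..sin \<alpha>}\<close> the function in \<^const>\<open>adversarial\<close> is arbitrary, possibly not measurable; \<open>k\<close> is
  a measurable replacement that agrees with it on that interval.
\<close>
lemma adversarial_density:
  assumes adv: "adversarial m \<alpha> \<beta> H a \<mu>" and a: "a \<in> Sph m" and al: "0 < \<alpha>" "\<alpha> \<le> pi / 2"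
    and be: "0 \<le> \<beta>"
  shows "\<exists>k. antimono_on {0..sin \<alpha>} k \<and> k \<in> borel_measurable borel \<and>
    (\<forall>r. 0 < r \<and> r \<le> sin \<alpha> \<longrightarrow> k r \<le> ennreal (H * (r / sin \<alpha>) powr (- \<beta>))) \<and>
    (\<beta> = 0 \<longrightarrow> k 0 \<le> ennreal H) \<and>
    (\<forall>G\<in>sets borel. G \<subseteq> Sph m \<longrightarrow> emeasure \<mu> G =
      (\<integral>\<^sup>+y. k (axis_sin m a y) * indicator G (proj m y) * indicator (sector m a (sin \<alpha>)) y \<partial>LM m)
        / emeasure (LM m) (sector m a (sin \<alpha>)))"
proof -
  define \<sigma> where "\<sigma> = sin \<alpha>"
  have \<sigma>: "0 < \<sigma>" "\<sigma> \<le> 1" using al pi_gt_zero by (auto simp: \<sigma>_def intro!: sin_gt_zero)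
  define C where "C = sin_int m \<alpha> / sin_int (m - \<beta>) \<alpha>"
  have C: "C \<le> \<sigma> powr \<beta>" "0 \<le> C" using sin_int_le[OF be al, of m] by (auto simp: C_def \<sigma>_def)
  obtain g h where \<mu>: "\<mu> = density (cap_measure m a \<alpha>) (\<lambda>x. g (sin (ang m x a)))"
    and g: "antimono_on {0..\<sigma>} g" "\<And>r. r \<in> {0..\<sigma>} \<Longrightarrow> g r = ennreal C * neg_power r \<beta> * ennreal (h r)"
    and h: "continuous_on {0..\<sigma>} h" "\<And>r. r \<in> {0..\<sigma>} \<Longrightarrow> 0 \<le> h r" "H = (SUP r\<in>{0..\<sigma>}. h r)"
    using adv unfolding adversarial_def C_def \<sigma>_def by blast
  have "compact (h ` {0..\<sigma>})" using h(1) by (intro compact_continuous_image) auto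
  then have bdd: "bdd_above (h ` {0..\<sigma>})" by (intro bounded_imp_bdd_above compact_imp_bounded)
  have hH: "h r \<le> H" if "r \<in> {0..\<sigma>}" for r unfolding h(3) using bdd that by (intro cSUP_upper)
  define k where "k r = ennreal C * neg_power r \<beta> * ennreal (indicator {0..\<sigma>} r *\<^sub>R h r)" for r
  have kg: "k r = g r" if "r \<in> {0..\<sigma>}" for r using that g(2) by (simp add: k_def)
  have hm: "(\<lambda>r. indicator {0..\<sigma>} r *\<^sub>R h r) \<in> borel_measurable borel"
    using h(1) by (intro borel_measurable_continuous_on_indicator) auto
  have km[measurable]: "k \<in> borel_measurable borel"
    unfolding k_def neg_power_def using hm by measurable
  show ?thesis
  proof (intro exI conjI allI impI ballI)
    show "antimono_on {0..sin \<alpha>} k"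
      using g(1) unfolding monotone_on_def \<sigma>_def[symmetric] by (simp add: kg)
    show "k \<in> borel_measurable borel" by (rule km)
    show "k r \<le> ennreal (H * (r / sin \<alpha>) powr (- \<beta>))" if r: "0 < r \<and> r \<le> sin \<alpha>" for r
    proof -
      have rm: "r \<in> {0..\<sigma>}" using r by (simp add: \<sigma>_def)
      have "neg_power r \<beta> = ennreal (r powr - \<beta>)"
        using r by (auto simp: neg_power_def inverse_ennreal powr_minus)
      then have "k r = ennreal (C * r powr - \<beta> * h r)"
        using rm C h(2)[OF rm] by (simp add: k_def ennreal_mult)
      also have "\<dots> \<le> ennreal (\<sigma> powr \<beta> * r powr - \<beta> * H)"
        using C hH[OF rm] h(2)[OF rm] by (intro ennreal_leI mult_mono mult_nonneg_nonneg) auto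
      also have "\<sigma> powr \<beta> * r powr - \<beta> * H = H * (r / \<sigma>) powr - \<beta>"
        using r \<sigma> by (simp add: powr_divide[of r \<sigma>] powr_minus field_simps)
      finally show ?thesis by (simp add: \<sigma>_def)
    qed
    show "k 0 \<le> ennreal H" if "\<beta> = 0"
    proof -
      have z: "0 \<in> {0..\<sigma>}" using \<sigma> by simp
      have "k 0 = ennreal (C * h 0)" using that C h(2)[OF z] \<sigma> by (simp add: k_def neg_power_def ennreal_mult)
      also have "\<dots> \<le> ennreal (1 * H)"
        using C that hH[OF z] h(2)[OF z] \<sigma> by (intro ennreal_leI mult_mono) auto
      finally show ?thesis by simp
    qed
    let ?N = "cap_measure m a \<alpha>"
    have setsN: "sets ?N = sets (restrict_space borel (Sph m))"
      by (simp add: cap_measure_def sets_sphere_measure)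
    define f where "f x = k (sqrt (1 - (dotp m x a)\<^sup>2))" for x
    have f[measurable]: "f \<in> borel_measurable borel" unfolding f_def by measurable
    have eq: "g (sin (ang m x a)) = f x" if "x \<in> cap m a \<alpha>" for x
    proof -
      have x: "x \<in> Sph m" "ang m x a \<le> \<alpha>" using that by (auto simp: cap_def)
      have "sin (ang m x a) = sqrt (1 - (dotp m x a)\<^sup>2)"
        unfolding ang_def using abs_dotp_Sph_le[OF x(1) a] by (intro sin_arccos) auto
      moreover have "sin (ang m x a) \<le> \<sigma>" "0 \<le> sin (ang m x a)"
        using x ang_nonneg[OF x(1) a] al unfolding \<sigma>_def
        by (auto intro!: sin_monotone_2pi_le sin_ge_zero)
      ultimately show ?thesis by (simp add: f_def kg)
    qed
    have capm: "cap m a \<alpha> \<in> sets (sphere_measure m)"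
      using sets_cap(1)[OF a, of \<alpha>] al pi_gt_zero by auto
    have AE: "AE x in ?N. g (sin (ang m x a)) = f x"
      unfolding cap_measure_def using capm by (rule AE_uniform_measureI) (auto simp: eq)
    \<comment> \<open>The original density may be non-measurable, so the two set functions inside
      \<open>density\<close> are compared directly; equality almost everywhere is enough for the
      integrals to agree.\<close>
    have "(\<lambda>A. \<integral>\<^sup>+x. g (sin (ang m x a)) * indicator A x \<partial>?N) = (\<lambda>A. \<integral>\<^sup>+x. f x * indicator A x \<partial>?N)"
      using AE by (intro ext nn_integral_cong_AE) auto
    then have \<mu>': "\<mu> = density ?N f" unfolding \<mu> density_def by simp
    fix G :: "(nat \<Rightarrow> real) set" assume G: "G \<in> sets borel" "G \<subseteq> Sph m"
    have GN: "G \<in> sets (restrict_space borel (Sph m))" using G by (subst sets_restrict_space_iff) auto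
    have fr[measurable]: "f \<in> borel_measurable (restrict_space borel (Sph m))"
      by (rule measurable_restrict_space1) measurable
    have "emeasure \<mu> G = (\<integral>\<^sup>+x. f x * indicator G x \<partial>?N)"
      unfolding \<mu>' by (rule emeasure_density) (use fr GN setsN in \<open>auto simp: measurable_cong_sets[OF setsN refl]\<close>)
    also have "\<dots> = (\<integral>\<^sup>+y. f (proj m y) * indicator G (proj m y) * indicator (sector m a (sin \<alpha>)) y \<partial>LM m)
        / emeasure (LM m) (sector m a (sin \<alpha>))"
      by (rule nn_integral_cap_measure[OF _ a al]) (use GN in measurable)
    also have "(\<lambda>y. f (proj m y)) = (\<lambda>y. k (axis_sin m a y))"
      by (simp add: f_def axis_sin_def dotp_proj)
    finally show "emeasure \<mu> G = (\<integral>\<^sup>+y. k (axis_sin m a y) * indicator G (proj m y) * indicator (sector m a (sin \<alpha>)) y \<partial>LM m)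
        / emeasure (LM m) (sector m a (sin \<alpha>))" by (simp add: fun_eq_iff)
  qed
qed

section \<open>Probabilities of slabs\<close>

text \<open>The open half-spaces with bound 2\<delta> cover all points that have a witness with
  bound \<delta>, so Lindelof extracts countably many. Doubling makes the half-spaces open and
  contain the closed ones; countability makes the resulting sets measurable.\<close>

lemma countable_slab_witnesses:
  assumes "0 < \<delta>"
  obtains D where "countable D" "D \<subseteq> P" "\<And>b. \<exists>x\<in>P. dotp m b x \<le> \<delta> \<Longrightarrow> \<exists>x\<in>D. dotp m b x < 2 * \<delta>"
proof -
  let ?U = "\<lambda>x. {b. dotp m b x < 2 * \<delta>}"
  have op: "open (?U x)" for x
    by (intro open_Collect_less continuous_on_dotp continuous_on_const)
  obtain F where F: "F \<subseteq> ?U ` P" "countable F" "\<Union>F = \<Union>(?U ` P)"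
    by (rule Lindelof[of "?U ` P"]) (use op in auto)
  then obtain D where D: "countable D" "D \<subseteq> P" "F = ?U ` D"
    using countable_subset_image[of F ?U P] by blast
  show thesis
  proof
    fix b assume "\<exists>x\<in>P. dotp m b x \<le> \<delta>"
    then have "b \<in> \<Union>(?U ` P)" using assms by force
    then show "\<exists>x\<in>D. dotp m b x < 2 * \<delta>" using F(3) D(3) by auto
  qed (use D in auto)
qed

text \<open>For compact nonempty \<open>P\<close> this says that the minimum of the inner products
  over \<open>P\<close> lies between -\<delta> and \<delta>. Quantifiers give it a meaning for every
  \<open>P\<close>; the slab of the empty set is empty.\<close>

definition slab :: "nat \<Rightarrow> (nat \<Rightarrow> real) set \<Rightarrow> real \<Rightarrow> (nat \<Rightarrow> real) set" where
  "slab m P \<delta> = {b \<in> Sph m. (\<exists>x\<in>P. dotp m b x \<le> \<delta>) \<and> (\<forall>w\<in>P. - \<delta> \<le> dotp m b w)}"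

text \<open>A point of the sector is its projection scaled by a factor at most 1, which preserves an
  upper bound 2\<delta> and a lower bound -\<delta>. Hence the solid slab contains the cone over the
  spherical one.\<close>

lemma nn_integral_slab_le:
  fixes f :: "real \<Rightarrow> ennreal"
  assumes a: "a \<in> Sph m" and s: "0 < s" "s \<le> t" "t \<le> 1"
    and f: "antimono_on {0..t} f" "f \<in> borel_measurable borel" and \<delta>: "0 < \<delta>" and P: "P \<subseteq> Sph m"
    and G: "G \<subseteq> slab m P \<delta>"
  shows "(\<integral>\<^sup>+y. f (max (axis_sin m a y) s) * indicator G (proj m y) * indicator (sector m a t) y \<partial>LM m)
    \<le> ennreal (54 * real (Suc m) ^ 3 * \<delta> / s) *
      (\<integral>\<^sup>+y. f (max (axis_sin m a y) s) * indicator (sector m a t) y \<partial>LM m)"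
proof -
  obtain D where D: "countable D" "D \<subseteq> P" "\<And>b. \<exists>x\<in>P. dotp m b x \<le> \<delta> \<Longrightarrow> \<exists>x\<in>D. dotp m b x < 2 * \<delta>"
    using countable_slab_witnesses[OF \<delta>] by metis
  define E where "E = {y \<in> space (LM m). (\<exists>x\<in>D. dotp m y x < 2 * \<delta>) \<and> (\<forall>w\<in>D. - \<delta> \<le> dotp m y w)}"
  have sub: "y \<in> E" if y: "y \<in> sector m a t" and Gy: "proj m y \<in> G" for y
  proof -
    let ?L = "L2_set y {..m}"
    have L: "0 < ?L" "?L \<le> 1" "y \<in> space (LM m)" using y by (auto simp: sector_def)
    have sl: "\<exists>x\<in>P. dotp m (proj m y) x \<le> \<delta>" "\<forall>w\<in>P. - \<delta> \<le> dotp m (proj m y) w"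
      using G Gy by (auto simp: slab_def)
    have dy: "dotp m y w = ?L * dotp m (proj m y) w" for w using L by (simp add: dotp_proj)
    obtain x where x: "x \<in> D" "dotp m (proj m y) x < 2 * \<delta>" using D(3) sl(1) by blast
    have "dotp m y x < 2 * \<delta>"
    proof (cases "dotp m (proj m y) x \<le> 0")
      case True
      then have "dotp m y x \<le> 0" unfolding dy using L by (simp add: mult_nonneg_nonpos)
      then show ?thesis using \<delta> by simp
    next
      case False
      then have "dotp m y x \<le> 1 * dotp m (proj m y) x" unfolding dy using L by (intro mult_right_mono) auto
      then show ?thesis using x by simp
    qed
    moreover have "- \<delta> \<le> dotp m y w" if "w \<in> D" for w
    proof -
      have "- \<delta> \<le> ?L * (- \<delta>)" using L \<delta> by simp
      also have "\<dots> \<le> dotp m y w" unfolding dy using sl(2) D(2) that L by (intro mult_left_mono) auto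
      finally show ?thesis .
    qed
    ultimately show ?thesis using x(1) L by (auto simp: E_def)
  qed
  have [measurable]: "(\<lambda>y. f (max (axis_sin m a y) s)) \<in> borel_measurable (LM m)"
    using f(2) by measurable
  have "(\<integral>\<^sup>+y. f (max (axis_sin m a y) s) * indicator G (proj m y) * indicator (sector m a t) y \<partial>LM m)
    \<le> (\<integral>\<^sup>+y. (f (max (axis_sin m a y) s) * indicator (sector m a t) y) * indicator E y \<partial>LM m)"
    using sub by (intro nn_integral_mono) (auto simp: indicator_def)
  also have "\<dots> \<le> ennreal (54 * real (Suc m) ^ 3 * \<delta> / s) *
      (\<integral>\<^sup>+y. f (max (axis_sin m a y) s) * indicator (sector m a t) y \<partial>LM m)"
    unfolding E_def
    by (rule nn_integral_sector_slab_le[OF a s f(1) \<delta> D(1)]) (use D(2) P in auto)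
  finally show ?thesis .
qed

text \<open>Keeps the ratio of a geometric series below 1 by a multiple of \<open>x\<close>. It
  rests on ln 2 \<ge> 1/2 and exp u \<ge> 1 + u.\<close>

lemma half_powr_le:
  fixes x :: real
  assumes "0 < x" "x \<le> 1" "x \<le> p"
  shows "(1 / 2) powr p \<le> 1 - x / 4"
proof -
  have "(1 / 2 :: real) powr p \<le> (1 / 2) powr x"
    using assms by (intro powr_mono') auto
  also have "\<dots> = exp (- (x * ln 2))" by (simp add: powr_def ln_div)
  also have "\<dots> \<le> 1 / (1 + x / 2)"
  proof -
    have "1 + x / 2 \<le> 1 + x * ln 2"
      using ln2_ge_two_thirds assms mult_left_mono[of "1/2" "ln 2" x] by simp
    also have "\<dots> \<le> exp (x * ln 2)" by (rule exp_ge_add_one_self)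
    finally have "1 / exp (x * ln 2) \<le> 1 / (1 + x / 2)"
      using assms by (intro divide_left_mono) auto
    then show ?thesis by (simp add: exp_minus inverse_eq_divide)
  qed
  also have "\<dots> \<le> 1 - x / 4"
  proof -
    have "x * x \<le> x * 1" using assms by (intro mult_left_mono) auto
    then have "1 \<le> (1 - x / 4) * (1 + x / 2)" using assms by (simp add: algebra_simps)
    then show ?thesis using assms by (simp add: pos_divide_le_eq)
  qed
  finally show ?thesis .
qed

text \<open>Handles the points that lie in every set of a decreasing sequence: the dominating series
  is infinite there.\<close>

lemma suminf_ge_one_eq_top:
  fixes f :: "nat \<Rightarrow> ennreal"
  assumes "\<And>j. 1 \<le> f j"
  shows "(\<Sum>j. f j) = \<top>"
proof (rule ccontr)
  assume "(\<Sum>j. f j) \<noteq> \<top>"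
  then obtain n where n: "(\<Sum>j. f j) < of_nat n" using ennreal_Ex_less_of_nat less_top by blast
  have "of_nat n = (\<Sum>j<n. 1 :: ennreal)" by simp
  also have "\<dots> \<le> (\<Sum>j<n. f j)" by (intro sum_mono assms)
  also have "\<dots> \<le> (\<Sum>j. f j)" by (rule sum_le_suminf) auto
  finally show False using n by simp
qed

text \<open>
  A dyadic decomposition of the neighbourhood of the axis, on which the density may blow up.
\<close>
lemma nn_integral_near_axis_le:
  fixes f :: "real \<Rightarrow> ennreal"
  assumes a: "a \<in> Sph m" and t: "0 < t" "t \<le> 1" and r: "0 < r" "r \<le> 1"
    and f: "\<And>x. 0 < x \<Longrightarrow> x \<le> t \<Longrightarrow> f x \<le> ennreal (H * (x / t) powr (- \<beta>))" and H: "1 \<le> H"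
    and be: "0 \<le> \<beta>" "\<beta> < real m" and g: "0 < g" "g \<le> 1" "g \<le> real m - \<beta>"
  shows "(\<integral>\<^sup>+y. f (axis_sin m a y) * indicator (sector m a (t * r)) y \<partial>LM m) \<le>
    ennreal (48 * H / (t * g) * (12 ^ m * r powr (real m - \<beta>))) * emeasure (LM m) (sector m a t)"
proof -
  define p where "p = real m - \<beta>"
  define x where "x j = r / 2 ^ j" for j :: nat
  define q where "q = (1 / 2 :: real) powr p"
  define B where "B = 12 * H / t * (12 ^ m * r powr p)"
  have x: "0 < x j" "x j \<le> 1" "x (Suc j) = x j / 2" for j
  proof -
    have "r \<le> 2 ^ j" using r(2) one_le_power[of "2::real" j] by linarith
    then show "0 < x j" "x j \<le> 1" "x (Suc j) = x j / 2" using r by (auto simp: x_def field_simps)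
  qed
  let ?c = "\<lambda>j. H * x (Suc j) powr (- \<beta>)"
  have c1: "1 \<le> ?c j" for j
  proof -
    have "1 \<le> x (Suc j) powr (- \<beta>)"
      using x(1,2)[of "Suc j"] be by (simp add: powr_minus powr_le1 one_le_inverse)
    then have "1 * 1 \<le> ?c j" using H by (intro mult_mono) auto
    then show ?thesis by simp
  qed
  \<comment> \<open>The layer with sine between t x_(j+1) and t x_j is enlarged to the whole sector
    of sine t x_j. On it the density is at most its bound at the inner radius,
    \<open>?c j\<close>.\<close>
  have pt: "f (axis_sin m a y) * indicator (sector m a (t * r)) y \<le>
      (\<Sum>j. ennreal (?c j) * indicator (sector m a (t * x j)) y)" (is "?lhs \<le> suminf ?F") for y
  proof (cases "y \<in> sector m a (t * r)")
    case True
    have tx: "0 < t * x j" "t * x j \<le> 1" for j using t x[of j] by (auto intro!: mult_le_one)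
    have tr: "0 < t * r" "t * r \<le> 1" using t r by (auto intro!: mult_le_one)
    have y1: "y \<in> sector m a 1" using True sector_mono[of "t * r" 1 m a] tr by auto
    define s where "s = axis_sin m a y"
    have s0: "0 \<le> s" unfolding s_def by (rule axis_sin_nonneg[OF a])
    have str: "s \<le> t * r" using True axis_sin_le_iff[OF a _ _ y1, of "t * r"] tr by (simp add: s_def)
    have iff: "y \<in> sector m a (t * x j) \<longleftrightarrow> s \<le> t * x j" for j
      using axis_sin_le_iff[OF a _ _ y1, of "t * x j"] tx[of j] by (simp add: s_def)
    show ?thesis
    proof (cases "s = 0")
      case True
      \<comment> \<open>On the axis the density may be infinite, but the point belongs to all the
        sectors and every coefficient is at least 1.\<close>
      have "?F j \<ge> 1" for j using c1[of j] iff[of j] True tx[of j] by (simp add: ennreal_leI[of 1, simplified])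
      then have "suminf ?F = \<top>" by (rule suminf_ge_one_eq_top)
      then show ?thesis by simp
    next
      case False
      then have s: "0 < s" using s0 by simp
      have "\<exists>j. t * x (Suc j) < s"
      proof -
        obtain n where "(1 / 2) ^ n < s / (t * r)"
          using real_arch_pow_inv[of "s / (t * r)" "1 / 2"] s tr by auto
        then have "t * x n < s" using tr by (simp add: x_def field_simps power_one_over)
        moreover have "x (Suc n) \<le> x n" using x(1)[of n] x(3)[of n] by simp
        ultimately have "t * x (Suc n) < s" using t by (meson le_less_trans mult_left_mono less_imp_le)
        then show ?thesis by blast
      qed
      define j where "j = (LEAST j. t * x (Suc j) < s)"
      have j: "t * x (Suc j) < s" unfolding j_def by (rule LeastI_ex) fact
      have sj: "s \<le> t * x j"
      proof (cases j)
        case 0 then show ?thesis using str by (simp add: x_def)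
      next
        case (Suc i)
        then have "i < (LEAST j. t * x (Suc j) < s)" unfolding j_def by simp
        then have "\<not> t * x (Suc i) < s" by (rule not_less_Least)
        then show ?thesis using Suc by simp
      qed
      have "t * r \<le> t * 1" using t r by (intro mult_left_mono) auto
      then have "f s \<le> ennreal (H * (s / t) powr (- \<beta>))" using s str by (intro f) auto
      also have "\<dots> \<le> ennreal (?c j)"
      proof (intro ennreal_leI mult_left_mono powr_mono2')
        show "x (Suc j) \<le> s / t" using j t by (simp add: pos_le_divide_eq mult.commute)
      qed (use H be x in auto)
      also have "\<dots> = ?F j" using sj iff by simp
      also have "\<dots> = sum ?F {j}"
        by (simp only: sum.insert finite.emptyI empty_iff not_False_eq_True sum.empty add_0_right)
      also have "\<dots> \<le> suminf ?F" by (rule sum_le_suminf) auto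
      finally show ?thesis using \<open>y \<in> sector m a (t * r)\<close> by (simp add: s_def)
    qed
  qed simp
  \<comment> \<open>The factor 6^m of the volume ratio and 2^\<beta> \<le> 2^m from the inner radius
    combine to 12^m; what remains decays like 2^(-j(m-\<beta>)).\<close>
  have cj: "?c j * (12 / t * (6 * x j) ^ m) \<le> B * q ^ j" for j
  proof -
    have "x (Suc j) powr (- \<beta>) = x j powr (- \<beta>) * 2 powr \<beta>"
      unfolding x(3)[of j] using x(1)[of j] by (simp add: powr_divide powr_minus_divide)
    also have "\<dots> \<le> x j powr (- \<beta>) * 2 ^ m"
    proof -
      have "(2::real) powr \<beta> \<le> 2 powr (real m)" using be by (intro powr_mono) auto
      then show ?thesis by (intro mult_left_mono) (auto simp: powr_realpow)
    qed
    finally have "?c j * (12 / t * (6 * x j) ^ m) \<le> H * (x j powr (- \<beta>) * 2 ^ m) * (12 / t * (6 * x j) ^ m)"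
      using H t x(1)[of j] by (intro mult_right_mono mult_left_mono) auto
    also have "\<dots> = 12 * H / t * (12 ^ m * (x j powr (- \<beta>) * x j ^ m))"
    proof -
      have e: "(2::real) ^ m * (6 * x j) ^ m = 12 ^ m * x j ^ m"
        using power_mult_distrib[of "2::real" 6 m] by (simp add: power_mult_distrib[of 6])
      have "H * (u * 2 ^ m) * (12 / t * (6 * x j) ^ m) = 12 * H / t * (u * (2 ^ m * (6 * x j) ^ m))" for u
        by (simp only: times_divide_eq_left times_divide_eq_right ac_simps)
      from this[of "x j powr (- \<beta>)"] show ?thesis unfolding e by (simp only: mult.left_commute)
    qed
    also have "x j powr (- \<beta>) * x j ^ m = x j powr p"
    proof -
      have "x j ^ m = x j powr real m" using x(1)[of j] by (rule powr_realpow[symmetric])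
      then show ?thesis by (simp add: p_def powr_add[symmetric])
    qed
    also have "x j powr p = r powr p * q ^ j"
    proof (induction j)
      case (Suc j)
      have "x (Suc j) powr p = (x j * (1 / 2)) powr p" unfolding x(3)[of j] by simp
      also have "\<dots> = x j powr p * q" unfolding q_def using x(1)[of j] by (subst powr_mult) auto
      finally show ?case using Suc by simp
    qed (simp add: x_def)
    also have "12 * H / t * (12 ^ m * (r powr p * q ^ j)) = B * q ^ j" by (simp add: B_def)
    finally show ?thesis .
  qed
  have q: "0 < q" "q \<le> 1 - g / 4" unfolding q_def using half_powr_le[of g p] g by (auto simp: p_def)
  have B: "0 \<le> B" using H t by (simp add: B_def)
  have "(\<integral>\<^sup>+y. f (axis_sin m a y) * indicator (sector m a (t * r)) y \<partial>LM m) \<le>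
     (\<integral>\<^sup>+y. (\<Sum>j. ennreal (?c j) * indicator (sector m a (t * x j)) y) \<partial>LM m)"
    by (intro nn_integral_mono pt)
  also have "\<dots> = (\<Sum>j. \<integral>\<^sup>+y. ennreal (?c j) * indicator (sector m a (t * x j)) y \<partial>LM m)"
    by (rule nn_integral_suminf) measurable
  also have "\<dots> = (\<Sum>j. ennreal (?c j) * emeasure (LM m) (sector m a (t * x j)))"
    by (simp add: nn_integral_cmult_indicator)
  also have "\<dots> \<le> (\<Sum>j. ennreal (B * q ^ j) * emeasure (LM m) (sector m a t))"
  proof (intro suminf_le allI)
    fix j
    have "ennreal (?c j) * emeasure (LM m) (sector m a (t * x j)) \<le>
        ennreal (?c j) * (ennreal (12 / t * (6 * x j) ^ m) * emeasure (LM m) (sector m a t))"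
      using x[of j] by (intro mult_left_mono emeasure_sector_ratio[OF a t]) auto
    also have "\<dots> = ennreal (?c j * (12 / t * (6 * x j) ^ m)) * emeasure (LM m) (sector m a t)"
      using c1[of j] t x(1)[of j] by (subst ennreal_mult) (auto simp: mult.assoc)
    also have "\<dots> \<le> ennreal (B * q ^ j) * emeasure (LM m) (sector m a t)"
      by (intro mult_right_mono ennreal_leI cj) auto
    finally show "ennreal (?c j) * emeasure (LM m) (sector m a (t * x j)) \<le> ennreal (B * q ^ j) * emeasure (LM m) (sector m a t)" .
  qed auto
  also have "\<dots> = ennreal (B * (1 / (1 - q))) * emeasure (LM m) (sector m a t)"
  proof -
    have "(\<lambda>j. B * q ^ j) sums (B * (1 / (1 - q)))"
      using q g by (intro sums_mult geometric_sums) auto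
    then have "(\<Sum>j. ennreal (B * q ^ j)) = ennreal (B * (1 / (1 - q)))"
      by (intro suminf_ennreal_eq) (use B q in auto)
    then show ?thesis by simp
  qed
  also have "\<dots> \<le> ennreal (48 * H / (t * g) * (12 ^ m * r powr (real m - \<beta>))) * emeasure (LM m) (sector m a t)"
  proof (intro mult_right_mono ennreal_leI)
    have "1 / (1 - q) \<le> 1 / (g / 4)" using q g by (intro divide_left_mono) auto
    then have "B * (1 / (1 - q)) \<le> B * (4 / g)" using B by (intro mult_left_mono) auto
    also have "\<dots> = 48 * H / (t * g) * (12 ^ m * r powr (real m - \<beta>))"
      by (simp add: B_def p_def)
    finally show "B * (1 / (1 - q)) \<le> 48 * H / (t * g) * (12 ^ m * r powr (real m - \<beta>))" .
  qed auto
  finally show ?thesis .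
qed

text \<open>For \<beta> = 0 the density is at most \<open>H\<close>, so the slab bound for the
  constant density 1 applies at once. The result is linear in \<delta>, with no loss from
  truncation.\<close>

lemma emeasure_slab_le_uniform:
  assumes adv: "adversarial m \<alpha> 0 H a \<mu>" and a: "a \<in> Sph m" and al: "0 < \<alpha>" "\<alpha> \<le> pi / 2"
    and H: "1 \<le> H" and \<delta>: "0 < \<delta>" and P: "P \<subseteq> Sph m" and G: "G \<in> sets borel" "G \<subseteq> slab m P \<delta>"
  shows "emeasure \<mu> G \<le> ennreal (54 * real (Suc m) ^ 3 * H / sin \<alpha> * \<delta>)"
proof -
  define t where "t = sin \<alpha>"
  have t: "0 < t" "t \<le> 1" using al pi_gt_zero by (auto simp: t_def intro!: sin_gt_zero)
  let ?V = "emeasure (LM m) (sector m a t)"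
  have V: "?V \<noteq> 0" "?V \<noteq> \<top>" using emeasure_sector_pos_finite[OF a t] by auto
  obtain k where k: "\<And>r. 0 < r \<Longrightarrow> r \<le> t \<Longrightarrow> k r \<le> ennreal (H * (r / t) powr (- 0))"
      "(0::real) = 0 \<longrightarrow> k 0 \<le> ennreal H"
    and \<mu>': "\<And>G. G \<in> sets borel \<Longrightarrow> G \<subseteq> Sph m \<Longrightarrow> emeasure \<mu> G =
      (\<integral>\<^sup>+y. k (axis_sin m a y) * indicator G (proj m y) * indicator (sector m a t) y \<partial>LM m) / ?V"
    using adversarial_density[OF adv a al order_refl, folded t_def] by blast
  have \<mu>: "emeasure \<mu> G = (\<integral>\<^sup>+y. k (axis_sin m a y) * indicator G (proj m y) * indicator (sector m a t) y \<partial>LM m) / ?V"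
    using G by (intro \<mu>') (auto simp: slab_def)
  have kH: "k (axis_sin m a y) \<le> ennreal H" if y: "y \<in> sector m a t" for y
  proof -
    have y1: "y \<in> sector m a 1" using y sector_mono[of t 1 m a] t by auto
    have r: "0 \<le> axis_sin m a y" "axis_sin m a y \<le> t"
      using axis_sin_nonneg[OF a] axis_sin_le_iff[OF a _ _ y1, of t] y t by auto
    then show ?thesis using k(1)[of "axis_sin m a y"] k(2) t
      by (cases "axis_sin m a y = 0") (auto simp: less_le)
  qed
  have Gp[measurable]: "G \<in> sets borel" by (rule G(1))
  have "(\<integral>\<^sup>+y. k (axis_sin m a y) * indicator G (proj m y) * indicator (sector m a t) y \<partial>LM m) \<le>
      (\<integral>\<^sup>+y. ennreal H * (1 * indicator G (proj m y) * indicator (sector m a t) y) \<partial>LM m)"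
    using kH by (intro nn_integral_mono) (auto simp: indicator_def)
  also have "\<dots> = ennreal H * (\<integral>\<^sup>+y. 1 * indicator G (proj m y) * indicator (sector m a t) y \<partial>LM m)"
    by (rule nn_integral_cmult) measurable
  also have "\<dots> \<le> ennreal H * (ennreal (54 * real (Suc m) ^ 3 * \<delta> / t) * (\<integral>\<^sup>+y. 1 * indicator (sector m a t) y \<partial>LM m))"
    using nn_integral_slab_le[OF a t(1) order_refl t(2) _ _ \<delta> P G(2), of "\<lambda>_. 1"]
    by (intro mult_left_mono) (auto simp: monotone_on_def)
  also have "\<dots> = ennreal (54 * real (Suc m) ^ 3 * H / t * \<delta>) * ?V"
  proof -
    have "54 * real (Suc m) ^ 3 * H / t * \<delta> = H * (54 * real (Suc m) ^ 3 * \<delta> / t)" by simp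
    then have "ennreal (54 * real (Suc m) ^ 3 * H / t * \<delta>) = ennreal H * ennreal (54 * real (Suc m) ^ 3 * \<delta> / t)"
      using H t \<delta> by (simp only: ennreal_mult) (intro ennreal_mult, auto)
    moreover have "(\<integral>\<^sup>+y. 1 * indicator (sector m a t) y \<partial>LM m) = ?V" by simp
    ultimately show ?thesis by (simp only: mult.assoc)
  qed
  finally have "emeasure \<mu> G \<le> ennreal (54 * real (Suc m) ^ 3 * H / t * \<delta>) * ?V / ?V"
    unfolding \<mu> by (rule divide_right_mono_ennreal)
  then have "emeasure \<mu> G \<le> ennreal (54 * real (Suc m) ^ 3 * H / t * \<delta>)"
    unfolding mult_divide_eq_ennreal[OF V] .
  then show ?thesis unfolding t_def .
qed

text \<open>The density is cut off at sine t\<tau> with \<tau> = sqrt \<delta>. Outside, the slab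
  contributes order \<delta>/(t\<tau>) = \<tau>/t; near the axis the mass is of order (12
  \<tau>^\<gamma>)^m. Both are O(\<tau>^\<gamma>) when \<tau> and 12 \<tau>^\<gamma> are below 1,
  and otherwise the bound exceeds 1.\<close>

lemma emeasure_slab_le:
  assumes adv: "adversarial m \<alpha> \<beta> H a \<mu>" and a: "a \<in> Sph m" and al: "0 < \<alpha>" "\<alpha> \<le> pi / 2"
    and be: "0 \<le> \<beta>" "\<beta> < real m"
    and H: "1 \<le> H" and \<delta>: "0 < \<delta>" and P: "P \<subseteq> Sph m" and G: "G \<in> sets borel" "G \<subseteq> slab m P \<delta>"
  defines "\<gamma> \<equiv> 1 - \<beta> / real m"
  shows "emeasure \<mu> G \<le> ennreal (630 * real (Suc m) ^ 3 * H / (sin \<alpha> * \<gamma>) * \<delta> powr (\<gamma> / 2))"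
proof -
  define t where "t = sin \<alpha>"
  have t: "0 < t" "t \<le> 1" using al pi_gt_zero by (auto simp: t_def intro!: sin_gt_zero)
  have \<gamma>: "0 < \<gamma>" "\<gamma> \<le> 1" "real m - \<beta> = \<gamma> * real m"
    using be by (auto simp: \<gamma>_def field_simps)
  have m1: "1 \<le> real m" using be by (cases m) auto
  have \<gamma>m: "\<gamma> \<le> real m - \<beta>" unfolding \<gamma>(3) using \<gamma>(1) m1 by simp
  define Q where "Q = real (Suc m) ^ 3 * H / (t * \<gamma>)"
  have Sm1: "1 \<le> real (Suc m) ^ 3" by (rule one_le_power) simp
  have Q1: "1 \<le> Q"
  proof -
    have "t * \<gamma> \<le> 1 * 1" using t \<gamma> by (intro mult_mono) auto
    moreover have "1 * 1 \<le> real (Suc m) ^ 3 * H" using Sm1 H by (intro mult_mono) auto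
    ultimately have "t * \<gamma> \<le> real (Suc m) ^ 3 * H" by linarith
    then show ?thesis using t \<gamma> by (simp add: Q_def)
  qed
  define \<tau> where "\<tau> = sqrt \<delta>"
  have \<tau>: "0 < \<tau>" "\<tau> powr \<gamma> = \<delta> powr (\<gamma> / 2)"
    using \<delta> by (auto simp: \<tau>_def powr_half_sqrt[symmetric] powr_powr)
  interpret prob_space \<mu> using adv by (simp add: adversarial_def)
  show ?thesis
  proof (cases "1 \<le> 12 * \<tau> powr \<gamma> \<or> 1 \<le> \<tau>")
    case True
    have "1 \<le> 12 * \<tau> powr \<gamma>"
      using True
    proof
      assume "1 \<le> \<tau>"
      then have "1 \<le> \<tau> powr \<gamma>" using \<gamma> by (simp add: ge_one_powr_ge_zero)
      then show ?thesis by simp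
    qed
    then have "1 * 1 \<le> (630 / 12 * Q) * (12 * \<tau> powr \<gamma>)" using Q1 by (intro mult_mono) auto
    then have ge: "1 \<le> 630 * real (Suc m) ^ 3 * H / (sin \<alpha> * \<gamma>) * \<delta> powr (\<gamma> / 2)"
      by (simp add: Q_def t_def \<tau>(2) mult_ac)
    have "emeasure \<mu> G \<le> ennreal 1" using emeasure_le_1[of G] by simp
    also have "\<dots> \<le> ennreal (630 * real (Suc m) ^ 3 * H / (sin \<alpha> * \<gamma>) * \<delta> powr (\<gamma> / 2))"
      using ge by (rule ennreal_leI)
    finally show ?thesis .
  next
    case False
    then have \<tau>1: "\<tau> < 1" "12 * \<tau> powr \<gamma> < 1" by auto
    let ?V = "emeasure (LM m) (sector m a t)"
    have V: "?V \<noteq> 0" "?V \<noteq> \<top>" using emeasure_sector_pos_finite[OF a t] by auto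
    obtain k where k: "antimono_on {0..t} k" "k \<in> borel_measurable borel"
        "\<And>r. 0 < r \<Longrightarrow> r \<le> t \<Longrightarrow> k r \<le> ennreal (H * (r / t) powr (- \<beta>))"
      and \<mu>: "\<And>G. G \<in> sets borel \<Longrightarrow> G \<subseteq> Sph m \<Longrightarrow> emeasure \<mu> G =
        (\<integral>\<^sup>+y. k (axis_sin m a y) * indicator G (proj m y) * indicator (sector m a t) y \<partial>LM m) / ?V"
      using adversarial_density[OF adv a al be(1), folded t_def] by blast
    define s where "s = t * \<tau>"
    have s: "0 < s" "s \<le> t" using t \<tau> \<tau>1 by (auto simp: s_def)
    note [measurable] = k(2) G(1)
    have ax: "0 \<le> axis_sin m a y" "axis_sin m a y \<le> t" "axis_sin m a y \<le> s \<longleftrightarrow> y \<in> sector m a s"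
      if y: "y \<in> sector m a t" for y
    proof -
      have y1: "y \<in> sector m a 1" using y sector_mono[of t 1 m a] t by auto
      show "0 \<le> axis_sin m a y" "axis_sin m a y \<le> t" "axis_sin m a y \<le> s \<longleftrightarrow> y \<in> sector m a s"
        using axis_sin_nonneg[OF a] axis_sin_le_iff[OF a _ _ y1, of t] axis_sin_le_iff[OF a _ _ y1, of s] y t s
        by auto
    qed
    \<comment> \<open>Truncation only lowers the density, whose total mass is 1.\<close>
    have total: "(\<integral>\<^sup>+y. k (max (axis_sin m a y) s) * indicator (sector m a t) y \<partial>LM m) \<le> ?V"
    proof -
      let ?X = "\<integral>\<^sup>+y. k (axis_sin m a y) * indicator (Sph m) (proj m y) * indicator (sector m a t) y \<partial>LM m"
      have "(\<integral>\<^sup>+y. k (max (axis_sin m a y) s) * indicator (sector m a t) y \<partial>LM m) \<le> ?X"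
      proof (intro nn_integral_mono)
        fix y
        show "k (max (axis_sin m a y) s) * indicator (sector m a t) y
          \<le> k (axis_sin m a y) * indicator (Sph m) (proj m y) * indicator (sector m a t) y"
        proof (cases "y \<in> sector m a t")
          case True
          have "proj m y \<in> Sph m" using True by (simp add: proj_in_Sph_iff sector_def)
          moreover have "k (max (axis_sin m a y) s) \<le> k (axis_sin m a y)"
            using ax[OF True] s by (intro monotone_onD[OF k(1)]) auto
          ultimately show ?thesis using True by simp
        qed simp
      qed
      also have "?X = ?X / ?V * ?V"
        using V by (simp add: ennreal_divide_times less_top)
      also have "\<dots> = emeasure \<mu> (Sph m) * ?V" by (subst \<mu>) auto
      also have "\<dots> \<le> 1 * ?V" by (intro mult_right_mono emeasure_le_1) auto
      finally show ?thesis by simp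
    qed
    have "(\<integral>\<^sup>+y. k (axis_sin m a y) * indicator G (proj m y) * indicator (sector m a t) y \<partial>LM m) \<le>
      (\<integral>\<^sup>+y. k (max (axis_sin m a y) s) * indicator G (proj m y) * indicator (sector m a t) y +
         k (axis_sin m a y) * indicator (sector m a s) y \<partial>LM m)"
    proof (intro nn_integral_mono)
      fix y
      show "k (axis_sin m a y) * indicator G (proj m y) * indicator (sector m a t) y \<le>
        k (max (axis_sin m a y) s) * indicator G (proj m y) * indicator (sector m a t) y +
         k (axis_sin m a y) * indicator (sector m a s) y"
        using ax(3)[of y] by (cases "y \<in> sector m a s") (auto simp: indicator_def max_def)
    qed
    also have "\<dots> = (\<integral>\<^sup>+y. k (max (axis_sin m a y) s) * indicator G (proj m y) * indicator (sector m a t) y \<partial>LM m) +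
         (\<integral>\<^sup>+y. k (axis_sin m a y) * indicator (sector m a s) y \<partial>LM m)"
      by (rule nn_integral_add) measurable
    also have "\<dots> \<le> ennreal (54 * real (Suc m) ^ 3 * \<delta> / s) * ?V +
       ennreal (48 * H / (t * \<gamma>) * (12 ^ m * \<tau> powr (real m - \<beta>))) * ?V"
    proof (intro add_mono)
      show "(\<integral>\<^sup>+y. k (max (axis_sin m a y) s) * indicator G (proj m y) * indicator (sector m a t) y \<partial>LM m)
          \<le> ennreal (54 * real (Suc m) ^ 3 * \<delta> / s) * ?V"
        by (rule order_trans[OF nn_integral_slab_le[OF a s t(2) k(1,2) \<delta> P G(2)] mult_left_mono[OF total]]) simp
      show "(\<integral>\<^sup>+y. k (axis_sin m a y) * indicator (sector m a s) y \<partial>LM m) \<le>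
          ennreal (48 * H / (t * \<gamma>) * (12 ^ m * \<tau> powr (real m - \<beta>))) * ?V"
        unfolding s_def
        by (rule nn_integral_near_axis_le[OF a t \<tau>(1) _ k(3) H be \<gamma>(1,2) \<gamma>m]) (use \<tau>1 in auto)
    qed
    also have "\<dots> = ennreal (54 * real (Suc m) ^ 3 * \<delta> / s + 48 * H / (t * \<gamma>) * (12 ^ m * \<tau> powr (real m - \<beta>))) * ?V"
      using s \<delta> H t \<gamma> by (subst ennreal_plus) (auto simp: distrib_right)
    \<comment> \<open>630 = 54 + 48 * 12. The second summand uses (12 \<tau>^\<gamma>)^m \<le> 12
      \<tau>^\<gamma>, valid because the base is below 1 and m \<ge> 1.\<close>
    also have "\<dots> \<le> ennreal (630 * Q * \<tau> powr \<gamma>) * ?V"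
    proof (intro mult_right_mono ennreal_leI)
      have "\<delta> = \<tau> * \<tau>" using \<delta> by (simp add: \<tau>_def)
      then have "54 * real (Suc m) ^ 3 * \<delta> / s = 54 * (real (Suc m) ^ 3 * 1 / (t * 1)) * \<tau>"
        using \<tau>(1) t by (simp add: s_def)
      also have "\<dots> \<le> 54 * Q * \<tau> powr \<gamma>"
      proof (intro mult_mono)
        show "real (Suc m) ^ 3 * 1 / (t * 1) \<le> Q" unfolding Q_def
          using H t \<gamma> by (intro frac_le mult_left_mono mult_pos_pos mult_nonneg_nonneg) auto
        show "\<tau> \<le> \<tau> powr \<gamma>" using powr_mono'[of \<gamma> 1 \<tau>] \<gamma> \<tau> \<tau>1 by simp
      qed (use Q1 \<tau> t in auto)
      finally have 1: "54 * real (Suc m) ^ 3 * \<delta> / s \<le> 54 * Q * \<tau> powr \<gamma>" .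
      have "12 ^ m * \<tau> powr (real m - \<beta>) = (12 * \<tau> powr \<gamma>) ^ m"
        using \<tau>(1) unfolding \<gamma>(3) power_mult_distrib by (simp add: powr_powr[symmetric] powr_realpow)
      also have "\<dots> \<le> (12 * \<tau> powr \<gamma>) ^ 1"
        using \<tau>1(2) m1 by (intro power_decreasing) auto
      finally have "48 * H / (t * \<gamma>) * (12 ^ m * \<tau> powr (real m - \<beta>)) \<le> 48 * H / (t * \<gamma>) * (12 * \<tau> powr \<gamma>) ^ 1"
        by (rule mult_left_mono) (use H t \<gamma> in auto)
      also have "\<dots> = 48 * (1 * H / (t * \<gamma>)) * (12 * \<tau> powr \<gamma>)" by simp
      also have "\<dots> \<le> 48 * Q * (12 * \<tau> powr \<gamma>)"
        unfolding Q_def using Sm1 H t \<gamma> by (intro mult_right_mono mult_left_mono divide_right_mono) auto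
      finally have 2: "48 * H / (t * \<gamma>) * (12 ^ m * \<tau> powr (real m - \<beta>)) \<le> 48 * Q * (12 * \<tau> powr \<gamma>)" .
      show "54 * real (Suc m) ^ 3 * \<delta> / s + 48 * H / (t * \<gamma>) * (12 ^ m * \<tau> powr (real m - \<beta>)) \<le> 630 * Q * \<tau> powr \<gamma>"
        using add_mono[OF 1 2] by (simp add: algebra_simps)
    qed auto
    finally have "emeasure \<mu> G \<le> ennreal (630 * Q * \<tau> powr \<gamma>) * ?V / ?V"
      using G(2) by (subst \<mu>) (auto simp: slab_def intro: divide_right_mono_ennreal)
    then show ?thesis unfolding mult_divide_eq_ennreal[OF V] by (simp add: Q_def t_def \<tau>(2) mult.assoc)
  qed
qed

subsection \<open>Random instances\<close>

text \<open>The index set is explicit because only the rows in \<open>J\<close> matter: a row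
  outside \<open>J\<close> can be integrated while this set stays fixed.\<close>

definition polar :: "nat \<Rightarrow> nat set \<Rightarrow> (nat \<Rightarrow> nat \<Rightarrow> real) \<Rightarrow> (nat \<Rightarrow> real) set" where
  "polar m J A = {x \<in> Sph m. \<forall>j\<in>J. dotp m (A j) x \<le> 0}"

lemma slab_mono: "\<delta> \<le> \<delta>' \<Longrightarrow> slab m P \<delta> \<subseteq> slab m P \<delta>'"
  by (force simp: slab_def)

text \<open>
  If every row \<open>A i\<close> left the slab of the others, there would be for each \<open>i\<close> a solution of the other
  inequalities at which the \<open>i\<close>-th one holds with margin; the sum of these solutions then satisfies all
  inequalities with margin.
\<close>
lemma feasible_without_margin:
  assumes A: "\<And>i. i < k \<Longrightarrow> A i \<in> Sph m" and e: "0 < e"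
    and x: "x \<in> Sph m" "\<And>i. i < k \<Longrightarrow> dotp m (A i) x \<le> 0"
    and no: "\<And>z. z \<in> Sph m \<Longrightarrow> \<exists>i<k. - e < dotp m (A i) z"
  shows "\<exists>i<k. A i \<in> slab m (polar m ({..<k} - {i}) A) (real k * e)"
proof (rule ccontr)
  assume contr: "\<not> ?thesis"
  have k: "0 < k" using no[OF x(1)] by auto
  have ke: "0 < real k * e" using k e by simp
  have "\<exists>w. w \<in> polar m ({..<k} - {i}) A \<and> dotp m (A i) w < - (real k * e)" if i: "i < k" for i
  proof -
    \<comment> \<open>The common solution \<open>x\<close> satisfies the first slab condition, so
      being outside the slab can only mean that the second one fails.\<close>
    have "x \<in> polar m ({..<k} - {i}) A" using x by (auto simp: polar_def)
    moreover have "dotp m (A i) x \<le> real k * e" using x(2)[OF i] ke by linarith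
    ultimately show ?thesis using contr i A[OF i] unfolding slab_def by force
  qed
  then obtain w where w: "\<And>i. i < k \<Longrightarrow> w i \<in> polar m ({..<k} - {i}) A"
    "\<And>i. i < k \<Longrightarrow> dotp m (A i) (w i) < - (real k * e)" by metis
  define W where "W = (\<lambda>l. \<Sum>i<k. w i l)"
  have AW: "dotp m (A i) W < - (real k * e)" if i: "i < k" for i
  proof -
    have "dotp m (A i) W = (\<Sum>l<k. dotp m (A i) (w l))" unfolding W_def by (rule dotp_sum_right)
    also have "\<dots> = dotp m (A i) (w i) + (\<Sum>l\<in>{..<k} - {i}. dotp m (A i) (w l))"
      using i by (subst sum.remove[of _ i]) auto
    also have "(\<Sum>l\<in>{..<k} - {i}. dotp m (A i) (w l)) \<le> 0"
      using w(1) i by (intro sum_nonpos) (auto simp: polar_def)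
    finally show ?thesis using w(2)[OF i] by linarith
  qed
  have wS: "w i \<in> Sph m" if "i < k" for i using w(1)[OF that] by (simp add: polar_def)
  \<comment> \<open>Normalising the sum of \<open>k\<close> unit vectors may divide the margin by
    \<open>k\<close>; this is why the slab has width \<open>real k * e\<close>.\<close>
  have LW: "L2_set W {..m} \<le> real k"
  proof -
    have "L2_set (\<lambda>l. \<Sum>i<j. w i l) {..m} \<le> real j" if "j \<le> k" for j
      using that
    proof (induction j)
      case (Suc j)
      have "L2_set (\<lambda>l. \<Sum>i<Suc j. w i l) {..m} \<le> L2_set (\<lambda>l. \<Sum>i<j. w i l) {..m} + L2_set (w j) {..m}"
        using L2_set_add_le[of "\<lambda>l. \<Sum>i<j. w i l" "w j" m] by simp
      then show ?case using Suc wS[of j] by simp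
    qed (simp add: L2_set_def)
    then show ?thesis by (simp add: W_def)
  qed
  have "\<bar>dotp m (A 0) W\<bar> \<le> L2_set W {..m}" using abs_dotp_le[of m "A 0" W] A[OF k] by simp
  then have pos: "0 < L2_set W {..m}" using AW[OF k] ke by linarith
  have "0 < dotp m W W" using pos by (simp add: L2_set_dotp)
  then have z: "(\<lambda>l. W l / L2_set W {..m}) \<in> Sph m"
    using wS by (intro normalize_in_Sph) (auto simp: W_def Sph_iff)
  obtain i where i: "i < k" "- e < dotp m (A i) (\<lambda>l. W l / L2_set W {..m})" using no[OF z] by blast
  then have "- e * L2_set W {..m} < dotp m (A i) W"
    using pos by (simp add: dotp_simps pos_less_divide_eq)
  moreover have "e * L2_set W {..m} \<le> e * real k" using LW e by (intro mult_left_mono) auto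
  ultimately show False using AW[OF i(1)] by (simp add: mult.commute)
qed

text \<open>
  Here \<open>k\<close> is the largest number of initial rows that are still feasible. If these rows have margin \<open>\<eta>\<close> at
  \<open>z\<close>, then \<open>x + \<eta> / 3 * z\<close> solves their inequalities, which puts \<open>A k\<close> into the slab.
\<close>
lemma infeasible_without_margin:
  assumes A: "\<And>i. i < n \<Longrightarrow> A i \<in> Sph m" and \<eta>: "0 < \<eta>" "\<eta> \<le> 1"
    and x: "x \<in> Sph m" "\<And>i. i < n \<Longrightarrow> dotp m (A i) x < \<eta>\<^sup>2 / 3"
    and inf: "\<And>y. y \<in> Sph m \<Longrightarrow> \<exists>i<n. 0 < dotp m (A i) y"
  shows "\<exists>k<n. (\<exists>i<k. A i \<in> slab m (polar m ({..<k} - {i}) A) (real k * \<eta>)) \<or> A k \<in> slab m (polar m {..<k} A) \<eta>"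
proof -
  let ?feas = "\<lambda>k. \<exists>y\<in>Sph m. \<forall>i<k. dotp m (A i) y \<le> 0"
  have n: "\<not> ?feas n" using inf by (meson not_le)
  have "\<exists>k. ?feas k \<and> \<not> ?feas (Suc k)"
  proof (rule ccontr)
    assume *: "\<not> (\<exists>k. ?feas k \<and> \<not> ?feas (Suc k))"
    have "?feas k" for k
    proof (induction k)
      case 0 show ?case using Sph_nonempty by auto
    next
      case (Suc k) then show ?case using * by blast
    qed
    then show False using n by blast
  qed
  then obtain k where k: "?feas k" "\<not> ?feas (Suc k)" by (elim exE conjE)
  have kn: "k < n"
  proof (rule ccontr)
    assume "\<not> k < n"
    then have "?feas n" using k(1) by (meson less_le_trans not_less)
    then show False using n by blast
  qed
  obtain y where y: "y \<in> Sph m" "\<And>i. i < k \<Longrightarrow> dotp m (A i) y \<le> 0" using k(1) by blast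
  show ?thesis
  proof (cases "\<forall>z\<in>Sph m. \<exists>i<k. - \<eta> < dotp m (A i) z")
    case True
    have "\<exists>i<k. A i \<in> slab m (polar m ({..<k} - {i}) A) (real k * \<eta>)"
      by (rule feasible_without_margin[OF _ \<eta>(1) y]) (use A kn True in auto)
    then show ?thesis using kn by blast
  next
    case False
    then obtain z where z: "z \<in> Sph m" "\<And>i. i < k \<Longrightarrow> dotp m (A i) z \<le> - \<eta>" by (meson not_le)
    define u where "u = (\<lambda>l. x l + \<eta> / 3 * z l)"
    have du: "dotp m c u = dotp m c x + \<eta> / 3 * dotp m c z" for c by (simp add: u_def dotp_simps)
    have Lu: "1 - \<eta> / 3 \<le> L2_set u {..m}"
    proof -
      have "L2_set x {..m} \<le> L2_set u {..m} + L2_set (\<lambda>l. (- \<eta> / 3) * z l) {..m}"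
        using L2_set_add_le[of u "\<lambda>l. (- \<eta> / 3) * z l" m] by (simp add: u_def)
      then show ?thesis using x(1) z(1) \<eta> unfolding L2_set_scale by simp
    qed
    then have pos: "0 < L2_set u {..m}" using \<eta> by linarith
    then have "0 < dotp m u u" by (simp add: L2_set_dotp)
    then have v: "(\<lambda>l. u l / L2_set u {..m}) \<in> Sph m" (is "?v \<in> _")
      using x(1) z(1) by (intro normalize_in_Sph) (auto simp: u_def Sph_iff)
    have "?v \<in> polar m {..<k} A"
    proof -
      have "dotp m (A i) u \<le> 0" if i: "i < k" for i
      proof -
        have "\<eta> / 3 * dotp m (A i) z \<le> \<eta> / 3 * (- \<eta>)" using z(2)[OF i] \<eta> by (intro mult_left_mono) auto
        moreover have "dotp m (A i) x < \<eta>\<^sup>2 / 3" using x(2) i kn by simp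
        ultimately show ?thesis unfolding du by (simp add: power2_eq_square)
      qed
      then show ?thesis using v pos by (auto simp: polar_def dotp_simps divide_nonpos_pos)
    qed
    \<comment> \<open>Before normalisation the product is at most \<eta>^2/3 + \<eta>/3 \<le>
      2\<eta>/3, and the length of \<open>u\<close> is at least 1 - \<eta>/3 \<ge> 2/3.\<close>
    moreover have "dotp m (A k) ?v \<le> \<eta>"
    proof -
      have "dotp m (A k) z \<le> 1" using abs_dotp_Sph_le[OF A[OF kn] z(1)] by linarith
      then have "\<eta> / 3 * dotp m (A k) z \<le> \<eta> / 3 * 1" using \<eta> by (intro mult_left_mono) auto
      moreover have "\<eta>\<^sup>2 \<le> \<eta>" using \<eta> by (simp add: power2_eq_square mult_left_le)
      ultimately have "dotp m (A k) u \<le> \<eta> * (2 / 3)" unfolding du using x(2)[OF kn] by linarith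
      also have "\<dots> \<le> \<eta> * L2_set u {..m}" using Lu \<eta> by (intro mult_left_mono) auto
      finally show ?thesis using pos by (simp add: dotp_simps pos_divide_le_eq)
    qed
    \<comment> \<open>Adding row \<open>k\<close> makes the prefix infeasible, so every unit vector
      in the polar cone of the earlier rows has a positive product with it.\<close>
    moreover have "- \<eta> \<le> dotp m (A k) w" if w: "w \<in> polar m {..<k} A" for w
    proof -
      have wS: "w \<in> Sph m" "\<And>j. j < k \<Longrightarrow> dotp m (A j) w \<le> 0" using w by (auto simp: polar_def)
      then obtain i where i: "i < Suc k" "0 < dotp m (A i) w" using k(2) by (meson not_le)
      then have "i = k" using wS(2)[of i] by (cases "i < k") auto
      then have "0 < dotp m (A k) w" using i by simp
      then show ?thesis using \<eta> by simp
    qed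
    ultimately have "A k \<in> slab m (polar m {..<k} A) \<eta>" using A[OF kn] by (auto simp: slab_def)
    then show ?thesis using kn by blast
  qed
qed

section \<open>Compactness and measurability of solvability\<close>

text \<open>The sphere is a closed subset of a product of intervals [-1,1], which is compact by
  Tychonoff.\<close>

lemma compact_Sph: "compact (Sph m)"
proof -
  have "compactin (product_topology (\<lambda>i::nat. euclideanreal) UNIV) (PiE UNIV (\<lambda>i. {-1..1}))"
    by (subst compactin_PiE) auto
  then have "compact (PiE UNIV (\<lambda>i::nat. {-1..1::real}))"
    by (simp add: euclidean_product_topology)
  moreover have "Sph m \<subseteq> PiE UNIV (\<lambda>i. {-1..1})"
  proof
    fix x assume x: "x \<in> Sph m"
    have "\<bar>x i\<bar> \<le> 1" for i
    proof (cases "i \<le> m")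
      case True
      have "\<bar>x i\<bar> \<le> L2_set (\<lambda>i. \<bar>x i\<bar>) {..m}" by (rule member_le_L2_set) (use True in auto)
      also have "\<dots> = 1" using Sph_L2[OF x] by (simp add: L2_set_def)
      finally show ?thesis .
    qed (use x in \<open>auto simp: Sph_iff\<close>)
    then show "x \<in> PiE UNIV (\<lambda>i. {-1..1})" by (auto simp: PiE_def extensional_def abs_le_iff minus_le_iff)
  qed
  ultimately show ?thesis using closed_Sph by (metis compact_Int_closed inf.absorb_iff2)
qed

lemma isCont_dotp: "isCont (\<lambda>x. dotp m c x) x"
  using continuous_on_dotp[of m c] by (simp add: dotp_commute[of m c] continuous_on_eq_continuous_at)

text \<open>The slack 1/(q+1) pays for moving a solution into the dense set \<open>D\<close>;
  conversely, compactness gives a limit point of approximate solutions, where the slack has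
  vanished. Solvability thus becomes a countable condition on the rows.\<close>

lemma solvable_iff_countable:
  assumes J: "finite J" and D: "D \<subseteq> Sph m" "Sph m \<subseteq> closure D"
  shows "(\<exists>x\<in>Sph m. \<forall>j\<in>J. dotp m (c j) x \<le> t j) \<longleftrightarrow>
    (\<forall>q::nat. \<exists>x\<in>D. \<forall>j\<in>J. dotp m (c j) x \<le> t j + 1 / real (Suc q))" (is "?l \<longleftrightarrow> ?r")
proof
  assume ?l
  then obtain x where x: "x \<in> Sph m" "\<And>j. j \<in> J \<Longrightarrow> dotp m (c j) x \<le> t j" by blast
  show ?r
  proof
    fix q :: nat
    let ?U = "\<Inter>j\<in>J. {y. dotp m (c j) y < t j + 1 / real (Suc q)}"
    have "open ?U"
      using J continuous_on_dotp
      by (intro open_INT ballI open_Collect_less) (auto simp: dotp_commute[of m "c _"])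
    moreover have "x \<in> ?U" using x(2) by (force intro: le_less_trans)
    moreover have "x \<in> closure D" using x(1) D(2) by blast
    ultimately obtain y where "y \<in> D" "y \<in> ?U" unfolding closure_iff_nhds_not_empty by blast
    then show "\<exists>x\<in>D. \<forall>j\<in>J. dotp m (c j) x \<le> t j + 1 / real (Suc q)" by (intro bexI[of _ y]) (auto intro: less_imp_le)
  qed
next
  assume ?r
  then obtain f where f: "\<And>q. f q \<in> D" "\<And>q j. j \<in> J \<Longrightarrow> dotp m (c j) (f q) \<le> t j + 1 / real (Suc q)" by metis
  have "seq_compact (Sph m)" using compact_Sph by (rule compact_imp_seq_compact)
  moreover have "\<forall>q. f q \<in> Sph m" using f(1) D(1) by blast
  ultimately obtain l r where l: "l \<in> Sph m" "strict_mono r" "(f \<circ> r) \<longlonglongrightarrow> l"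
    by (rule seq_compactE)
  have "dotp m (c j) l \<le> t j" if j: "j \<in> J" for j
  proof (rule LIMSEQ_le)
    show "(\<lambda>q. dotp m (c j) ((f \<circ> r) q)) \<longlonglongrightarrow> dotp m (c j) l"
      by (rule isCont_tendsto_compose[OF isCont_dotp l(3)])
    have "(\<lambda>q. t j + 1 / real (Suc q)) \<longlonglongrightarrow> t j + 0"
      by (intro tendsto_add tendsto_const LIMSEQ_Suc[OF lim_1_over_n])
    then show "(\<lambda>q. t j + 1 / real (Suc (r q))) \<longlonglongrightarrow> t j"
      using LIMSEQ_subseq_LIMSEQ[OF _ l(2)] by (fastforce simp: o_def)
    show "\<exists>N. \<forall>q\<ge>N. dotp m (c j) ((f \<circ> r) q) \<le> t j + 1 / real (Suc (r q))"
      using f(2)[OF j] by (auto simp del: of_nat_Suc)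
  qed
  then show ?l using l(1) by blast
qed

section \<open>Independent rows obeying a power law for slabs\<close>

text \<open>It isolates what the expectation bound uses, so that it can be instantiated with
  exponent (1 - \<beta>/m)/2 in general and with exponent 1 for \<beta> = 0.\<close>

locale slab_product =
  fixes n m :: nat and \<mu> :: "nat \<Rightarrow> (nat \<Rightarrow> real) measure" and C \<gamma> :: real
  assumes prob: "\<And>i. prob_space (\<mu> i)"
    and sets_\<mu>: "\<And>i. sets (\<mu> i) = sets (restrict_space borel (Sph m))"
    and slab_le: "\<And>i P \<delta> G. i < n \<Longrightarrow> 0 < \<delta> \<Longrightarrow> P \<subseteq> Sph m \<Longrightarrow> G \<in> sets borel \<Longrightarrow> G \<subseteq> slab m P \<delta> \<Longrightarrow>
      emeasure (\<mu> i) G \<le> ennreal (C * \<delta> powr \<gamma>)"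
    and C: "1 \<le> C" and \<gamma>: "0 < \<gamma>" "\<gamma> \<le> 1" and n: "3 \<le> n" and m: "1 \<le> m"
begin

abbreviation "PM \<equiv> \<Pi>\<^sub>M i\<in>{..<n}. \<mu> i"

lemma space_\<mu>: "space (\<mu> i) = Sph m"
  using sets_eq_imp_space_eq[OF sets_\<mu>] by (simp add: space_restrict_space)

lemma product_prob: "product_prob_space \<mu>"
  unfolding product_prob_space_def product_prob_space_axioms_def product_sigma_finite_def
  using prob by (auto intro: prob_space_imp_sigma_finite)

lemma space_PM: "A \<in> space PM \<Longrightarrow> A \<in> instances n m" "A \<in> space PM \<Longrightarrow> i < n \<Longrightarrow> A i \<in> Sph m"
  by (auto simp: space_PiM space_\<mu> instances_def)

lemma measurable_row_dotp:
  assumes "i < n"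
  shows "(\<lambda>A. dotp m (A i) x) \<in> borel_measurable PM"
proof -
  have "(\<lambda>y. dotp m y x) \<in> borel_measurable (\<mu> i)"
    using measurable_restrict_space1[OF borel_measurable_dotp[of m x], of "Sph m"]
    by (simp add: measurable_cong_sets[OF sets_\<mu> refl])
  moreover have "(\<lambda>A. A i) \<in> measurable PM (\<mu> i)"
    using assms by (intro measurable_component_singleton) auto
  ultimately show ?thesis by (rule measurable_compose_rev)
qed

lemma sets_solvable:
  assumes J: "J \<subseteq> {..<n}"
  shows "{A \<in> space PM. \<exists>x\<in>Sph m. \<forall>j\<in>J. dotp m (A j) x \<le> t j} \<in> sets PM"
proof -
  obtain D where D: "countable D" "D \<subseteq> Sph m" "Sph m \<subseteq> closure D" by (rule separable)
  have fin: "finite J" using J finite_subset by blast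
  have "{A \<in> space PM. \<forall>q::nat. \<exists>x\<in>D. \<forall>j\<in>J. dotp m (A j) x \<le> t j + 1 / real (Suc q)} \<in> sets PM"
  proof (intro sets.sets_Collect_countable_All sets.sets_Collect_countable_Ex'[OF _ D(1)] sets.sets_Collect_finite_All fin)
    fix q :: nat and x j assume "x \<in> D" "j \<in> J"
    then show "{A \<in> space PM. dotp m (A j) x \<le> t j + 1 / real (Suc q)} \<in> sets PM"
      using J by (intro borel_measurable_le measurable_row_dotp borel_measurable_const) auto
  qed
  then show ?thesis by (simp only: solvable_iff_countable[OF fin D(2,3)])
qed

text \<open>Both slab conditions are solvability statements with threshold 0 for the rows in
  \<open>J\<close> and another for row \<open>i\<close>. A violation of the lower bound is
  solvability with threshold -\<delta> - 1/(q+1) for some \<open>q\<close>.\<close>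

lemma sets_slab:
  assumes i: "i < n" and J: "J \<subseteq> {..<n}" "i \<notin> J"
  shows "{A \<in> space PM. A i \<in> slab m (polar m J A) \<delta>} \<in> sets PM"
proof -
  have iJ: "insert i J \<subseteq> {..<n}" using i J by auto
  let ?T = "\<lambda>\<tau>. {A \<in> space PM. \<exists>x\<in>Sph m. \<forall>j\<in>insert i J. dotp m (A j) x \<le> (if j = i then \<tau> else 0)}"
  have T: "?T \<tau> \<in> sets PM" for \<tau> by (rule sets_solvable[OF iJ])
  have Teq: "A \<in> ?T \<tau> \<longleftrightarrow> A \<in> space PM \<and> (\<exists>x\<in>polar m J A. dotp m (A i) x \<le> \<tau>)" for A \<tau>
    using J(2) by (auto simp: polar_def)
  have "{A \<in> space PM. A i \<in> slab m (polar m J A) \<delta>} = ?T \<delta> - (\<Union>q. ?T (- \<delta> - 1 / real (Suc q)))"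
  proof (intro set_eqI iffI)
    fix A assume A: "A \<in> {A \<in> space PM. A i \<in> slab m (polar m J A) \<delta>}"
    have "A \<notin> ?T (- \<delta> - 1 / real (Suc q))" for q
    proof
      assume "A \<in> ?T (- \<delta> - 1 / real (Suc q))"
      then obtain x where x: "x \<in> polar m J A" "dotp m (A i) x \<le> - \<delta> - 1 / real (Suc q)"
        unfolding Teq by blast
      have "0 < 1 / real (Suc q)" by simp
      moreover have "- \<delta> \<le> dotp m (A i) x" using A x(1) by (auto simp: slab_def)
      ultimately show False using x(2) by linarith
    qed
    moreover have "A \<in> ?T \<delta>" unfolding Teq using A by (auto simp: slab_def)
    ultimately show "A \<in> ?T \<delta> - (\<Union>q. ?T (- \<delta> - 1 / real (Suc q)))" by blast
  next
    fix A assume A: "A \<in> ?T \<delta> - (\<Union>q. ?T (- \<delta> - 1 / real (Suc q)))"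
    then have sp: "A \<in> space PM" and 1: "\<exists>x\<in>polar m J A. dotp m (A i) x \<le> \<delta>"
      unfolding Teq Diff_iff by blast+
    have 2: "\<not> dotp m (A i) x \<le> - \<delta> - 1 / real (Suc q)" if "x \<in> polar m J A" for x q
      using A sp that unfolding Diff_iff UN_iff Teq by blast
    have "- \<delta> \<le> dotp m (A i) x" if x: "x \<in> polar m J A" for x
    proof (rule ccontr)
      assume "\<not> ?thesis"
      then have "0 < - \<delta> - dotp m (A i) x" by simp
      then obtain q where "1 / real (Suc q) < - \<delta> - dotp m (A i) x"
        using reals_Archimedean[of "- \<delta> - dotp m (A i) x"] by (auto simp: inverse_eq_divide)
      then show False using 2[OF x, of q] by linarith
    qed
    with 1 show "A \<in> {A \<in> space PM. A i \<in> slab m (polar m J A) \<delta>}"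
      using sp space_PM(2)[OF sp i] by (auto simp: slab_def)
  qed
  also have "\<dots> \<in> sets PM" by (intro sets.Diff T sets.countable_UN image_subsetI)
  finally show ?thesis .
qed

text \<open>Fubini in row \<open>i\<close>: since \<open>i\<close> is not in \<open>J\<close>, the
  polar set is constant on each section, and the bound for a fixed slab applies.\<close>

lemma emeasure_slab_event_le:
  assumes i: "i < n" and J: "J \<subseteq> {..<n}" "i \<notin> J" and \<delta>: "0 < \<delta>"
  shows "emeasure PM {A \<in> space PM. A i \<in> slab m (polar m J A) \<delta>} \<le> ennreal (C * \<delta> powr \<gamma>)"
proof -
  interpret product_prob_space \<mu> by (rule product_prob)
  let ?S = "{A \<in> space PM. A i \<in> slab m (polar m J A) \<delta>}"
  let ?I = "{..<n} - {i}"
  let ?PI = "\<Pi>\<^sub>M i\<in>?I. \<mu> i"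
  have ins: "insert i ?I = {..<n}" using i by auto
  have S: "?S \<in> sets PM" by (rule sets_slab[OF i J])
  have "emeasure PM ?S = (\<integral>\<^sup>+A. indicator ?S A \<partial>PM)" using S by simp
  also have "\<dots> = (\<integral>\<^sup>+A. (\<integral>\<^sup>+y. indicator ?S (A(i := y)) \<partial>\<mu> i) \<partial>?PI)"
    using product_nn_integral_insert[of ?I i "indicator ?S"] S unfolding ins by simp
  also have "\<dots> \<le> (\<integral>\<^sup>+A. ennreal (C * \<delta> powr \<gamma>) \<partial>?PI)"
  proof (intro nn_integral_mono)
    fix A assume A: "A \<in> space ?PI"
    define G where "G = {y \<in> space (\<mu> i). A(i := y) \<in> ?S}"
    have "(\<lambda>y. A(i := y)) \<in> measurable (\<mu> i) (Pi\<^sub>M (insert i ?I) \<mu>)"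
      using A by (intro measurable_fun_upd[where J = ?I]) auto
    then have "(\<lambda>y. A(i := y)) -` ?S \<inter> space (\<mu> i) \<in> sets (\<mu> i)"
      unfolding ins using S by (rule measurable_sets)
    also have "(\<lambda>y. A(i := y)) -` ?S \<inter> space (\<mu> i) = G" by (auto simp: G_def)
    finally have G: "G \<in> sets (\<mu> i)" .
    then have Gb: "G \<in> sets borel"
      unfolding sets_\<mu> by (subst (asm) sets_restrict_space_iff) auto
    have "G \<subseteq> slab m (polar m J A) \<delta>"
    proof
      fix y assume "y \<in> G"
      then have "y \<in> slab m (polar m J (A(i := y))) \<delta>" by (auto simp: G_def)
      moreover have "polar m J (A(i := y)) = polar m J A" using J(2) by (auto simp: polar_def)
      ultimately show "y \<in> slab m (polar m J A) \<delta>" by simp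
    qed
    then have "emeasure (\<mu> i) G \<le> ennreal (C * \<delta> powr \<gamma>)"
      by (intro slab_le[OF i \<delta> _ Gb]) (auto simp: polar_def)
    moreover have "(\<integral>\<^sup>+y. indicator ?S (A(i := y)) \<partial>\<mu> i) = (\<integral>\<^sup>+y. indicator G y \<partial>\<mu> i)"
      by (intro nn_integral_cong) (auto simp: G_def indicator_def)
    ultimately show "(\<integral>\<^sup>+y. indicator ?S (A(i := y)) \<partial>\<mu> i) \<le> ennreal (C * \<delta> powr \<gamma>)"
      using G by simp
  qed
  also have "\<dots> = ennreal (C * \<delta> powr \<gamma>)"
    using prob_space.emeasure_space_1[OF prob_space_PiM[of ?I \<mu>]] prob by simp
  finally show ?thesis .
qed

text \<open>The first family serves feasible instances with k = n and infeasible ones whose feasible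
  prefix lacks margin; the second serves those whose prefix has margin. All widths are enlarged to
  the common value n\<eta>.\<close>

definition near :: "real \<Rightarrow> (nat \<Rightarrow> nat \<Rightarrow> real) set" where
  "near \<eta> = (\<Union>k\<in>{..n}. \<Union>i\<in>{..<k}. {A \<in> space PM. A i \<in> slab m (polar m ({..<k} - {i}) A) (real n * \<eta>)}) \<union>
     (\<Union>k\<in>{..<n}. {A \<in> space PM. A k \<in> slab m (polar m {..<k} A) (real n * \<eta>)})"

lemma sets_near: "near \<eta> \<in> sets PM"
  unfolding near_def
  by (intro sets.Un sets.finite_UN sets_slab) auto

lemma emeasure_near_le:
  assumes \<eta>: "0 < \<eta>"
  shows "emeasure PM (near \<eta>) \<le> ennreal (real n ^ 3 * C * \<eta> powr \<gamma>)"
proof -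
  let ?b = "ennreal (C * (real n * \<eta>) powr \<gamma>)"
  have n\<eta>: "0 < real n * \<eta>" using n \<eta> by simp
  let ?X = "\<lambda>k i. {A \<in> space PM. A i \<in> slab m (polar m ({..<k} - {i}) A) (real n * \<eta>)}"
  let ?Y = "\<lambda>k. {A \<in> space PM. A k \<in> slab m (polar m {..<k} A) (real n * \<eta>)}"
  have X: "?X k i \<in> sets PM" "emeasure PM (?X k i) \<le> ?b" if "k \<le> n" "i < k" for k i
  proof -
    have "{..<k} - {i} \<subseteq> {..<n}" "i < n" "i \<notin> {..<k} - {i}" using that by auto
    then show "?X k i \<in> sets PM" "emeasure PM (?X k i) \<le> ?b"
      using sets_slab[of i "{..<k} - {i}"] emeasure_slab_event_le[OF _ _ _ n\<eta>, of i "{..<k} - {i}"] by blast+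
  qed
  have Y: "?Y k \<in> sets PM" "emeasure PM (?Y k) \<le> ?b" if "k < n" for k
  proof -
    have "{..<k} \<subseteq> {..<n}" "k \<notin> {..<k}" using that by auto
    then show "?Y k \<in> sets PM" "emeasure PM (?Y k) \<le> ?b"
      using that sets_slab[of k "{..<k}"] emeasure_slab_event_le[OF _ _ _ n\<eta>, of k "{..<k}"] by blast+
  qed
  have UX: "(\<Union>i\<in>{..<k}. ?X k i) \<in> sets PM" if "k \<le> n" for k using X(1)[OF that] by (intro sets.finite_UN) auto
  have UXX: "(\<Union>k\<in>{..n}. \<Union>i\<in>{..<k}. ?X k i) \<in> sets PM" by (rule sets.finite_UN[OF finite_atMost UX]) simp
  have UY: "(\<Union>k\<in>{..<n}. ?Y k) \<in> sets PM" using Y(1) by (intro sets.finite_UN) auto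
  have "emeasure PM (near \<eta>) \<le> emeasure PM (\<Union>k\<in>{..n}. \<Union>i\<in>{..<k}. ?X k i) + emeasure PM (\<Union>k\<in>{..<n}. ?Y k)"
    unfolding near_def by (rule emeasure_subadditive[OF UXX UY])
  also have "\<dots> \<le> (\<Sum>k\<le>n. \<Sum>i<k. ?b) + (\<Sum>k<n. ?b)"
  proof (intro add_mono)
    have "emeasure PM (\<Union>k\<in>{..n}. \<Union>i\<in>{..<k}. ?X k i) \<le> (\<Sum>k\<le>n. emeasure PM (\<Union>i\<in>{..<k}. ?X k i))"
      by (rule emeasure_subadditive_finite[OF finite_atMost image_subsetI[OF UX]]) simp
    also have "\<dots> \<le> (\<Sum>k\<le>n. \<Sum>i<k. emeasure PM (?X k i))"
      by (intro sum_mono emeasure_subadditive_finite[OF finite_lessThan image_subsetI[OF X(1)]]) auto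
    also have "\<dots> \<le> (\<Sum>k\<le>n. \<Sum>i<k. ?b)" by (intro sum_mono X(2)) auto
    finally show "emeasure PM (\<Union>k\<in>{..n}. \<Union>i\<in>{..<k}. ?X k i) \<le> (\<Sum>k\<le>n. \<Sum>i<k. ?b)" .
    have "emeasure PM (\<Union>k\<in>{..<n}. ?Y k) \<le> (\<Sum>k<n. emeasure PM (?Y k))"
      by (rule emeasure_subadditive_finite[OF finite_lessThan image_subsetI[OF Y(1)]]) simp
    also have "\<dots> \<le> (\<Sum>k<n. ?b)" by (intro sum_mono Y(2)) auto
    finally show "emeasure PM (\<Union>k\<in>{..<n}. ?Y k) \<le> (\<Sum>k<n. ?b)" .
  qed
  also have "\<dots> = of_nat ((\<Sum>k\<le>n. k) + n) * ?b"
    by (simp add: sum_distrib_right[symmetric] distrib_right of_nat_sum[symmetric] del: of_nat_sum)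
  \<comment> \<open>There are n(n+1)/2 + n events, at most n^2 because n \<ge> 3. The width n\<eta>
    supplies the third factor n.\<close>
  also have "\<dots> \<le> of_nat (n ^ 2) * ?b"
  proof (intro mult_right_mono of_nat_mono)
    have "2 * (\<Sum>k\<le>n. k) = n * n + n" by (induction n) auto
    moreover have "3 * n \<le> n * n" by (rule mult_right_mono[OF n]) simp
    ultimately have "(\<Sum>k\<le>n. k) + n \<le> n * n" by linarith
    then show "(\<Sum>k\<le>n. k) + n \<le> n ^ 2" by (simp only: power2_eq_square)
  qed simp
  also have "\<dots> = ennreal (real n ^ 2 * (C * (real n * \<eta>) powr \<gamma>))"
    unfolding ennreal_of_nat_eq_real_of_nat using C by (subst ennreal_mult) auto
  also have "\<dots> \<le> ennreal (real n ^ 3 * C * \<eta> powr \<gamma>)"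
  proof (rule ennreal_leI)
    have "real n powr \<gamma> \<le> real n powr 1" using n \<gamma> by (intro powr_mono) auto
    then have "(real n * \<eta>) powr \<gamma> \<le> real n * \<eta> powr \<gamma>"
      using n \<eta> by (simp add: powr_mult mult_right_mono)
    then have "real n ^ 2 * (C * (real n * \<eta>) powr \<gamma>) \<le> real n ^ 2 * (C * (real n * \<eta> powr \<gamma>))"
      using C by (intro mult_left_mono) auto
    then show "real n ^ 2 * (C * (real n * \<eta>) powr \<gamma>) \<le> real n ^ 3 * C * \<eta> powr \<gamma>"
      by (simp add: power2_eq_square power3_eq_cube mult_ac)
  qed
  finally show ?thesis .
qed

text \<open>With \<eta> = exp (-s), margin e = \<eta>^2/3 gives ln (2/e) = ln 6 + 2s; without that
  margin, one of the two deterministic slab lemmas applies.\<close>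

lemma ln_gcc_le_or_near:
  assumes A: "A \<in> space PM" and s: "0 \<le> s"
  shows "ln_ennreal (gcc n m A) \<le> ennreal (ln 6 + 2 * s) \<or> A \<in> near (exp (- s))"
proof -
  define \<eta> where "\<eta> = exp (- s)"
  define e where "e = \<eta>\<^sup>2 / 3"
  have \<eta>: "0 < \<eta>" "\<eta> \<le> 1" using s by (auto simp: \<eta>_def)
  have "\<eta>\<^sup>2 \<le> \<eta>" using \<eta> by (simp add: power2_eq_square mult_left_le)
  then have e: "0 < e" "e \<le> 1" "e \<le> \<eta>" using \<eta> by (auto simp: e_def)
  have rows: "A i \<in> Sph m" if "i < n" for i using space_PM(2)[OF A that] .
  show ?thesis
  proof (cases "(\<exists>z\<in>Sph m. \<forall>i<n. dotp m (A i) z \<le> - e) \<or> (\<forall>x\<in>Sph m. \<exists>i<n. dotp m (A i) x \<ge> e)")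
    case True
    have "ln_ennreal (gcc n m A) \<le> ennreal (ln 2 - ln e)"
      by (rule ln_gcc_le[OF space_PM(1)[OF A] m _ e(1,2) True]) (use n in simp)
    also have "ln 2 - ln e = ln 6 + 2 * s"
    proof -
      have "ln e = - 2 * s - ln 3" unfolding e_def \<eta>_def by (simp add: ln_div ln_realpow)
      moreover have "ln 6 = ln 2 + ln (3::real)" using ln_mult[of 2 "3::real"] by simp
      ultimately show ?thesis by simp
    qed
    finally show ?thesis by simp
  next
    case False
    have incl: "A \<in> near \<eta>" if "k \<le> n" "i < k" "A i \<in> slab m (polar m ({..<k} - {i}) A) (real k * \<eta>)" for k i
    proof -
      have "real k * \<eta> \<le> real n * \<eta>" using that \<eta> by (intro mult_right_mono) auto
      then have "A i \<in> slab m (polar m ({..<k} - {i}) A) (real n * \<eta>)" using that slab_mono by blast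
      then show ?thesis unfolding near_def using that A by blast
    qed
    from False obtain x where x: "x \<in> Sph m" "\<And>i. i < n \<Longrightarrow> dotp m (A i) x < e" by (meson not_le)
    from False have no: "\<exists>i<n. - e < dotp m (A i) z" if "z \<in> Sph m" for z using that by (meson not_le)
    have "A \<in> near \<eta>"
    proof (cases "\<exists>y\<in>Sph m. \<forall>i<n. dotp m (A i) y \<le> 0")
      case True
      then obtain y where y: "y \<in> Sph m" "\<And>i. i < n \<Longrightarrow> dotp m (A i) y \<le> 0" by blast
      have "\<exists>i<n. A i \<in> slab m (polar m ({..<n} - {i}) A) (real n * \<eta>)"
        by (rule feasible_without_margin[OF rows \<eta>(1) y]) (use no e(3) in \<open>force+\<close>)
      then show ?thesis using incl[of n] by blast
    next
      case False
      have "\<exists>k<n. (\<exists>i<k. A i \<in> slab m (polar m ({..<k} - {i}) A) (real k * \<eta>)) \<or> A k \<in> slab m (polar m {..<k} A) \<eta>"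
        by (rule infeasible_without_margin[OF rows \<eta> x(1)])
           (use x(2) False in \<open>auto simp: e_def not_le\<close>)
      then obtain k where k: "k < n" "(\<exists>i<k. A i \<in> slab m (polar m ({..<k} - {i}) A) (real k * \<eta>)) \<or> A k \<in> slab m (polar m {..<k} A) \<eta>"
        by blast
      from k(2) show ?thesis
      proof
        assume "\<exists>i<k. A i \<in> slab m (polar m ({..<k} - {i}) A) (real k * \<eta>)"
        then show ?thesis using incl[of k] k(1) by auto
      next
        assume *: "A k \<in> slab m (polar m {..<k} A) \<eta>"
        have "1 * \<eta> \<le> real n * \<eta>" using n \<eta> by (intro mult_right_mono) auto
        then have "A k \<in> slab m (polar m {..<k} A) (real n * \<eta>)" using * slab_mono[of \<eta> "real n * \<eta>"] by auto
        then show ?thesis unfolding near_def using k(1) A by blast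
      qed
    qed
    then show ?thesis by (simp add: \<eta>_def)
  qed
qed

text \<open>Layer-cake summation: the levels \<open>s j\<close> are spaced so that the j-th near
  event has probability at most exp (-j). Each level adds 2/\<gamma> to the logarithm, and the
  geometric series sums to at most 2. The logarithm is dominated pointwise by a measurable series of
  indicators.\<close>

lemma nn_integral_ln_gcc_le:
  "(\<integral>\<^sup>+A. ln_ennreal (gcc n m A) \<partial>PM) \<le> ennreal (ln 6 + 2 / \<gamma> * (ln (real n ^ 3 * C) + 2))"
proof -
  define M where "M = real n ^ 3 * C"
  have "1 * 1 \<le> M" unfolding M_def using n C by (intro mult_mono one_le_power) auto
  then have M: "1 \<le> M" by simp
  define s where "s j = (ln M + real j) / \<gamma>" for j :: nat
  have s: "0 \<le> s j" for j using M \<gamma> by (simp add: s_def)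
  let ?E = "\<lambda>j. near (exp (- s j))"
  let ?X = "\<lambda>A. ln_ennreal (gcc n m A)"
  let ?F = "\<lambda>A j. ennreal (2 / \<gamma>) * indicator (?E j) A"
  define b where "b = ln 6 + 2 * (ln M / \<gamma>)"
  have b: "0 \<le> b" using M \<gamma> by (simp add: b_def)
  have pt: "?X A \<le> ennreal b + (\<Sum>j. ?F A j)" if A: "A \<in> space PM" for A
  proof (cases "\<exists>j. A \<notin> ?E j")
    case True
    define j where "j = (LEAST j. A \<notin> ?E j)"
    have j: "A \<notin> ?E j" unfolding j_def by (rule LeastI_ex[OF True])
    have i: "A \<in> ?E i" if "i < j" for i using not_less_Least that unfolding j_def by blast
    have "?X A \<le> ennreal (ln 6 + 2 * s j)" using ln_gcc_le_or_near[OF A s] j by blast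
    also have "ln 6 + 2 * s j = b + real j * (2 / \<gamma>)"
      using \<gamma> by (simp add: b_def s_def field_simps)
    also have "ennreal (b + real j * (2 / \<gamma>)) = ennreal b + ennreal (real j * (2 / \<gamma>))"
      using b \<gamma> by (intro ennreal_plus) auto
    also have "ennreal (real j * (2 / \<gamma>)) = ennreal (real j) * ennreal (2 / \<gamma>)"
      using \<gamma> by (intro ennreal_mult) auto
    also have "\<dots> = (\<Sum>i<j. ?F A i)"
      using i by (simp add: ennreal_of_nat_eq_real_of_nat)
    also have "\<dots> \<le> (\<Sum>i. ?F A i)" by (rule sum_le_suminf) auto
    finally show ?thesis by (simp add: add_left_mono)
  next
    case False
    have "1 \<le> ?F A j" for j
    proof -
      have "1 \<le> 2 / \<gamma>" using \<gamma> by (simp add: pos_le_divide_eq)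
      then have "ennreal 1 \<le> ennreal (2 / \<gamma>)" by (rule ennreal_leI)
      then show ?thesis using False by simp
    qed
    then have "(\<Sum>j. ?F A j) = \<top>" by (rule suminf_ge_one_eq_top)
    then show ?thesis by simp
  qed
  interpret PM: prob_space PM by (intro prob_space_PiM prob)
  have "(\<integral>\<^sup>+A. ?X A \<partial>PM) \<le> (\<integral>\<^sup>+A. ennreal b + (\<Sum>j. ?F A j) \<partial>PM)"
    by (intro nn_integral_mono pt)
  also have "\<dots> = ennreal b + (\<Sum>j. ennreal (2 / \<gamma>) * emeasure PM (?E j))"
    using sets_near by (subst nn_integral_add; (subst nn_integral_suminf)?)
      (auto simp: nn_integral_cmult_indicator PM.emeasure_space_1)
  also have "\<dots> \<le> ennreal b + (\<Sum>j. ennreal (2 / \<gamma> * exp (- 1) ^ j))"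
  proof (intro add_left_mono suminf_le allI)
    fix j
    have "M * exp (- s j) powr \<gamma> = exp (- 1) ^ j"
    proof -
      have "exp (- s j) powr \<gamma> = exp (- s j * \<gamma>)" by (simp add: powr_def mult.commute)
      also have "- s j * \<gamma> = - ln M + real j * (- 1)" using \<gamma> by (simp add: s_def)
      also have "exp \<dots> = inverse M * exp (- 1) ^ j"
        using M by (simp only: exp_add exp_minus exp_of_nat_mult) (simp add: power_inverse)
      finally show ?thesis using M by simp
    qed
    then have "emeasure PM (?E j) \<le> ennreal (exp (- 1) ^ j)"
      using emeasure_near_le[of "exp (- s j)"] by (simp add: M_def)
    then have "ennreal (2 / \<gamma>) * emeasure PM (?E j) \<le> ennreal (2 / \<gamma>) * ennreal (exp (- 1) ^ j)"
      by (rule mult_left_mono) simp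
    moreover have "ennreal (2 / \<gamma> * exp (- 1) ^ j) = ennreal (2 / \<gamma>) * ennreal (exp (- 1) ^ j)"
      using \<gamma> by (intro ennreal_mult) auto
    ultimately show "ennreal (2 / \<gamma>) * emeasure PM (?E j) \<le> ennreal (2 / \<gamma> * exp (- 1) ^ j)"
      by (simp only:)
  qed auto
  also have "(\<Sum>j. ennreal (2 / \<gamma> * exp (- 1) ^ j)) = ennreal (2 / \<gamma> * (1 / (1 - exp (- 1))))"
    using \<gamma> by (intro suminf_ennreal_eq sums_mult geometric_sums) auto
  also have "\<dots> \<le> ennreal (2 / \<gamma> * 2)"
  proof (intro ennreal_leI mult_left_mono)
    have "1 + 1 \<le> exp (1::real)" by (rule exp_ge_add_one_self)
    then have "exp (- 1 :: real) \<le> 1 / 2" by (simp add: exp_minus field_simps)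
    then show "1 / (1 - exp (- 1 :: real)) \<le> 2" by (simp add: pos_divide_le_eq)
  qed (use \<gamma> in auto)
  finally have "(\<integral>\<^sup>+A. ?X A \<partial>PM) \<le> ennreal b + ennreal (2 / \<gamma> * 2)" by (simp add: add_left_mono)
  also have "\<dots> = ennreal (b + 2 / \<gamma> * 2)" using b \<gamma> by (intro ennreal_plus[symmetric]) auto
  also have "b + 2 / \<gamma> * 2 = ln 6 + 2 / \<gamma> * (ln (real n ^ 3 * C) + 2)"
    by (simp add: b_def M_def distrib_left)
  finally show ?thesis .
qed

end

lemma nn_integral_ln_gcc_adversarial_le:
  assumes m: "1 \<le> m" and n: "m + 1 < n" and C: "1 \<le> C" and \<gamma>: "0 < \<gamma>" "\<gamma> \<le> 1"
    and adv: "\<And>i. i < n \<Longrightarrow> adversarial m \<alpha> \<beta> H (a i) (\<mu> i)"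
    and slab: "\<And>i P \<delta> G. i < n \<Longrightarrow> 0 < \<delta> \<Longrightarrow> P \<subseteq> Sph m \<Longrightarrow> G \<in> sets borel \<Longrightarrow> G \<subseteq> slab m P \<delta> \<Longrightarrow>
      emeasure (\<mu> i) G \<le> ennreal (C * \<delta> powr \<gamma>)"
  shows "(\<integral>\<^sup>+A. ln_ennreal (gcc n m A) \<partial>(\<Pi>\<^sub>M i\<in>{..<n}. \<mu> i)) \<le> ennreal (ln 6 + 2 / \<gamma> * (ln (real n ^ 3 * C) + 2))"
proof -
  \<comment> \<open>The locale asks for probability measures on the sphere at all indices, so those
    from \<open>n\<close> on are filled with a copy of the first; the product over
    \<open>{..<n}\<close> is unchanged.\<close>
  define \<mu>' where "\<mu>' i = (if i < n then \<mu> i else \<mu> 0)" for i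
  have adv': "adversarial m \<alpha> \<beta> H (if i < n then a i else a 0) (\<mu>' i)" for i
    using adv[of i] adv[of 0] n by (simp add: \<mu>'_def)
  interpret slab_product n m \<mu>' C \<gamma>
  proof (rule slab_product.intro)
    show "prob_space (\<mu>' i)" for i using adv'[of i] by (simp add: adversarial_def)
    show "sets (\<mu>' i) = sets (restrict_space borel (Sph m))" for i using sets_adversarial[OF adv'] .
    show "emeasure (\<mu>' i) G \<le> ennreal (C * \<delta> powr \<gamma>)"
      if "i < n" "0 < \<delta>" "P \<subseteq> Sph m" "G \<in> sets borel" "G \<subseteq> slab m P \<delta>" for i P \<delta> G
      using slab[OF that] that(1) by (simp add: \<mu>'_def)
  qed (use C \<gamma> m n in auto)
  have "(\<Pi>\<^sub>M i\<in>{..<n}. \<mu> i) = (\<Pi>\<^sub>M i\<in>{..<n}. \<mu>' i)" by (rule PiM_cong) (auto simp: \<mu>'_def)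
  then show ?thesis using nn_integral_ln_gcc_le by simp
qed

section \<open>Numerical constants and the two estimates\<close>

lemma ln_le_of_le_power2: "0 < x \<Longrightarrow> x \<le> 2 ^ k \<Longrightarrow> ln x \<le> 25 / 36 * real k" for x :: real
proof -
  assume "0 < x" "x \<le> 2 ^ k"
  then have "ln x \<le> ln (2 ^ k)" by (intro ln_mono) auto
  also have "\<dots> = real k * ln 2" by (simp add: ln_realpow)
  also have "\<dots> \<le> real k * (25 / 36)" using ln2_le_25_over_36 by (intro mult_left_mono) auto
  finally show ?thesis by simp
qed

theorem theorem1p2:
  shows "\<exists>K::real. K > 0 \<and>
    (\<forall>(m::nat) (n::nat) (\<alpha>::real) (\<sigma>::real) (\<beta>::real) (H::real)
       (a :: nat \<Rightarrow> nat \<Rightarrow> real) (\<mu> :: nat \<Rightarrow> (nat \<Rightarrow> real) measure).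
      m \<ge> 1 \<and> n > m + 1 \<and> 0 < \<alpha> \<and> \<alpha> \<le> pi / 2 \<and> \<sigma> = sin \<alpha> \<and>
      0 \<le> \<beta> \<and> \<beta> < real m \<and> H \<ge> 1 \<and>
      (\<forall>i<n. a i \<in> Sph m \<and> adversarial m \<alpha> \<beta> H (a i) (\<mu> i)) \<longrightarrow>
      (\<integral>\<^sup>+ A. ln_ennreal (gcc n m A) \<partial>(\<Pi>\<^sub>M i\<in>{..<n}. \<mu> i))
        \<le> ennreal (K * (1 - \<beta> / real m) powi (-2) * ln (real n * H / \<sigma>)) \<and>
      (\<beta> = 0 \<longrightarrow>
        (\<integral>\<^sup>+ A. ln_ennreal (gcc n m A) \<partial>(\<Pi>\<^sub>M i\<in>{..<n}. \<mu> i))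
          \<le> ennreal (12 * ln (real n) + 17 * ln (real m) + 6 * ln (1 / \<sigma>) + 8 * ln H + 29)))"
proof (intro exI[of _ 100] conjI allI impI; (elim conjE)?)
  fix m n :: nat and \<alpha> \<sigma> \<beta> H :: real and a :: "nat \<Rightarrow> nat \<Rightarrow> real" and \<mu> :: "nat \<Rightarrow> (nat \<Rightarrow> real) measure"
  assume m: "m \<ge> 1" and n: "n > m + 1" and \<alpha>: "0 < \<alpha>" "\<alpha> \<le> pi / 2" and \<sigma>_eq: "\<sigma> = sin \<alpha>"
    and \<beta>: "0 \<le> \<beta>" "\<beta> < real m" and H: "H \<ge> 1"
    and adv: "\<forall>i<n. a i \<in> Sph m \<and> adversarial m \<alpha> \<beta> H (a i) (\<mu> i)"
  let ?I = "\<integral>\<^sup>+ A. ln_ennreal (gcc n m A) \<partial>(\<Pi>\<^sub>M i\<in>{..<n}. \<mu> i)"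
  have \<sigma>: "0 < \<sigma>" "\<sigma> \<le> 1" using \<alpha> pi_gt_zero by (auto simp: \<sigma>_eq intro!: sin_gt_zero)
  have advI: "a i \<in> Sph m" "adversarial m \<alpha> \<beta> H (a i) (\<mu> i)" if "i < n" for i using adv that by auto
  have lnH: "0 \<le> ln H" and ln\<sigma>: "0 \<le> ln (1 / \<sigma>)" and lnm: "0 \<le> ln (real m)" and lnn: "0 \<le> ln (real n)"
    using H \<sigma> m n by (auto simp: ln_div)
  have Sm1: "1 \<le> real (Suc m) ^ 3" by (rule one_le_power) simp
  have H\<sigma>: "1 \<le> H / \<sigma>" using H \<sigma> by simp
  have ln6: "ln (6::real) \<le> 25 / 12" using ln_le_of_le_power2[of 6 3] by simp
  show "?I \<le> ennreal (100 * (1 - \<beta> / real m) powi (-2) * ln (real n * H / \<sigma>))"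
  proof -
    define g where "g = 1 - \<beta> / real m"
    have g: "0 < g" "g \<le> 1" using \<beta> by (auto simp: g_def field_simps)
    define C where "C = 630 * real (Suc m) ^ 3 * H / (\<sigma> * g)"
    have C_eq: "C = 630 * real (Suc m) ^ 3 * (H / \<sigma>) * (1 / g)" by (simp add: C_def)
    have C1: "1 \<le> C"
    proof -
      have "1 * 1 * 1 * 1 \<le> C" unfolding C_eq using Sm1 H\<sigma> H \<sigma> g by (intro mult_mono) auto
      then show ?thesis by simp
    qed
    have "?I \<le> ennreal (ln 6 + 2 / (g / 2) * (ln (real n ^ 3 * C) + 2))"
    proof (rule nn_integral_ln_gcc_adversarial_le[OF m n C1 _ _ advI(2)])
      show "emeasure (\<mu> i) G \<le> ennreal (C * \<delta> powr (g / 2))"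
        if "i < n" "0 < \<delta>" "P \<subseteq> Sph m" "G \<in> sets borel" "G \<subseteq> slab m P \<delta>" for i P \<delta> G
        unfolding C_def g_def \<sigma>_eq
        by (rule emeasure_slab_le[OF advI(2,1)[OF that(1)] \<alpha> \<beta> H that(2-5)])
    qed (use g in auto)
    also have "\<dots> \<le> ennreal (100 * (1 / g\<^sup>2) * ln (real n * H / \<sigma>))"
    proof (rule ennreal_leI)
      define L where "L = ln (real n * H / \<sigma>)"
      define q where "q = 1 / g"
      have q: "1 \<le> q" using g by (simp add: q_def)
      have L_eq: "L = ln (real n) + ln (H / \<sigma>)"
        unfolding L_def using n H \<sigma> ln_mult[of "real n" "H / \<sigma>"] by simp
      have H\<sigma>0: "0 \<le> ln (H / \<sigma>)" using H\<sigma> by simp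
      \<comment> \<open>n > m+1 \<ge> 2 gives n \<ge> 3 \<ge> e, so \<open>L\<close> is at least 1
        and can absorb additive constants.\<close>
      have "1 \<le> ln (3::real)" using exp_le by (simp add: ln_ge_iff)
      also have "\<dots> \<le> ln (real n)" using m n by (intro ln_mono) auto
      finally have L1: "1 \<le> L" using L_eq H\<sigma>0 by linarith
      \<comment> \<open>The logarithm of the factor 1/g in \<open>C\<close> is bounded by 1/g
        itself; together with the prefactor 4/g this produces the power -2.\<close>
      have lnq: "ln q \<le> q" using q ln_le_minus_one[of q] by simp
      have "ln (real (Suc m)) \<le> ln (real n)" using n by (intro ln_mono) auto
      moreover have "ln (real n ^ 3 * C) = 3 * ln (real n) + ln 630 + 3 * ln (real (Suc m)) + ln (H / \<sigma>) + ln q"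
      proof -
        have "ln C = ln 630 + 3 * ln (real (Suc m)) + ln (H / \<sigma>) + ln q"
          unfolding C_eq q_def[symmetric] using H \<sigma> H\<sigma> q
          by (simp add: ln_mult ln_realpow del: of_nat_Suc times_divide_eq_right)
        then show ?thesis using C1 n by (simp add: ln_mult ln_realpow)
      qed
      moreover have "ln (630::real) \<le> 7" using ln_le_of_le_power2[of 630 10] by simp
      ultimately have "ln (real n ^ 3 * C) + 2 \<le> 6 * L + 9 + q" using L_eq H\<sigma>0 lnq by linarith
      also have "\<dots> \<le> 6 * L * q + 9 * (L * q) + L * q"
      proof -
        have "1 * 1 \<le> L * q" "L * 1 \<le> L * q" "1 * q \<le> L * q"
          by (rule mult_mono; use L1 q in simp)+
        then show ?thesis by linarith
      qed
      finally have "4 * q * (ln (real n ^ 3 * C) + 2) \<le> 4 * q * (16 * (L * q))"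
        using q by (intro mult_left_mono) auto
      moreover have "1 * 1 * 1 \<le> L * q * q" using L1 q by (intro mult_mono) auto
      ultimately have "ln 6 + 4 * q * (ln (real n ^ 3 * C) + 2) \<le> 100 * (L * q * q)"
        using ln6 by (simp add: algebra_simps)
      then show "ln 6 + 2 / (g / 2) * (ln (real n ^ 3 * C) + 2) \<le> 100 * (1 / g\<^sup>2) * ln (real n * H / \<sigma>)"
        by (simp add: L_def q_def power2_eq_square)
    qed
    also have "1 / g\<^sup>2 = (1 - \<beta> / real m) powi (-2)" by (simp add: g_def power_int_minus inverse_eq_divide)
    finally show ?thesis .
  qed
  show "?I \<le> ennreal (12 * ln (real n) + 17 * ln (real m) + 6 * ln (1 / \<sigma>) + 8 * ln H + 29)" if \<beta>0: "\<beta> = 0"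
  proof -
    define C where "C = 54 * real (Suc m) ^ 3 * H / \<sigma>"
    have C_eq: "C = 54 * real (Suc m) ^ 3 * (H / \<sigma>)" by (simp add: C_def)
    have C1: "1 \<le> C"
    proof -
      have "1 * 1 * 1 \<le> C" unfolding C_eq using Sm1 H\<sigma> H \<sigma> by (intro mult_mono) auto
      then show ?thesis by simp
    qed
    have "?I \<le> ennreal (ln 6 + 2 / 1 * (ln (real n ^ 3 * C) + 2))"
    proof (rule nn_integral_ln_gcc_adversarial_le[OF m n C1 _ _ advI(2)])
      show "emeasure (\<mu> i) G \<le> ennreal (C * \<delta> powr 1)"
        if "i < n" "0 < \<delta>" "P \<subseteq> Sph m" "G \<in> sets borel" "G \<subseteq> slab m P \<delta>" for i P \<delta> G
        using emeasure_slab_le_uniform[OF advI(2)[OF that(1), unfolded \<beta>0] advI(1)[OF that(1)] \<alpha> H that(2-5)] that(2)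
        by (simp add: C_def \<sigma>_eq)
    qed auto
    also have "\<dots> \<le> ennreal (12 * ln (real n) + 17 * ln (real m) + 6 * ln (1 / \<sigma>) + 8 * ln H + 29)"
    proof (rule ennreal_leI)
      have "ln (real n ^ 3 * C) = 3 * ln (real n) + ln 54 + 3 * ln (real (Suc m)) + ln H + ln (1 / \<sigma>)"
      proof -
        have "ln (H / \<sigma>) = ln H + ln (1 / \<sigma>)" using H \<sigma> by (simp add: ln_div)
        moreover have "ln C = ln 54 + 3 * ln (real (Suc m)) + ln (H / \<sigma>)"
          unfolding C_eq using H \<sigma> H\<sigma>
          by (simp add: ln_mult ln_realpow del: of_nat_Suc times_divide_eq_right)
        ultimately show ?thesis using C1 n by (simp add: ln_mult ln_realpow)
      qed
      moreover have "ln (54::real) \<le> 25 / 6" using ln_le_of_le_power2[of 54 6] by simp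
      moreover have "ln (real (Suc m)) \<le> ln (real m) + 1"
      proof -
        have "ln (real (Suc m)) \<le> ln (2 * real m)" using m by (intro ln_mono) auto
        also have "\<dots> = ln 2 + ln (real m)" using m by (simp add: ln_mult)
        finally show ?thesis using ln2_le_25_over_36 by linarith
      qed
      \<comment> \<open>The left side is at most 6 ln n + 6 ln m + 2 ln (1/\<sigma>) + 2 ln H plus a
        constant below 21, and all these logarithms are nonnegative.\<close>
      ultimately show "ln 6 + 2 / 1 * (ln (real n ^ 3 * C) + 2)
          \<le> 12 * ln (real n) + 17 * ln (real m) + 6 * ln (1 / \<sigma>) + 8 * ln H + 29"
        using ln6 lnH ln\<sigma> lnm lnn by simp
    qed
    finally show ?thesis .
  qed
qed simp

end
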